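(* Over $\mathsf{RCA}_0$, $\forall X\,\exists Y\,(Y=X^{(\omega)})$ implies $\mathsf{RT}(!\omega)$.
   Context: A finite set $X\subseteq\mathbb{N}$ is exactly large if $|X|=\min(X)+1$; $[X]^{!\omega}$ is the set of exactly large subsets of $X$. $\mathsf{RT}(!\omega)$: for every infinite $M\subseteq\mathbb{N}$ and every $C:[\mathbb{N}]^{!\omega}\to 2$ there is an infinite $L\subseteq M$ with $C$ constant on $[L]^{!\omega}$. $X^{(\omega)}=\{(i,j):j\in X^{(i)}\}$ where $X^{(i)}$ is the $i$-th Turing jump; "$Y=X^{(\omega)}$" is formalized as: for every $n$ the $n$-th projection of $Y$ is $X^{(n)}$. *)

theory Defs
  imports Main
begin

(* Structures for the language of second order arithmetic.  The numbers of the structure are all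
   the elements of the type 'a; set quantifiers range over the family of sets carried by the
   structure.  (General semantics: nonstandard numbers and non-full families of sets are allowed.) *)

record 'a l2_structure =
  zero :: 'a  ("\<zero>\<index>")
  one :: 'a  ("\<one>\<index>")
  add :: "'a \<Rightarrow> 'a \<Rightarrow> 'a"  (infixl "\<oplus>\<index>" 65)
  mult :: "'a \<Rightarrow> 'a \<Rightarrow> 'a"  (infixl "\<otimes>\<index>" 70)
  less :: "'a \<Rightarrow> 'a \<Rightarrow> bool"  (infix "\<prec>\<index>" 50)
  set_part :: "'a set set"

datatype tm = Var nat | Zero | One | Add tm tm | Mult tm tm

(* Bounded quantifier formulas, with set variables.  In BAll x t and BEx x t the bound t lies
   outside the scope of x. *)
datatype bfm =
    Eq tm tm
  | Less tm tm
  | Mem tm nat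
  | Neg bfm
  | And bfm bfm
  | Or bfm bfm
  | BAll nat tm bfm
  | BEx nat tm bfm

context
  fixes M :: "'a l2_structure" (structure)
begin

primrec tval :: "(nat \<Rightarrow> 'a) \<Rightarrow> tm \<Rightarrow> 'a" where
  "tval v (Var x) = v x"
| "tval v Zero = \<zero>"
| "tval v One = \<one>"
| "tval v (Add s t) = tval v s \<oplus> tval v t"
| "tval v (Mult s t) = tval v s \<otimes> tval v t"

primrec sat :: "(nat \<Rightarrow> 'a) \<Rightarrow> (nat \<Rightarrow> 'a set) \<Rightarrow> bfm \<Rightarrow> bool" where
  "sat v V (Eq s t) \<longleftrightarrow> tval v s = tval v t"
| "sat v V (Less s t) \<longleftrightarrow> tval v s \<prec> tval v t"
| "sat v V (Mem t X) \<longleftrightarrow> tval v t \<in> V X"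
| "sat v V (Neg \<phi>) \<longleftrightarrow> \<not> sat v V \<phi>"
| "sat v V (And \<phi> \<psi>) \<longleftrightarrow> sat v V \<phi> \<and> sat v V \<psi>"
| "sat v V (Or \<phi> \<psi>) \<longleftrightarrow> sat v V \<phi> \<or> sat v V \<psi>"
| "sat v V (BAll x t \<phi>) \<longleftrightarrow> (\<forall>a. a \<prec> tval v t \<longrightarrow> sat (v(x := a)) V \<phi>)"
| "sat v V (BEx x t \<phi>) \<longleftrightarrow> (\<exists>a. a \<prec> tval v t \<and> sat (v(x := a)) V \<phi>)"

(* The classes {n. \<exists>m. \<phi>(n, m)} with \<phi> a bounded quantifier formula; the valuations
   supply number and set parameters. *)
definition sigma1 :: "'a set \<Rightarrow> bool" where
  "sigma1 P \<longleftrightarrow> (\<exists>\<phi> x y v V. range V \<subseteq> set_part M \<and>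
     P = {n. \<exists>m. sat (v(x := n, y := m)) V \<phi>})"

definition basic_axioms :: bool where
  "basic_axioms \<longleftrightarrow>
     (\<forall>n. n \<oplus> \<one> \<noteq> \<zero>) \<and>
     (\<forall>m n. m \<oplus> \<one> = n \<oplus> \<one> \<longrightarrow> m = n) \<and>
     (\<forall>m. m \<oplus> \<zero> = m) \<and>
     (\<forall>m n. m \<oplus> (n \<oplus> \<one>) = (m \<oplus> n) \<oplus> \<one>) \<and>
     (\<forall>m. m \<otimes> \<zero> = \<zero>) \<and>
     (\<forall>m n. m \<otimes> (n \<oplus> \<one>) = (m \<otimes> n) \<oplus> m) \<and>
     (\<forall>m. \<not> m \<prec> \<zero>) \<and>
     (\<forall>m n. m \<prec> n \<oplus> \<one> \<longleftrightarrow> m \<prec> n \<or> m = n)"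

definition sigma1_induction :: bool where
  "sigma1_induction \<longleftrightarrow>
     (\<forall>P. sigma1 P \<longrightarrow> \<zero> \<in> P \<longrightarrow> (\<forall>n. n \<in> P \<longrightarrow> n \<oplus> \<one> \<in> P) \<longrightarrow> (\<forall>n. n \<in> P))"

definition delta1_comprehension :: bool where
  "delta1_comprehension \<longleftrightarrow> (\<forall>P. sigma1 P \<longrightarrow> sigma1 (- P) \<longrightarrow> P \<in> set_part M)"

definition RCA0_model :: bool where
  "RCA0_model \<longleftrightarrow>
     set_part M \<noteq> {} \<and> basic_axioms \<and> sigma1_induction \<and> delta1_comprehension"

(* All notions below are evaluated inside the structure. *)

definition num :: "nat \<Rightarrow> 'a" where
  "num k = ((\<lambda>x. x \<oplus> \<one>) ^^ k) \<zero>"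

(* Pairs and finite sets are coded as in Simpson, Subsystems of Second Order Arithmetic, II.2.
   The pairing map is injective but not surjective. *)
definition pair :: "'a \<Rightarrow> 'a \<Rightarrow> 'a" where
  "pair i j = (i \<oplus> j) \<otimes> (i \<oplus> j) \<oplus> i"

definition fmem :: "'a \<Rightarrow> 'a \<Rightarrow> bool" where
  "fmem i s \<longleftrightarrow> (\<exists>k m n. s = pair (pair k m) n \<and> i \<prec> k \<and>
     (\<exists>q. n = q \<otimes> (m \<otimes> (i \<oplus> \<one>) \<oplus> \<one>)))"

(* Every number s has a coded extension {i. fmem i s}; the code of a finite set is the least
   number with that extension, so that each finite set has exactly one code. *)
definition finset_code :: "'a \<Rightarrow> bool" where
  "finset_code s \<longleftrightarrow> (\<forall>t. t \<prec> s \<longrightarrow> (\<exists>i. fmem i t \<noteq> fmem i s))"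

(* f codes a bijection from {i. i < k} onto the finite set s. *)
definition has_card :: "'a \<Rightarrow> 'a \<Rightarrow> bool" where
  "has_card s k \<longleftrightarrow> (\<exists>f.
     (\<forall>p. fmem p f \<longrightarrow> (\<exists>i x. p = pair i x \<and> i \<prec> k \<and> fmem x s)) \<and>
     (\<forall>i. i \<prec> k \<longrightarrow> (\<exists>!x. fmem (pair i x) f)) \<and>
     (\<forall>x. fmem x s \<longrightarrow> (\<exists>!i. fmem (pair i x) f)))"

definition is_min :: "'a \<Rightarrow> 'a \<Rightarrow> bool" where
  "is_min a s \<longleftrightarrow> fmem a s \<and> (\<forall>x. fmem x s \<longrightarrow> a \<prec> x \<or> a = x)"

definition exactly_large :: "'a \<Rightarrow> bool" where
  "exactly_large s \<longleftrightarrow> finset_code s \<and> (\<exists>a. is_min a s \<and> has_card s (a \<oplus> \<one>))"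

definition colouring :: "'a set \<Rightarrow> bool" where
  "colouring C \<longleftrightarrow>
     (\<forall>p \<in> C. \<exists>s c. p = pair s c \<and> exactly_large s \<and> (c = \<zero> \<or> c = \<one>)) \<and>
     (\<forall>s. exactly_large s \<longrightarrow> (\<exists>!c. pair s c \<in> C))"

definition unbounded :: "'a set \<Rightarrow> bool" where
  "unbounded A \<longleftrightarrow> (\<forall>n. \<exists>m \<in> A. n \<prec> m)"

definition homogeneous :: "'a set \<Rightarrow> 'a set \<Rightarrow> bool" where
  "homogeneous C L \<longleftrightarrow>
     (\<exists>c. \<forall>s. exactly_large s \<and> (\<forall>x. fmem x s \<longrightarrow> x \<in> L) \<longrightarrow> pair s c \<in> C)"

definition RT_exactly_large :: bool where
  "RT_exactly_large \<longleftrightarrow>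
     (\<forall>A \<in> set_part M. \<forall>C \<in> set_part M. unbounded A \<and> colouring C \<longrightarrow>
        (\<exists>L \<in> set_part M. unbounded L \<and> L \<subseteq> A \<and> homogeneous C L))"

(* Kleene's partial recursive functions relative to the oracle X, as unary functions on (codes of)
   tuples; indices are numbers of the structure.  D codes a finite set of triples (e, x, y), read
   as {e}(x) = y, and the clauses are: constants, identity, successor, the two projections,
   the oracle, pairing, composition, primitive recursion and minimization.  Each clause
   appeals only to triples with smaller index, or with the same index and smaller recursion
   argument, so a finite D closed under justification contains only correct computations. *)
definition justified :: "'a set \<Rightarrow> 'a \<Rightarrow> 'a \<Rightarrow> 'a \<Rightarrow> 'a \<Rightarrow> bool" where
  "justified X D e x y \<longleftrightarrow> (let T = (\<lambda>a u w. fmem (pair a (pair u w)) D) in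
     e = pair (num 0) y \<or>
     (e = pair (num 1) \<zero> \<and> y = x) \<or>
     (e = pair (num 2) \<zero> \<and> y = x \<oplus> \<one>) \<or>
     (e = pair (num 3) \<zero> \<and> (\<exists>u. x = pair y u)) \<or>
     (e = pair (num 4) \<zero> \<and> (\<exists>u. x = pair u y)) \<or>
     (e = pair (num 5) \<zero> \<and> (x \<in> X \<and> y = \<one> \<or> x \<notin> X \<and> y = \<zero>)) \<or>
     (\<exists>a b u w. e = pair (num 6) (pair a b) \<and> T a x u \<and> T b x w \<and> y = pair u w) \<or>
     (\<exists>a b u. e = pair (num 7) (pair a b) \<and> T b x u \<and> T a u y) \<or>
     (\<exists>a b p. e = pair (num 8) (pair a b) \<and> x = pair p \<zero> \<and> T a p y) \<or>
     (\<exists>a b p n u. e = pair (num 8) (pair a b) \<and> x = pair p (n \<oplus> \<one>) \<and>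
        T e (pair p n) u \<and> T b (pair p (pair n u)) y) \<or>
     (\<exists>a. e = pair (num 9) a \<and> T a (pair x y) \<zero> \<and>
        (\<forall>k. k \<prec> y \<longrightarrow> (\<exists>u. u \<noteq> \<zero> \<and> T a (pair x k) u))))"

definition computes :: "'a set \<Rightarrow> 'a \<Rightarrow> 'a \<Rightarrow> 'a \<Rightarrow> bool" where
  "computes X e x y \<longleftrightarrow> (\<exists>D. fmem (pair e (pair x y)) D \<and>
     (\<forall>a u w. fmem (pair a (pair u w)) D \<longrightarrow> justified X D a u w))"

(* A class of numbers of the structure, which need not belong to the sets of the structure. *)
definition jump :: "'a set \<Rightarrow> 'a set" where
  "jump X = {e. \<exists>y. computes X e e y}"

definition projection :: "'a set \<Rightarrow> 'a \<Rightarrow> 'a set" where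
  "projection Y i = {j. pair i j \<in> Y}"

(* Z is the n-th jump of X, for n a possibly nonstandard number: W is a set of the structure
   whose projections 0, ..., n are the successive jumps of X. *)
definition is_iterated_jump :: "'a \<Rightarrow> 'a set \<Rightarrow> 'a set \<Rightarrow> bool" where
  "is_iterated_jump n X Z \<longleftrightarrow> (\<exists>W \<in> set_part M. projection W \<zero> = X \<and>
     (\<forall>i. i \<prec> n \<longrightarrow> projection W (i \<oplus> \<one>) = jump (projection W i)) \<and> projection W n = Z)"

definition is_omega_jump :: "'a set \<Rightarrow> 'a set \<Rightarrow> bool" where
  "is_omega_jump X Y \<longleftrightarrow> (\<forall>n. is_iterated_jump n X (projection Y n))"

end

end

theory Submission imports Defs "HOL-Library.Countable_Set" begin

text \<open>The homogeneous set is built by limits instead of by an iteration of Ramsey's theorem. Put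
  \<open>c 0 = C\<close>. Given a colouring \<open>c n\<close> of finite sets and an unbounded set \<open>R n\<close>, choose an
  unbounded \<open>R (n + 1) \<subseteq> R n\<close> that is cohesive for the sets \<open>{x. c n (t \<union> {x}) = 1}\<close>, and let
  \<open>c (n + 1) t\<close> be the limit of \<open>c n (t \<union> {x})\<close> as \<open>x\<close> runs through \<open>R (n + 1)\<close>. Then pick the
  elements of \<open>H\<close> one after the other so that adding \<open>x\<close> to a set \<open>t\<close> of earlier elements, of which
  \<open>d + 1\<close> elements are missing for exact largeness, does not change the colour:
  \<open>c d (t \<union> {x}) = c (d + 1) t\<close>. The colour of an exactly large subset of \<open>H\<close> with minimum \<open>a\<close> is
  therefore \<open>c a {a}\<close>, and one of the two colour classes of \<open>H\<close> is unbounded.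

  Each stage is arithmetical in the previous one. The sections of the columns of an \<open>\<omega>\<close>-jump form a
  family of sets that is coded by one set and closed under arithmetical definability, because every
  \<open>\<Sigma>1\<close> class is a section of the jump. All stages live in this family, so the whole sequence is
  obtained by an arithmetical choice of their codes.\<close>

section \<open>Definable predicates\<close>

text \<open>The numbers of the model may be nonstandard, so the minimum \<open>a\<close> of an
  exactly large set, and with it the number of stages that concern this set, need not be a natural
  number of the metatheory. An external iteration over exponents would reach the standard ones only;
  whatever is repeated has to be an induction or a recursion inside the model. Arithmetical
  comprehension gives induction for arithmetical formulas, whereas the existence of a next stage is
  a statement about sets. Replacing the set quantifier by a quantifier over the column numbers of a
  single set \<open>U\<close> makes the choice of the next stage arithmetical in \<open>U\<close>.
  Only finitely many jumps, in the sense of the metatheory, separate one stage from the next, so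
  closure of the columns under formulas keeps the construction inside the family even through a
  nonstandard number of stages.\<close>

locale rca0 =
  fixes M :: "'a l2_structure" (structure)
  assumes model: "RCA0_model M"
begin

definition le :: "'a \<Rightarrow> 'a \<Rightarrow> bool" (infix "\<preceq>" 50) where
  "a \<preceq> b \<longleftrightarrow> a \<prec> b \<or> a = b"

text \<open>Predicates of valuations that are definable with set parameters from \<open>\<V>\<close>; numbers occur as
  parameters through \<open>trm_const\<close>. Variables are de Bruijn indices, and \<open>\<beta>\<close> says whether unbounded
  quantifiers are allowed.\<close>

inductive trm :: "((nat \<Rightarrow> 'a) \<Rightarrow> 'a) \<Rightarrow> bool" where
  trm_var: "trm (\<lambda>v. v i)"
| trm_const: "trm (\<lambda>v. c)"
| trm_add: "trm s \<Longrightarrow> trm t \<Longrightarrow> trm (\<lambda>v. s v \<oplus> t v)"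
| trm_mult: "trm s \<Longrightarrow> trm t \<Longrightarrow> trm (\<lambda>v. s v \<otimes> t v)"

inductive fm :: "bool \<Rightarrow> 'a set set \<Rightarrow> ((nat \<Rightarrow> 'a) \<Rightarrow> bool) \<Rightarrow> bool" for \<beta> \<V> where
  fm_eq: "trm s \<Longrightarrow> trm t \<Longrightarrow> fm \<beta> \<V> (\<lambda>v. s v = t v)"
| fm_less: "trm s \<Longrightarrow> trm t \<Longrightarrow> fm \<beta> \<V> (\<lambda>v. s v \<prec> t v)"
| fm_mem: "trm t \<Longrightarrow> Z \<in> \<V> \<Longrightarrow> fm \<beta> \<V> (\<lambda>v. t v \<in> Z)"
| fm_neg: "fm \<beta> \<V> P \<Longrightarrow> fm \<beta> \<V> (\<lambda>v. \<not> P v)"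
| fm_and: "fm \<beta> \<V> P \<Longrightarrow> fm \<beta> \<V> Q \<Longrightarrow> fm \<beta> \<V> (\<lambda>v. P v \<and> Q v)"
| fm_bex0: "trm t \<Longrightarrow> fm \<beta> \<V> Q \<Longrightarrow> fm \<beta> \<V> (\<lambda>v. \<exists>a. a \<prec> t v \<and> Q (case_nat a v))"
| fm_ex0: "\<beta> \<Longrightarrow> fm \<beta> \<V> Q \<Longrightarrow> fm \<beta> \<V> (\<lambda>v. \<exists>a. Q (case_nat a v))"

lemma joint_support:
  assumes "\<exists>N. \<forall>v w :: nat \<Rightarrow> 'a. (\<forall>i<N. v i = w i) \<longrightarrow> f v = f w"
    and "\<exists>N. \<forall>v w :: nat \<Rightarrow> 'a. (\<forall>i<N. v i = w i) \<longrightarrow> g v = g w"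
  shows "\<exists>N. \<forall>v w :: nat \<Rightarrow> 'a. (\<forall>i<N. v i = w i) \<longrightarrow> f v = f w \<and> g v = g w"
proof -
  obtain N1 where "\<forall>v w :: nat \<Rightarrow> 'a. (\<forall>i<N1. v i = w i) \<longrightarrow> f v = f w" using assms(1) ..
  moreover obtain N2 where "\<forall>v w :: nat \<Rightarrow> 'a. (\<forall>i<N2. v i = w i) \<longrightarrow> g v = g w" using assms(2) ..
  ultimately show ?thesis by (intro exI[of _ "max N1 N2"]) simp
qed

lemma trm_finite_support: "trm t \<Longrightarrow> \<exists>N. \<forall>v w. (\<forall>i<N. v i = w i) \<longrightarrow> t v = t w"
proof (induction rule: trm.induct)
  case (trm_var i) show ?case by (rule exI[of _ "Suc i"]) simp
next
  case (trm_add s t)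
  obtain N where N: "\<And>v w :: nat \<Rightarrow> 'a. (\<forall>i<N. v i = w i) \<Longrightarrow> s v = s w \<and> t v = t w"
    using joint_support[OF trm_add.IH] by blast
  show ?case by (intro exI[of _ N] allI impI) (drule N, simp)
next
  case (trm_mult s t)
  obtain N where N: "\<And>v w :: nat \<Rightarrow> 'a. (\<forall>i<N. v i = w i) \<Longrightarrow> s v = s w \<and> t v = t w"
    using joint_support[OF trm_mult.IH] by blast
  show ?case by (intro exI[of _ N] allI impI) (drule N, simp)
qed simp

text \<open>A quantified variable gets a name in \<open>fm_sat\<close>; the name must avoid all
  variables that the matrix reads, and there are finitely many of these.\<close>

lemma fm_finite_support: "fm \<beta> \<V> P \<Longrightarrow> \<exists>N. \<forall>v w. (\<forall>i<N. v i = w i) \<longrightarrow> P v = P w"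
proof (induction rule: fm.induct)
  case (fm_eq s t)
  obtain N where N: "\<And>v w :: nat \<Rightarrow> 'a. (\<forall>i<N. v i = w i) \<Longrightarrow> s v = s w \<and> t v = t w"
    using joint_support[OF fm_eq[THEN trm_finite_support]] by blast
  show ?case by (intro exI[of _ N] allI impI) (drule N, simp)
next
  case (fm_less s t)
  obtain N where N: "\<And>v w :: nat \<Rightarrow> 'a. (\<forall>i<N. v i = w i) \<Longrightarrow> s v = s w \<and> t v = t w"
    using joint_support[OF fm_less[THEN trm_finite_support]] by blast
  show ?case by (intro exI[of _ N] allI impI) (drule N, simp)
next
  case (fm_mem t Z)
  obtain N where N: "\<And>v w :: nat \<Rightarrow> 'a. (\<forall>i<N. v i = w i) \<Longrightarrow> t v = t w \<and> t v = t w"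
    using joint_support[OF fm_mem(1)[THEN trm_finite_support] fm_mem(1)[THEN trm_finite_support]] by blast
  show ?case by (intro exI[of _ N] allI impI) (drule N, simp)
next
  case (fm_neg P) then show ?case by simp
next
  case (fm_and P Q)
  obtain N where N: "\<And>v w :: nat \<Rightarrow> 'a. (\<forall>i<N. v i = w i) \<Longrightarrow> P v = P w \<and> Q v = Q w"
    using joint_support[OF fm_and.IH] by blast
  show ?case by (intro exI[of _ N] allI impI) (drule N, simp)
next
  case (fm_bex0 t Q)
  obtain N where N: "\<And>v w :: nat \<Rightarrow> 'a. (\<forall>i<N. v i = w i) \<Longrightarrow> t v = t w \<and> Q v = Q w"
    using joint_support[OF fm_bex0(1)[THEN trm_finite_support] fm_bex0.IH] by blast
  { fix v w :: "nat \<Rightarrow> 'a" assume e: "\<forall>i<N. v i = w i"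
    have "Q (case_nat a v) = Q (case_nat a w)" for a
      by (rule N[THEN conjunct2]) (use e in \<open>auto split: nat.split\<close>)
    with N[OF e] have "(\<exists>a. a \<prec> t v \<and> Q (case_nat a v)) = (\<exists>a. a \<prec> t w \<and> Q (case_nat a w))" by simp }
  then show ?case by blast
next
  case (fm_ex0 Q)
  then obtain N where N: "\<And>v w. (\<forall>i<N. v i = w i) \<Longrightarrow> Q v = Q w" by auto
  { fix v w :: "nat \<Rightarrow> 'a" assume e: "\<forall>i<N. v i = w i"
    have "Q (case_nat a v) = Q (case_nat a w)" for a
      by (rule N) (use e in \<open>auto split: nat.split\<close>)
    then have "(\<exists>a. Q (case_nat a v)) = (\<exists>a. Q (case_nat a w))" by simp }
  then show ?case by blast
qed

lemma fm_mono: "fm \<beta> \<V> P \<Longrightarrow> \<V> \<subseteq> \<W> \<Longrightarrow> \<beta> \<le> \<gamma> \<Longrightarrow> fm \<gamma> \<W> P"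
proof (induction rule: fm.induct)
  case (fm_mem t Z) then show ?case by (intro fm.fm_mem) auto
next
  case (fm_bex0 t Q) then show ?case using fm.fm_bex0[of t _ _ Q] by auto
next
  case (fm_ex0 Q) then show ?case using fm.fm_ex0[of \<gamma> \<W> Q] by auto
qed (simp_all add: fm.fm_eq fm.fm_less fm.fm_neg fm.fm_and)

text \<open>A valuation of set variables has only countably many values, while the family of
  parameters can be uncountable. A single predicate uses finitely many of them, and these can be
  enumerated in \<open>sigma1I\<close>.\<close>

lemma fm_finite_parameters: "fm \<beta> \<V> P \<Longrightarrow> \<exists>\<W>. finite \<W> \<and> \<W> \<subseteq> \<V> \<and> fm \<beta> \<W> P"
proof (induction rule: fm.induct)
  case (fm_eq s t) then show ?case by (intro exI[of _ "{}"]) (simp add: fm.fm_eq)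
next
  case (fm_less s t) then show ?case by (intro exI[of _ "{}"]) (simp add: fm.fm_less)
next
  case (fm_mem t Z) then show ?case by (intro exI[of _ "{Z}"]) (simp add: fm.fm_mem)
next
  case (fm_neg P) then show ?case using fm.fm_neg[of _ _ P] by auto
next
  case (fm_and P Q)
  then obtain W1 W2 where W: "finite W1" "W1 \<subseteq> \<V>" "fm \<beta> W1 P" "finite W2" "W2 \<subseteq> \<V>" "fm \<beta> W2 Q"
    by blast
  then have "fm \<beta> (W1 \<union> W2) P" "fm \<beta> (W1 \<union> W2) Q" by (auto elim!: fm_mono)
  with W show ?case by (intro exI[of _ "W1 \<union> W2"]) (simp add: fm.fm_and)
next
  case (fm_bex0 t Q) then show ?case using fm.fm_bex0[of t _ _ Q] by auto
next
  case (fm_ex0 Q) then show ?case using fm.fm_ex0[of _ _ Q] by auto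
qed

text \<open>The variables of a predicate are renamed along \<open>\<rho>\<close>; its numerical parameters become the
  values of fresh variables, chosen outside \<open>F\<close>.\<close>

lemma trm_tval:
  assumes "trm t" "finite F"
  shows "\<exists>s D g. finite D \<and> D \<inter> F = {} \<and> (\<forall>v. (\<forall>i\<in>D. v i = g i) \<longrightarrow> tval M v s = t (\<lambda>i. v (\<rho> i)))"
  using assms
proof (induction arbitrary: F rule: trm.induct)
  case (trm_var i) then show ?case
    by (intro exI[of _ "Var (\<rho> i)"] exI[of _ "{}"]) auto
next
  case (trm_const c)
  then obtain x :: nat where "x \<notin> F" using ex_new_if_finite infinite_UNIV_nat by blast
  then show ?case by (intro exI[of _ "Var x"] exI[of _ "{x}"] exI[of _ "\<lambda>_. c"]) auto
next
  case (trm_add s t)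
  from trm_add.IH(1)[OF trm_add.prems] obtain s' D g where 1: "finite D" "D \<inter> F = {}"
    "\<forall>v. (\<forall>i\<in>D. v i = g i) \<longrightarrow> tval M v s' = s (\<lambda>i. v (\<rho> i))"
    by (elim exE conjE) (rule that)
  have "finite (F \<union> D)" using 1(1) trm_add.prems by simp
  from trm_add.IH(2)[OF this] obtain t' D' g' where 2: "finite D'" "D' \<inter> (F \<union> D) = {}"
    "\<forall>v. (\<forall>i\<in>D'. v i = g' i) \<longrightarrow> tval M v t' = t (\<lambda>i. v (\<rho> i))"
    by (elim exE conjE) (rule that)
  let ?g = "\<lambda>i. if i \<in> D then g i else g' i"
  { fix v assume v: "\<forall>i\<in>D \<union> D'. v i = ?g i"
    then have "\<forall>i\<in>D. v i = g i" "\<forall>i\<in>D'. v i = g' i" using 2(2) by auto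
    with 1(3) 2(3) have "tval M v (Add s' t') = s (\<lambda>i. v (\<rho> i)) \<oplus> t (\<lambda>i. v (\<rho> i))" by simp }
  then have "\<forall>v. (\<forall>i\<in>D \<union> D'. v i = ?g i) \<longrightarrow> (tval M v (Add s' t') = s (\<lambda>i. v (\<rho> i)) \<oplus> t (\<lambda>i. v (\<rho> i)))" by blast
  moreover have "finite (D \<union> D')" "(D \<union> D') \<inter> F = {}" using 1(1,2) 2(1,2) by auto
  ultimately show ?case
    by (intro exI[of _ "Add s' t'"] exI[of _ "D \<union> D'"] exI[of _ ?g] conjI)
next
  case (trm_mult s t)
  from trm_mult.IH(1)[OF trm_mult.prems] obtain s' D g where 1: "finite D" "D \<inter> F = {}"
    "\<forall>v. (\<forall>i\<in>D. v i = g i) \<longrightarrow> tval M v s' = s (\<lambda>i. v (\<rho> i))"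
    by (elim exE conjE) (rule that)
  have "finite (F \<union> D)" using 1(1) trm_mult.prems by simp
  from trm_mult.IH(2)[OF this] obtain t' D' g' where 2: "finite D'" "D' \<inter> (F \<union> D) = {}"
    "\<forall>v. (\<forall>i\<in>D'. v i = g' i) \<longrightarrow> tval M v t' = t (\<lambda>i. v (\<rho> i))"
    by (elim exE conjE) (rule that)
  let ?g = "\<lambda>i. if i \<in> D then g i else g' i"
  { fix v assume v: "\<forall>i\<in>D \<union> D'. v i = ?g i"
    then have "\<forall>i\<in>D. v i = g i" "\<forall>i\<in>D'. v i = g' i" using 2(2) by auto
    with 1(3) 2(3) have "tval M v (Mult s' t') = s (\<lambda>i. v (\<rho> i)) \<otimes> t (\<lambda>i. v (\<rho> i))" by simp }
  then have "\<forall>v. (\<forall>i\<in>D \<union> D'. v i = ?g i) \<longrightarrow> (tval M v (Mult s' t') = s (\<lambda>i. v (\<rho> i)) \<otimes> t (\<lambda>i. v (\<rho> i)))" by blast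
  moreover have "finite (D \<union> D')" "(D \<union> D') \<inter> F = {}" using 1(1,2) 2(1,2) by auto
  ultimately show ?case
    by (intro exI[of _ "Mult s' t'"] exI[of _ "D \<union> D'"] exI[of _ ?g] conjI)
qed

lemma trm_tval2:
  assumes "trm s" "trm t" "finite F"
  shows "\<exists>s' t' D g. finite D \<and> D \<inter> F = {} \<and>
    (\<forall>v. (\<forall>i\<in>D. v i = g i) \<longrightarrow> tval M v s' = s (\<lambda>i. v (\<rho> i)) \<and> tval M v t' = t (\<lambda>i. v (\<rho> i)))"
proof -
  from trm_tval[OF assms(1,3), where \<rho> = \<rho>] obtain s' D g where 1: "finite D" "D \<inter> F = {}"
    "\<forall>v. (\<forall>i\<in>D. v i = g i) \<longrightarrow> tval M v s' = s (\<lambda>i. v (\<rho> i))"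
    by (elim exE conjE) (rule that)
  have "finite (F \<union> D)" using 1(1) assms(3) by simp
  from trm_tval[OF assms(2) this, where \<rho> = \<rho>] obtain t' D' g' where 2: "finite D'" "D' \<inter> (F \<union> D) = {}"
    "\<forall>v. (\<forall>i\<in>D'. v i = g' i) \<longrightarrow> tval M v t' = t (\<lambda>i. v (\<rho> i))"
    by (elim exE conjE) (rule that)
  let ?g = "\<lambda>i. if i \<in> D then g i else g' i"
  { fix v assume v: "\<forall>i\<in>D \<union> D'. v i = ?g i"
    then have "\<forall>i\<in>D. v i = g i" "\<forall>i\<in>D'. v i = g' i" using 2(2) by auto
    with 1(3) 2(3) have "tval M v s' = s (\<lambda>i. v (\<rho> i)) \<and> tval M v t' = t (\<lambda>i. v (\<rho> i))" by simp }
  then have "\<forall>v. (\<forall>i\<in>D \<union> D'. v i = ?g i) \<longrightarrow> (tval M v s' = s (\<lambda>i. v (\<rho> i)) \<and> tval M v t' = t (\<lambda>i. v (\<rho> i)))" by blast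
  moreover have "finite (D \<union> D')" "(D \<union> D') \<inter> F = {}" using 1(1,2) 2(1,2) by auto
  ultimately show ?thesis
    by (intro exI[of _ s'] exI[of _ t'] exI[of _ "D \<union> D'"] exI[of _ ?g] conjI)
qed

text \<open>The parameters are the values of \<open>V\<close>, so a membership atom can be named by
  a set variable. \<open>F\<close> collects the names already taken, which keeps the numerical
  parameters of two subformulas apart.\<close>

lemma fm_sat:
  assumes "fm \<beta> (range V) P" "\<not> \<beta>" "finite F"
  shows "\<exists>\<phi> D g. finite D \<and> D \<inter> F = {} \<and> (\<forall>v. (\<forall>i\<in>D. v i = g i) \<longrightarrow> sat M v V \<phi> = P (\<lambda>i. v (\<rho> i)))"
  using assms
proof (induction arbitrary: F \<rho> rule: fm.induct)
  case (fm_eq s t)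
  from trm_tval2[OF fm_eq(1,2,4), where \<rho> = \<rho>] obtain s' t' D g where "finite D" "D \<inter> F = {}"
    "\<forall>v. (\<forall>i\<in>D. v i = g i) \<longrightarrow> tval M v s' = s (\<lambda>i. v (\<rho> i)) \<and> tval M v t' = t (\<lambda>i. v (\<rho> i))"
    by (elim exE conjE) (rule that)
  then show ?case by (intro exI[of _ "Eq s' t'"] exI[of _ D] exI[of _ g]) auto
next
  case (fm_less s t)
  from trm_tval2[OF fm_less(1,2,4), where \<rho> = \<rho>] obtain s' t' D g where "finite D" "D \<inter> F = {}"
    "\<forall>v. (\<forall>i\<in>D. v i = g i) \<longrightarrow> tval M v s' = s (\<lambda>i. v (\<rho> i)) \<and> tval M v t' = t (\<lambda>i. v (\<rho> i))"
    by (elim exE conjE) (rule that)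
  then show ?case by (intro exI[of _ "Less s' t'"] exI[of _ D] exI[of _ g]) auto
next
  case (fm_mem t Z)
  then obtain X where "Z = V X" by auto
  moreover from trm_tval[OF fm_mem(1,4), where \<rho> = \<rho>] obtain t' D g where "finite D" "D \<inter> F = {}"
    "\<forall>v. (\<forall>i\<in>D. v i = g i) \<longrightarrow> tval M v t' = t (\<lambda>i. v (\<rho> i))"
    by (elim exE conjE) (rule that)
  ultimately show ?case by (intro exI[of _ "Mem t' X"] exI[of _ D] exI[of _ g]) auto
next
  case (fm_neg P)
  from fm_neg.IH[OF fm_neg.prems, where \<rho> = \<rho>] obtain \<phi> D g where "finite D" "D \<inter> F = {}"
    "\<forall>v. (\<forall>i\<in>D. v i = g i) \<longrightarrow> sat M v V \<phi> = P (\<lambda>i. v (\<rho> i))"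
    by (elim exE conjE) (rule that)
  then show ?case by (intro exI[of _ "Neg \<phi>"] exI[of _ D] exI[of _ g]) auto
next
  case (fm_and P Q)
  from fm_and.IH(1)[OF fm_and.prems, where \<rho> = \<rho>] obtain \<phi> D g where 1: "finite D" "D \<inter> F = {}"
    "\<forall>v. (\<forall>i\<in>D. v i = g i) \<longrightarrow> sat M v V \<phi> = P (\<lambda>i. v (\<rho> i))"
    by (elim exE conjE) (rule that)
  have "finite (F \<union> D)" using 1(1) fm_and.prems by simp
  from fm_and.IH(2)[OF fm_and.prems(1) this, where \<rho> = \<rho>] obtain \<psi> D' g' where 2: "finite D'" "D' \<inter> (F \<union> D) = {}"
    "\<forall>v. (\<forall>i\<in>D'. v i = g' i) \<longrightarrow> sat M v V \<psi> = Q (\<lambda>i. v (\<rho> i))"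
    by (elim exE conjE) (rule that)
  let ?g = "\<lambda>i. if i \<in> D then g i else g' i"
  { fix v assume v: "\<forall>i\<in>D \<union> D'. v i = ?g i"
    then have "\<forall>i\<in>D. v i = g i" "\<forall>i\<in>D'. v i = g' i" using 2(2) by auto
    with 1(3) 2(3) have "sat M v V (And \<phi> \<psi>) = (P (\<lambda>i. v (\<rho> i)) \<and> Q (\<lambda>i. v (\<rho> i)))" by simp }
  then have "\<forall>v. (\<forall>i\<in>D \<union> D'. v i = ?g i) \<longrightarrow> (sat M v V (And \<phi> \<psi>) = (P (\<lambda>i. v (\<rho> i)) \<and> Q (\<lambda>i. v (\<rho> i))))" by blast
  moreover have "finite (D \<union> D')" "(D \<union> D') \<inter> F = {}" using 1(1,2) 2(1,2) by auto
  ultimately show ?case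
    by (intro exI[of _ "And \<phi> \<psi>"] exI[of _ "D \<union> D'"] exI[of _ ?g] conjI)
next
  case (fm_bex0 t Q)
  obtain N where N: "\<And>v w. (\<forall>i<N. v i = w i) \<Longrightarrow> Q v = Q w" using fm_finite_support[OF fm_bex0(2)] by blast
  \<comment> \<open>The update \<open>v(x := a)\<close> must not disturb the renamed free variables
    on which \<open>Q\<close> depends, whence the image of the first \<open>N\<close>
    indices.\<close>
  obtain x where x: "x \<notin> F \<union> \<rho> ` {..<N}"
    using ex_new_if_finite[OF infinite_UNIV_nat, of "F \<union> \<rho> ` {..<N}"] fm_bex0.prems by auto
  have F': "finite (F \<union> {x})" using fm_bex0.prems by simp
  from trm_tval[OF fm_bex0(1) F', where \<rho> = \<rho>] obtain t' D g where 1: "finite D" "D \<inter> (F \<union> {x}) = {}"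
    "\<forall>v. (\<forall>i\<in>D. v i = g i) \<longrightarrow> tval M v t' = t (\<lambda>i. v (\<rho> i))"
    by (elim exE conjE) (rule that)
  have "finite (F \<union> {x} \<union> D)" using 1(1) F' by simp
  from fm_bex0.IH[OF fm_bex0.prems(1) this, where \<rho> = "case_nat x \<rho>"] obtain \<psi> D' g' where 2: "finite D'" "D' \<inter> (F \<union> {x} \<union> D) = {}"
    "\<forall>v. (\<forall>i\<in>D'. v i = g' i) \<longrightarrow> sat M v V \<psi> = Q (\<lambda>i. v (case_nat x \<rho> i))"
    by (elim exE conjE) (rule that)
  let ?g = "\<lambda>i. if i \<in> D then g i else g' i"
  { fix v assume v: "\<forall>i\<in>D \<union> D'. v i = ?g i"
    have t: "tval M v t' = t (\<lambda>i. v (\<rho> i))" using 1 v by auto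
    have "sat M (v(x := a)) V \<psi> = Q (case_nat a (\<lambda>i. v (\<rho> i)))" for a
    proof -
      have "\<forall>i\<in>D'. (v(x := a)) i = g' i" using v 1 2 x by auto
      then have "sat M (v(x := a)) V \<psi> = Q (\<lambda>i. (v(x := a)) (case_nat x \<rho> i))" using 2 by blast
      also have "\<dots> = Q (case_nat a (\<lambda>i. v (\<rho> i)))"
        by (rule N) (use x in \<open>auto split: nat.split\<close>)
      finally show ?thesis .
    qed
    with t have "sat M v V (BEx x t' \<psi>) = (\<exists>a. a \<prec> t (\<lambda>i. v (\<rho> i)) \<and> Q (case_nat a (\<lambda>i. v (\<rho> i))))" by simp }
  then have "\<forall>v. (\<forall>i\<in>D \<union> D'. v i = ?g i) \<longrightarrow> (sat M v V (BEx x t' \<psi>) = (\<exists>a. a \<prec> t (\<lambda>i. v (\<rho> i)) \<and> Q (case_nat a (\<lambda>i. v (\<rho> i)))))" by blast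
  moreover have "finite (D \<union> D')" "(D \<union> D') \<inter> F = {}" using 1(1,2) 2(1,2) by auto
  ultimately show ?case
    by (intro exI[of _ "BEx x t' \<psi>"] exI[of _ "D \<union> D'"] exI[of _ ?g] conjI)
next
  case (fm_ex0 Q) then show ?case by simp
qed

abbreviation S :: "'a set set" where "S \<equiv> set_part M"

abbreviation \<Delta>0 :: "((nat \<Rightarrow> 'a) \<Rightarrow> bool) \<Rightarrow> bool" where "\<Delta>0 \<equiv> fm False S"

lemma S_nonempty: "S \<noteq> {}"
  and basic: "basic_axioms M"
  and s1ind: "sigma1_induction M"
  and d1ca: "delta1_comprehension M"
  using model by (auto simp: RCA0_model_def)

lemma sigma1I:
  assumes "\<Delta>0 (\<lambda>v. Q (v 0) (v (Suc 0)))"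
  shows "sigma1 M {n. \<exists>m. Q n m}"
proof -
  obtain W where W: "finite W" "W \<subseteq> S" "fm False W (\<lambda>v. Q (v 0) (v (Suc 0)))"
    using fm_finite_parameters[OF assms] by blast
  obtain Z where Z: "Z \<in> S" using S_nonempty by blast
  \<comment> \<open>An enumeration needs a nonempty set, and \<open>W\<close> may be empty.\<close>
  define V where "V = from_nat_into (insert Z W)"
  have V: "range V = insert Z W" unfolding V_def using W(1) by (intro range_from_nat_into) (auto intro: countable_finite)
  have "fm False (range V) (\<lambda>v. Q (v 0) (v (Suc 0)))" by (rule fm_mono[OF W(3)]) (use V in auto)
  \<comment> \<open>0 and 1 are declared as taken, so that no numerical parameter is stored in the
    two free variables.\<close>
  from fm_sat[OF this not_False_eq_True[THEN iffD2, OF TrueI] finite_insert[THEN iffD2, OF finite_insert[THEN iffD2, OF finite.emptyI]], of 0 1 id]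
  obtain \<phi> D g where
    D: "D \<inter> {0,1} = {}" and s: "\<forall>v. (\<forall>i\<in>D. v i = g i) \<longrightarrow> sat M v V \<phi> = Q (v (id 0)) (v (id (Suc 0)))"
    by (elim exE conjE) (rule that)
  have "sat M (g(0 := n, 1 := m)) V \<phi> = Q n m" for n m
  proof -
    have "\<forall>i\<in>D. (g(0 := n, 1 := m)) i = g i" using D by auto
    from s[THEN spec, THEN mp, OF this] show ?thesis by (simp add: fun_upd_def)
  qed
  then have "{n. \<exists>m. Q n m} = {n. \<exists>m. sat M (g(0 := n, 1 := m)) V \<phi>}" by simp
  moreover have "range V \<subseteq> S" using V W(2) Z by auto
  ultimately show ?thesis unfolding sigma1_def by (intro exI conjI)
qed

lemma fm_ex: "\<beta> \<Longrightarrow> fm \<beta> \<V> (\<lambda>v. P (v 0) (\<lambda>i. v (Suc i))) \<Longrightarrow> fm \<beta> \<V> (\<lambda>v. \<exists>a. P a v)"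
  using fm_ex0[of \<beta> \<V> "\<lambda>v. P (v 0) (\<lambda>i. v (Suc i))"] by simp

lemma fm_bex: "trm t \<Longrightarrow> fm \<beta> \<V> (\<lambda>v. P (v 0) (\<lambda>i. v (Suc i))) \<Longrightarrow> fm \<beta> \<V> (\<lambda>v. \<exists>a. a \<prec> t v \<and> P a v)"
  using fm_bex0[of t \<beta> \<V> "\<lambda>v. P (v 0) (\<lambda>i. v (Suc i))"] by simp

lemma fm_or: "fm \<beta> \<V> P \<Longrightarrow> fm \<beta> \<V> Q \<Longrightarrow> fm \<beta> \<V> (\<lambda>v. P v \<or> Q v)"
  using fm_neg[OF fm_and[OF fm_neg fm_neg, of \<beta> \<V> P Q]] by simp

lemma fm_imp: "fm \<beta> \<V> P \<Longrightarrow> fm \<beta> \<V> Q \<Longrightarrow> fm \<beta> \<V> (\<lambda>v. P v \<longrightarrow> Q v)"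
  using fm_neg[OF fm_and[OF _ fm_neg, of \<beta> \<V> P Q]] by simp

lemma fm_iff: "fm \<beta> \<V> P \<Longrightarrow> fm \<beta> \<V> Q \<Longrightarrow> fm \<beta> \<V> (\<lambda>v. P v \<longleftrightarrow> Q v)"
  using fm_and[OF fm_imp fm_imp, of \<beta> \<V> P Q Q P] by (simp add: iff_conv_conj_imp)

lemma fm_all: "\<beta> \<Longrightarrow> fm \<beta> \<V> (\<lambda>v. P (v 0) (\<lambda>i. v (Suc i))) \<Longrightarrow> fm \<beta> \<V> (\<lambda>v. \<forall>a. P a v)"
  using fm_neg[OF fm_ex[OF _ fm_neg, of \<beta> \<V> P]] by simp

lemma fm_ball: "trm t \<Longrightarrow> fm \<beta> \<V> (\<lambda>v. P (v 0) (\<lambda>i. v (Suc i))) \<Longrightarrow> fm \<beta> \<V> (\<lambda>v. \<forall>a. a \<prec> t v \<longrightarrow> P a v)"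
  using fm_neg[OF fm_bex[OF _ fm_neg, of t \<beta> \<V> P]] by simp

lemma fm_const: "fm \<beta> \<V> (\<lambda>v. c)"
  using fm_eq[of "\<lambda>v. \<zero>" "\<lambda>v. \<zero>" \<beta> \<V>] fm_eq[of "\<lambda>v. \<zero>" "\<lambda>v. \<zero>", THEN fm_neg, of \<beta> \<V>]
  by (cases c) (auto simp: trm_const)

lemma fm_le: "trm s \<Longrightarrow> trm t \<Longrightarrow> fm \<beta> \<V> (\<lambda>v. s v \<preceq> t v)"
  unfolding le_def by (intro fm_or fm_less fm_eq)

lemmas fm_intros = fm_le fm_ball fm_bex fm_or fm_and fm_imp fm_neg fm_iff fm_eq fm_less fm_mem
lemmas trm_intros = trm_var trm_const trm_add trm_mult

section \<open>Substitution of terms into definable predicates\<close>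

lemma trm_subst:
  assumes "trm t" "\<And>i. trm (\<lambda>v. \<sigma> v i)"
  shows "trm (\<lambda>v. t (\<sigma> v))"
  using assms(1)
proof (induction rule: trm.induct)
  case (trm_var i) show ?case by (rule assms(2))
next
  case (trm_const c) show ?case by (rule trm.trm_const)
next
  case (trm_add s t) show ?case by (rule trm.trm_add[OF trm_add.IH])
next
  case (trm_mult s t) show ?case by (rule trm.trm_mult[OF trm_mult.IH])
qed

lemma fm_subst: "fm \<beta> \<V> P \<Longrightarrow> (\<And>i. trm (\<lambda>v. \<sigma> v i)) \<Longrightarrow> fm \<beta> \<V> (\<lambda>v. P (\<sigma> v))"
proof (induction arbitrary: \<sigma> rule: fm.induct)
  case (fm_bex0 t Q)
  have "trm (\<lambda>v. case_nat (v 0) (\<sigma> (\<lambda>i. v (Suc i))) i)" for i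
    using trm_subst[of "\<lambda>v. \<sigma> v j" "\<lambda>v i. v (Suc i)" for j, OF fm_bex0.prems trm_var] trm_var
    by (cases i) simp_all
  then have "fm \<beta> \<V> (\<lambda>v. Q (case_nat (v 0) (\<sigma> (\<lambda>i. v (Suc i)))))" by (rule fm_bex0.IH)
  then show ?case by (rule fm_bex[OF trm_subst[OF fm_bex0(1) fm_bex0.prems]])
next
  case (fm_ex0 Q)
  have "trm (\<lambda>v. case_nat (v 0) (\<sigma> (\<lambda>i. v (Suc i))) i)" for i
    using trm_subst[of "\<lambda>v. \<sigma> v j" "\<lambda>v i. v (Suc i)" for j, OF fm_ex0.prems trm_var] trm_var
    by (cases i) simp_all
  then have "fm \<beta> \<V> (\<lambda>v. Q (case_nat (v 0) (\<sigma> (\<lambda>i. v (Suc i)))))" by (rule fm_ex0.IH)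
  then show ?case by (rule fm_ex[OF fm_ex0(1)])
next
  case (fm_eq s t)
  show ?case
    by (rule fm.fm_eq[OF trm_subst[OF fm_eq(1) fm_eq.prems] trm_subst[OF fm_eq(2) fm_eq.prems]])
next
  case (fm_less s t)
  show ?case
    by (rule fm.fm_less[OF trm_subst[OF fm_less(1) fm_less.prems] trm_subst[OF fm_less(2) fm_less.prems]])
next
  case (fm_mem t Z)
  show ?case by (rule fm.fm_mem[OF trm_subst[OF fm_mem(1) fm_mem.prems] fm_mem(2)])
next
  case (fm_neg P)
  show ?case by (rule fm.fm_neg[OF fm_neg.IH[OF fm_neg.prems]])
next
  case (fm_and P Q)
  show ?case by (rule fm.fm_and[OF fm_and.IH(1)[OF fm_and.prems] fm_and.IH(2)[OF fm_and.prems]])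
qed

text \<open>Once a defined predicate is definable in its own variables, its use with arbitrary terms
  is a substitution, and the instance serves as an introduction rule.\<close>

lemma fm_inst1:
  assumes "fm \<beta> \<V> (\<lambda>v. R (v 0))" "trm s"
  shows "fm \<beta> \<V> (\<lambda>v. R (s v))"
  using fm_subst[OF assms(1), of "\<lambda>v i. s v"] assms(2) by simp

lemma fm_inst2:
  assumes "fm \<beta> \<V> (\<lambda>v. R (v 0) (v (Suc 0)))" "trm s" "trm t"
  shows "fm \<beta> \<V> (\<lambda>v. R (s v) (t v))"
proof -
  have "trm (\<lambda>v. if i = 0 then s v else t v)" for i :: nat using assms(2,3) by (cases "i = 0") simp_all
  from fm_subst[OF assms(1), where \<sigma> = "\<lambda>v i. if i = 0 then s v else t v", OF this] show ?thesis by simp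
qed

lemma fm_inst3:
  assumes "fm \<beta> \<V> (\<lambda>v. R (v 0) (v (Suc 0)) (v (Suc (Suc 0))))" "trm s" "trm t" "trm u"
  shows "fm \<beta> \<V> (\<lambda>v. R (s v) (t v) (u v))"
proof -
  have "trm (\<lambda>v. if i = 0 then s v else if i = Suc 0 then t v else u v)" for i :: nat
    using assms(2-4) by (cases "i = 0"; cases "i = Suc 0") simp_all
  from fm_subst[OF assms(1), where \<sigma> = "\<lambda>v i. if i = 0 then s v else if i = Suc 0 then t v else u v", OF this]
  show ?thesis by simp
qed

lemma fm_inst4:
  assumes "fm \<beta> \<V> (\<lambda>v. R (v 0) (v (Suc 0)) (v (Suc (Suc 0))) (v (Suc (Suc (Suc 0)))))"
    "trm s" "trm t" "trm u" "trm w"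
  shows "fm \<beta> \<V> (\<lambda>v. R (s v) (t v) (u v) (w v))"
proof -
  have "trm (\<lambda>v. if i = 0 then s v else if i = Suc 0 then t v else if i = Suc (Suc 0) then u v else w v)"
    for i :: nat using assms(2-5) by (cases "i = 0"; cases "i = Suc 0"; cases "i = Suc (Suc 0)") simp_all
  from fm_subst[OF assms(1), where \<sigma> = "\<lambda>v i. if i = 0 then s v else if i = Suc 0 then t v
    else if i = Suc (Suc 0) then u v else w v", OF this]
  show ?thesis by simp
qed

section \<open>Induction and comprehension for bounded formulas\<close>

lemma \<Sigma>1_induct:
  assumes "\<Delta>0 (\<lambda>v. Q (v 0) (v (Suc 0)))" "\<exists>m. Q \<zero> m" "\<And>n m. Q n m \<Longrightarrow> \<exists>m. Q (n \<oplus> \<one>) m"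
  shows "\<exists>m. Q n m"
  using s1ind sigma1I[OF assms(1)] assms(2,3) unfolding sigma1_induction_def by blast

lemma \<Delta>0_induct:
  assumes "\<Delta>0 (\<lambda>v. Q (v 0))" "Q \<zero>" "\<And>n. Q n \<Longrightarrow> Q (n \<oplus> \<one>)"
  shows "Q n"
  using \<Sigma>1_induct[of "\<lambda>n m. Q n"] assms by auto

lemma \<Delta>0_comprehension:
  assumes "\<Delta>0 (\<lambda>v. Q (v 0))"
  shows "{x. Q x} \<in> S"
proof -
  have "sigma1 M {x. Q x}" using sigma1I[of "\<lambda>n m. Q n"] assms by simp
  moreover have "sigma1 M (- {x. Q x})" using sigma1I[of "\<lambda>n m. \<not> Q n"] assms fm_neg
    by (simp add: Collect_neg_eq)
  ultimately show ?thesis using d1ca by (auto simp: delta1_comprehension_def)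
qed

section \<open>Arithmetic\<close>

lemma suc_neq_zero: "n \<oplus> \<one> \<noteq> \<zero>"
  and suc_inject: "m \<oplus> \<one> = n \<oplus> \<one> \<longleftrightarrow> m = n"
  and add_zero: "m \<oplus> \<zero> = m"
  and add_suc: "m \<oplus> (n \<oplus> \<one>) = (m \<oplus> n) \<oplus> \<one>"
  and mult_zero: "m \<otimes> \<zero> = \<zero>"
  and mult_suc: "m \<otimes> (n \<oplus> \<one>) = (m \<otimes> n) \<oplus> m"
  and not_less_zero: "\<not> m \<prec> \<zero>"
  and less_suc_iff: "m \<prec> n \<oplus> \<one> \<longleftrightarrow> m \<preceq> n"
  using basic unfolding basic_axioms_def le_def by blast+

lemma zero_add: "\<zero> \<oplus> n = n"
  by (rule \<Delta>0_induct[where Q="\<lambda>n. \<zero> \<oplus> n = n"])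
    (intro fm_intros trm_intros, simp_all add: add_zero add_suc)

lemma suc_add: "(m \<oplus> \<one>) \<oplus> n = (m \<oplus> n) \<oplus> \<one>"
  by (rule \<Delta>0_induct[where Q="\<lambda>n. (m \<oplus> \<one>) \<oplus> n = (m \<oplus> n) \<oplus> \<one>"])
    (intro fm_intros trm_intros, simp_all add: add_zero add_suc)

lemma add_assoc: "(a \<oplus> b) \<oplus> c = a \<oplus> (b \<oplus> c)"
  by (rule \<Delta>0_induct[where Q="\<lambda>c. (a \<oplus> b) \<oplus> c = a \<oplus> (b \<oplus> c)"])
    (intro fm_intros trm_intros, simp_all add: add_zero add_suc)

lemma add_commute: "a \<oplus> b = b \<oplus> a"
  by (rule \<Delta>0_induct[where Q="\<lambda>b. a \<oplus> b = b \<oplus> a"])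
    (intro fm_intros trm_intros, simp_all add: add_zero zero_add add_suc suc_add)

lemma add_left_commute: "a \<oplus> (b \<oplus> c) = b \<oplus> (a \<oplus> c)"
  by (metis add_assoc add_commute)

lemmas add_ac = add_assoc add_commute add_left_commute

lemma zero_mult: "\<zero> \<otimes> n = \<zero>"
  by (rule \<Delta>0_induct[where Q="\<lambda>n. \<zero> \<otimes> n = \<zero>"])
    (intro fm_intros trm_intros, simp_all add: mult_zero mult_suc add_zero)

lemma suc_mult: "(m \<oplus> \<one>) \<otimes> n = (m \<otimes> n) \<oplus> n"
  by (rule \<Delta>0_induct[where Q="\<lambda>n. (m \<oplus> \<one>) \<otimes> n = (m \<otimes> n) \<oplus> n"])
    (intro fm_intros trm_intros, simp_all add: add_zero mult_zero mult_suc add_ac)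

lemma distrib: "(a \<oplus> b) \<otimes> c = (a \<otimes> c) \<oplus> (b \<otimes> c)"
  by (rule \<Delta>0_induct[where Q="\<lambda>c. (a \<oplus> b) \<otimes> c = (a \<otimes> c) \<oplus> (b \<otimes> c)"])
    (intro fm_intros trm_intros, simp_all add: add_zero mult_zero mult_suc add_ac)

lemma mult_commute: "a \<otimes> b = b \<otimes> a"
  by (rule \<Delta>0_induct[where Q="\<lambda>b. a \<otimes> b = b \<otimes> a"])
    (intro fm_intros trm_intros, simp_all add: mult_zero zero_mult mult_suc suc_mult)

lemma mult_assoc: "(a \<otimes> b) \<otimes> c = a \<otimes> (b \<otimes> c)"
  by (rule \<Delta>0_induct[where Q="\<lambda>c. (a \<otimes> b) \<otimes> c = a \<otimes> (b \<otimes> c)"])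
    (intro fm_intros trm_intros, simp_all add: mult_zero mult_suc, metis distrib mult_commute)

lemma one_mult: "\<one> \<otimes> a = a"
  by (metis mult_commute mult_suc mult_zero zero_add)

text \<open>The induction needs a \<Delta>0 formula, so the predecessor is searched below
  \<open>n\<close>; the bound is dropped afterwards.\<close>

lemma zero_or_suc: "n = \<zero> \<or> (\<exists>k. n = k \<oplus> \<one>)"
  by (rule \<Delta>0_induct[where Q="\<lambda>n. n = \<zero> \<or> (\<exists>k. k \<prec> n \<and> n = k \<oplus> \<one>)", THEN disj_forward])
    (intro fm_intros trm_intros, auto simp: less_suc_iff le_def)

lemma less_add_suc: "m \<prec> m \<oplus> (k \<oplus> \<one>)"
  by (rule \<Delta>0_induct[where Q="\<lambda>k. m \<prec> m \<oplus> (k \<oplus> \<one>)"])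
    (intro fm_intros trm_intros, simp_all add: add_suc add_zero less_suc_iff le_def)

text \<open>The axioms describe the order through successors only. The difference is the witness of
  a \<Sigma>1 induction on \<open>n\<close>; from here on the order can be treated
  additively.\<close>

lemma less_iff_suc_add: "m \<prec> n \<longleftrightarrow> (\<exists>k. n = m \<oplus> (k \<oplus> \<one>))"
proof -
  have "\<exists>k. m \<prec> n \<longrightarrow> n = m \<oplus> (k \<oplus> \<one>)"
  proof (rule \<Sigma>1_induct[where Q="\<lambda>n k. m \<prec> n \<longrightarrow> n = m \<oplus> (k \<oplus> \<one>)"])
    show "\<Delta>0 (\<lambda>v. m \<prec> v 0 \<longrightarrow> v 0 = m \<oplus> (v (Suc 0) \<oplus> \<one>))" by (intro fm_intros trm_intros)
    fix n k assume "m \<prec> n \<longrightarrow> n = m \<oplus> (k \<oplus> \<one>)"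
    then consider "\<not> m \<preceq> n" | "m = n" | "n = m \<oplus> (k \<oplus> \<one>)" by (auto simp: le_def)
    then show "\<exists>k. m \<prec> n \<oplus> \<one> \<longrightarrow> n \<oplus> \<one> = m \<oplus> (k \<oplus> \<one>)"
    proof cases
      case 2 then show ?thesis by (intro exI[of _ \<zero>]) (simp add: zero_add)
    next
      case 3 then show ?thesis by (intro exI[of _ "k \<oplus> \<one>"]) (simp add: add_suc)
    qed (simp add: less_suc_iff le_def)
  qed (simp add: not_less_zero)
  then show ?thesis using less_add_suc by blast
qed

lemma add_right_cancel: "a \<oplus> c = b \<oplus> c \<longleftrightarrow> a = b"
  by (rule \<Delta>0_induct[where Q="\<lambda>c. a \<oplus> c = b \<oplus> c \<longleftrightarrow> a = b"])
    (intro fm_intros trm_intros, simp_all add: add_zero add_suc suc_inject)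

lemma less_trans: "a \<prec> b \<Longrightarrow> b \<prec> c \<Longrightarrow> a \<prec> c"
  unfolding less_iff_suc_add by (metis add_assoc)

lemma less_irrefl: "\<not> a \<prec> a"
  unfolding less_iff_suc_add by (metis add_commute add_right_cancel suc_neq_zero zero_add)

lemma less_linear: "a \<prec> b \<or> a = b \<or> b \<prec> a"
proof (rule \<Delta>0_induct[where Q="\<lambda>b. a \<prec> b \<or> a = b \<or> b \<prec> a"])
  show "\<Delta>0 (\<lambda>v. a \<prec> v 0 \<or> a = v 0 \<or> v 0 \<prec> a)" by (intro fm_intros trm_intros)
  show "a \<prec> \<zero> \<or> a = \<zero> \<or> \<zero> \<prec> a"
    using zero_or_suc[of a] less_add_suc[of \<zero>] by (auto simp: zero_add)
  fix b assume "a \<prec> b \<or> a = b \<or> b \<prec> a"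
  moreover have "b \<oplus> \<one> \<preceq> a" if ba: "b \<prec> a"
  proof -
    obtain k where k: "a = b \<oplus> (k \<oplus> \<one>)" using ba less_iff_suc_add by blast
    show ?thesis
    proof (cases "k = \<zero>")
      case True then show ?thesis using k by (simp add: zero_add le_def)
    next
      case False
      then obtain j where "k = j \<oplus> \<one>" using zero_or_suc by blast
      then have "a = (b \<oplus> \<one>) \<oplus> (j \<oplus> \<one>)" using k by (simp add: add_ac)
      then show ?thesis using less_iff_suc_add by (auto simp: le_def)
    qed
  qed
  ultimately show "a \<prec> b \<oplus> \<one> \<or> a = b \<oplus> \<one> \<or> b \<oplus> \<one> \<prec> a"
    by (auto simp: less_suc_iff le_def)
qed

text \<open>Truncated at zero, as the class of ordered semidomains demands.\<close>

definition sub :: "'a \<Rightarrow> 'a \<Rightarrow> 'a" where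
  "sub a b = (if b \<preceq> a then THE c. c \<oplus> b = a else \<zero>)"

lemma le_iff_add: "a \<preceq> b \<longleftrightarrow> (\<exists>c. b = a \<oplus> c)"
  unfolding le_def by (metis add_zero less_iff_suc_add zero_or_suc)

lemma sub_eq: "c \<oplus> b = a \<Longrightarrow> sub a b = c"
proof -
  assume a: "c \<oplus> b = a"
  then have "b \<preceq> a" using le_iff_add add_commute by metis
  moreover have "(THE c. c \<oplus> b = a) = c" using a by (auto simp: add_right_cancel)
  ultimately show ?thesis by (simp add: sub_def)
qed

lemma sub_zero: "\<not> b \<preceq> a \<Longrightarrow> sub a b = \<zero>" by (auto simp: sub_def)

lemma sub_sub: "sub (sub a b) c = sub a (b \<oplus> c)"
proof (cases "b \<oplus> c \<preceq> a")
  case True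
  then obtain d where "a = (b \<oplus> c) \<oplus> d" using le_iff_add by blast
  then have "(d \<oplus> c) \<oplus> b = a" "d \<oplus> (b \<oplus> c) = a" by (simp_all add: add_ac)
  then show ?thesis using sub_eq[of d c] by (metis sub_eq)
next
  case n: False
  show ?thesis
  proof (cases "b \<preceq> a")
    case True
    then obtain d where d: "a = b \<oplus> d" using le_iff_add by blast
    then have "sub a b = d" using sub_eq[of d b] by (simp add: add_commute)
    moreover have "\<not> c \<preceq> d" using n d unfolding le_iff_add by (metis add_assoc)
    ultimately show ?thesis using n sub_zero by simp
  next
    case False
    then have "sub (sub a b) c = sub \<zero> c" by (simp add: sub_zero)
    also have "\<dots> = \<zero>" using sub_zero sub_eq[of \<zero> \<zero> \<zero>] not_less_zero add_zero le_def by metis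
    finally show ?thesis using sub_zero[OF n] by simp
  qed
qed

lemma mult_sub: "a \<otimes> sub b c = sub (a \<otimes> b) (a \<otimes> c)"
proof (cases "c \<preceq> b")
  case True
  then obtain d where d: "b = c \<oplus> d" using le_iff_add by blast
  then have "sub b c = d" using sub_eq[of d c] by (simp add: add_commute)
  moreover have "a \<otimes> d \<oplus> a \<otimes> c = a \<otimes> b" using d by (metis add_commute distrib mult_commute)
  ultimately show ?thesis using sub_eq by metis
next
  case False
  then obtain d where "c = b \<oplus> (d \<oplus> \<one>)" using less_linear less_iff_suc_add le_def by blast
  then have c: "a \<otimes> c = a \<otimes> b \<oplus> a \<otimes> (d \<oplus> \<one>)" by (metis distrib mult_commute)
  show ?thesis
  proof (cases "a = \<zero>")
    case True then show ?thesis using sub_eq[of \<zero> \<zero> \<zero>] by (simp add: zero_mult add_zero)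
  next
    case F: False
    then obtain a' where "a = a' \<oplus> \<one>" using zero_or_suc by blast
    then have "a \<otimes> b \<prec> a \<otimes> c" using c less_iff_suc_add by (metis add_assoc mult_suc)
    then have "\<not> a \<otimes> c \<preceq> a \<otimes> b" using less_trans less_irrefl le_def by metis
    then show ?thesis using False by (simp add: sub_zero mult_zero)
  qed
qed

lemma zero_neq_one: "\<zero> \<noteq> \<one>"
  using suc_neq_zero[of \<zero>] by (simp add: zero_add)

lemma distrib_left: "c \<otimes> (a \<oplus> b) = (c \<otimes> a) \<oplus> (c \<otimes> b)"
  by (metis distrib mult_commute)

lemma zero_less_suc: "\<zero> \<prec> k \<oplus> \<one>"
  using less_add_suc[of \<zero>] by (simp add: zero_add)

lemma mult_less: "a \<prec> b \<Longrightarrow> \<zero> \<prec> c \<Longrightarrow> c \<otimes> a \<prec> c \<otimes> b"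
proof -
  assume "a \<prec> b" "\<zero> \<prec> c"
  then obtain k j where "b = a \<oplus> (k \<oplus> \<one>)" "c = j \<oplus> \<one>"
    using less_iff_suc_add[of a b] zero_or_suc[of c] not_less_zero by auto
  then have "c \<otimes> b = c \<otimes> a \<oplus> ((c \<otimes> k \<oplus> j) \<oplus> \<one>)"
    by (metis add_assoc distrib mult_commute mult_suc)
  then show ?thesis using less_iff_suc_add by blast
qed

lemma mult_eq_zero: "a \<otimes> b = \<zero> \<Longrightarrow> a = \<zero> \<or> b = \<zero>"
  by (metis mult_suc suc_neq_zero zero_or_suc add_suc)

lemma sub_add: "b \<preceq> a \<Longrightarrow> sub a b \<oplus> b = a"
  using sub_eq le_iff_add add_commute by metis

end

section \<open>The numbers as an ordered semidomain\<close>

sublocale rca0 \<subseteq> nn: linordered_semidom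
  where plus = "(\<oplus>)" and times = "(\<otimes>)" and zero = "\<zero>" and one = "\<one>"
    and less = "(\<prec>)" and less_eq = "(\<preceq>)" and minus = sub
proof (unfold_locales, goal_cases)
  case (3 a b) show ?case by (rule sub_eq) (rule add_commute)
next
  case (5 x y) then show ?case using less_trans less_irrefl by (auto simp: le_def)
next
  case (7 x y z) then show ?case using less_trans by (auto simp: le_def)
next
  case (8 x y) then show ?case using less_trans less_irrefl by (auto simp: le_def)
next
  case (9 a b c) then show ?case by (auto simp: le_iff_add add_ac)
next
  case (10 x y) then show ?case using less_linear by (auto simp: le_def)
next
  case (6 x) then show ?case by (simp add: le_def)
qed (auto simp add: add_assoc zero_add add_zero one_mult zero_mult mult_zero mult_assoc sub_sub
      mult_sub distrib mult_less zero_neq_one sub_add zero_less_suc[of \<zero>, unfolded zero_add] distrib_left dest: mult_eq_zero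
    intro: add_commute mult_commute)

context rca0 begin

declare nn.one_add_one [simp del]

lemma zero_le [simp]: "\<zero> \<preceq> b"
  by (simp add: le_iff_add zero_add)

declare not_less_zero [simp] suc_neq_zero [simp] zero_less_suc [simp]

lemma suc_le_iff: "a \<oplus> \<one> \<preceq> b \<longleftrightarrow> a \<prec> b"
  by (metis less_suc_iff nn.add_le_cancel_right nn.not_less)

lemma le_add1 [simp]: "a \<preceq> a \<oplus> b" "a \<preceq> b \<oplus> a"
  unfolding le_iff_add using add_commute by metis+

lemma le_mult_suc [simp]: "q \<preceq> q \<otimes> (i \<oplus> \<one>)"
  by (simp add: mult_suc)

lemma add_eq_zero [simp]: "a \<oplus> b = \<zero> \<longleftrightarrow> a = \<zero> \<and> b = \<zero>"
  by (metis le_add1 le_def not_less_zero zero_add)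

abbreviation dv :: "'a \<Rightarrow> 'a \<Rightarrow> bool" where "dv \<equiv> nn.dvd"

lemma zero_less_iff: "\<zero> \<prec> a \<longleftrightarrow> a \<noteq> \<zero>"
  by (metis less_linear not_less_zero)

lemma le_mult_self: "n \<preceq> n \<otimes> n"
proof (cases "n = \<zero>")
  case False
  then obtain k where "n = k \<oplus> \<one>" using zero_or_suc by blast
  then have "n \<otimes> n = n \<oplus> n \<otimes> k" by (simp add: algebra_simps)
  then show ?thesis by simp
qed simp

section \<open>Pairs and finite sets\<close>

abbreviation pr :: "'a \<Rightarrow> 'a \<Rightarrow> 'a" where "pr \<equiv> pair M"

lemma trm_pair: "trm s \<Longrightarrow> trm t \<Longrightarrow> trm (\<lambda>v. pr (s v) (t v))"
  unfolding pair_def by (intro trm_intros)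

text \<open>With \<open>s = i \<oplus> j\<close> the value of the pair lies between
  \<open>s \<otimes> s\<close> and \<open>s \<otimes> s \<oplus> s\<close>, an interval that ends
  before the next square. Injectivity of the pairing follows.\<close>

lemma pair_less: "i \<oplus> j \<prec> i' \<oplus> j' \<Longrightarrow> pr i j \<prec> pr i' j'"
proof -
  assume a: "i \<oplus> j \<prec> i' \<oplus> j'"
  let ?s = "i \<oplus> j"
  have "pr i j \<preceq> ?s \<otimes> ?s \<oplus> ?s" by (simp add: pair_def)
  also have "\<dots> \<prec> (?s \<otimes> ?s \<oplus> ?s) \<oplus> (?s \<oplus> \<one>)" by (rule less_add_suc)
  also have "\<dots> = (?s \<oplus> \<one>) \<otimes> (?s \<oplus> \<one>)" by (simp add: algebra_simps)
  also have "\<dots> \<preceq> (i' \<oplus> j') \<otimes> (i' \<oplus> j')"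
    using a by (intro nn.mult_mono) (simp_all add: suc_le_iff)
  also have "\<dots> \<preceq> pr i' j'" by (simp add: pair_def)
  finally show ?thesis .
qed

lemma pair_eq [simp]: "pr i j = pr i' j' \<longleftrightarrow> i = i' \<and> j = j'"
proof
  assume e: "pr i j = pr i' j'"
  then have s: "i \<oplus> j = i' \<oplus> j'"
    using less_linear[of "i \<oplus> j" "i' \<oplus> j'"] pair_less less_irrefl by metis
  with e show "i = i' \<and> j = j'" by (simp add: pair_def)
qed simp

lemma le_pair1 [simp]: "i \<preceq> pr i j" and le_pair2 [simp]: "j \<preceq> pr i j"
proof -
  show "i \<preceq> pr i j" by (simp add: pair_def)
  have "j \<preceq> i \<oplus> j" by simp
  also have "\<dots> \<preceq> pr i j" unfolding pair_def by (rule nn.order.trans[OF le_mult_self]) simp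
  finally show "j \<preceq> pr i j" .
qed

lemma pair_mono: "i \<preceq> i' \<Longrightarrow> j \<preceq> j' \<Longrightarrow> pr i j \<preceq> pr i' j'"
  unfolding pair_def by (intro nn.add_mono nn.mult_mono) auto

declare less_suc_iff [simp]

lemma fmem_pair: "fmem M i (pr (pr k m) n) \<longleftrightarrow> i \<prec> k \<and> dv (m \<otimes> (i \<oplus> \<one>) \<oplus> \<one>) n"
  unfolding fmem_def nn.dvd_def by (auto simp: ac_simps)

text \<open>No existential witness exceeds \<open>s\<close>, which makes membership in a coded set a
  \<Delta>0 formula.\<close>

lemma fmem_bounded: "fmem M i s \<longleftrightarrow> (\<exists>k. k \<prec> s \<oplus> \<one> \<and> (\<exists>m. m \<prec> s \<oplus> \<one> \<and> (\<exists>n. n \<prec> s \<oplus> \<one> \<and>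
  s = pr (pr k m) n \<and> i \<prec> k \<and> (\<exists>q. q \<prec> n \<oplus> \<one> \<and> n = q \<otimes> (m \<otimes> (i \<oplus> \<one>) \<oplus> \<one>)))))"
proof -
  have 1: "q \<preceq> q \<otimes> (m \<otimes> (i \<oplus> \<one>) \<oplus> \<one>)" for q m by (rule le_mult_suc)
  have 2: "k \<preceq> pr (pr k m) n" "m \<preceq> pr (pr k m) n" "n \<preceq> pr (pr k m) n" for k m n
    using nn.order.trans[OF le_pair1[of k m] le_pair1[of "pr k m" n]]
      nn.order.trans[OF le_pair2[of m k] le_pair1[of "pr k m" n]] by simp_all
  have "fmem M i s \<longleftrightarrow> (\<exists>k m n. s = pr (pr k m) n \<and> i \<prec> k \<and>
     (\<exists>q. n = q \<otimes> (m \<otimes> (i \<oplus> \<one>) \<oplus> \<one>)))" by (simp add: fmem_def)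
  also have "\<dots> \<longleftrightarrow> (\<exists>k m n. s = pr (pr k m) n \<and> i \<prec> k \<and>
     (\<exists>q. q \<preceq> n \<and> n = q \<otimes> (m \<otimes> (i \<oplus> \<one>) \<oplus> \<one>)))" using 1 by metis
  finally show ?thesis using 2 unfolding less_suc_iff by metis
qed

lemma fm_fmem: "trm s \<Longrightarrow> trm t \<Longrightarrow> fm \<beta> \<V> (\<lambda>v. fmem M (s v) (t v))"
  by (rule fm_inst2) (unfold fmem_bounded, (intro fm_intros trm_intros trm_pair)+)

lemma dv_diff: "dv a b \<Longrightarrow> dv a (b \<oplus> c) \<Longrightarrow> dv a c"
  by (simp add: nn.dvd_add_right_iff)

lemma dv_bounded: "dv (x \<oplus> \<one>) n \<longleftrightarrow> (\<exists>q. q \<prec> n \<oplus> \<one> \<and> n = q \<otimes> (x \<oplus> \<one>))"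
  unfolding nn.dvd_def less_suc_iff by (metis le_mult_suc mult_commute)

lemma fmem_less: "fmem M i s \<Longrightarrow> i \<prec> s"
proof -
  assume "fmem M i s"
  then obtain k m n where "s = pr (pr k m) n" "i \<prec> k" unfolding fmem_def by blast
  then show ?thesis using le_pair1[of k m] le_pair1[of "pr k m" n] by order
qed

text \<open>For distinct \<open>i, j < k\<close> the difference of the moduli \<open>a = m (i + 1) + 1\<close> and \<open>b = m (j + 1) + 1\<close> is
  \<open>m d\<close> with \<open>d\<close> a divisor of \<open>m\<close>, and \<open>a\<close> is invertible modulo \<open>m\<close>; this gives coprimality
  in the form needed here without Bezout's identity.\<close>

lemma coprime_moduli:
  assumes m: "m = q \<otimes> (d \<oplus> \<one>)" and ij: "i = j \<oplus> (d \<oplus> \<one>) \<or> j = i \<oplus> (d \<oplus> \<one>)"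
    and dv: "dv (m \<otimes> (i \<oplus> \<one>) \<oplus> \<one>) (n \<otimes> (m \<otimes> (j \<oplus> \<one>) \<oplus> \<one>))"
  shows "dv (m \<otimes> (i \<oplus> \<one>) \<oplus> \<one>) n"
proof -
  let ?a = "m \<otimes> (i \<oplus> \<one>) \<oplus> \<one>" and ?b = "m \<otimes> (j \<oplus> \<one>) \<oplus> \<one>" and ?d = "d \<oplus> \<one>"
  have "dv ?a (n \<otimes> m \<otimes> ?d)"
    using ij
  proof
    assume i: "i = j \<oplus> ?d"
    then have "n \<otimes> ?a = n \<otimes> ?b \<oplus> n \<otimes> m \<otimes> ?d" by (simp add: algebra_simps)
    then show ?thesis by (metis dv dv_diff nn.dvd_triv_right)
  next
    assume j: "j = i \<oplus> ?d"
    then have "n \<otimes> ?b = n \<otimes> ?a \<oplus> n \<otimes> m \<otimes> ?d" by (simp add: algebra_simps)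
    then show ?thesis by (metis dv dv_diff nn.dvd_triv_right)
  qed
  then have "dv ?a (n \<otimes> m \<otimes> ?d \<otimes> (i \<oplus> \<one>))" by (rule nn.dvd_mult2)
  moreover have "n \<otimes> ?d \<otimes> ?a = n \<otimes> m \<otimes> ?d \<otimes> (i \<oplus> \<one>) \<oplus> n \<otimes> ?d" by (simp add: algebra_simps)
  ultimately have "dv ?a (n \<otimes> ?d)" by (metis dv_diff nn.dvd_triv_right)
  then have "dv ?a (n \<otimes> ?d \<otimes> (q \<otimes> (i \<oplus> \<one>)))" by (rule nn.dvd_mult2)
  moreover have "n \<otimes> ?a = n \<otimes> ?d \<otimes> (q \<otimes> (i \<oplus> \<one>)) \<oplus> n"
    by (subst (1) m) (simp add: algebra_simps)
  ultimately show ?thesis by (metis dv_diff nn.dvd_triv_right)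
qed

text \<open>A stand-in for the factorial of \<open>k\<close>: any nonzero common multiple will do as
  the parameter \<open>m\<close> of Goedel's beta function. The step multiplies by
  \<open>k \<oplus> \<one>\<close>; quotients are bounded by \<open>m\<close> for the sake of
  \<Sigma>1 induction.\<close>

lemma common_multiple: "\<exists>m. m \<noteq> \<zero> \<and> (\<forall>i. i \<prec> k \<longrightarrow> (\<exists>q. q \<prec> m \<oplus> \<one> \<and> m = q \<otimes> (i \<oplus> \<one>)))"
proof (rule \<Sigma>1_induct[where Q="\<lambda>k m. m \<noteq> \<zero> \<and> (\<forall>i. i \<prec> k \<longrightarrow> (\<exists>q. q \<prec> m \<oplus> \<one> \<and> m = q \<otimes> (i \<oplus> \<one>)))"])
  show "\<Delta>0 (\<lambda>v. v (Suc 0) \<noteq> \<zero> \<and> (\<forall>i. i \<prec> v 0 \<longrightarrow>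
      (\<exists>q. q \<prec> v (Suc 0) \<oplus> \<one> \<and> v (Suc 0) = q \<otimes> (i \<oplus> \<one>))))"
    by (intro fm_intros trm_intros)
  show "\<exists>m. m \<noteq> \<zero> \<and> (\<forall>i. i \<prec> \<zero> \<longrightarrow> (\<exists>q. q \<prec> m \<oplus> \<one> \<and> m = q \<otimes> (i \<oplus> \<one>)))"
    using zero_neq_one by (intro exI[of _ \<one>]) auto
next
  fix k m assume m: "m \<noteq> \<zero> \<and> (\<forall>i. i \<prec> k \<longrightarrow> (\<exists>q. q \<prec> m \<oplus> \<one> \<and> m = q \<otimes> (i \<oplus> \<one>)))"
  let ?m = "m \<otimes> (k \<oplus> \<one>)"
  have le: "q \<preceq> q \<otimes> (i \<oplus> \<one>)" for q i by (rule le_mult_suc)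
  have "\<exists>q. ?m = q \<otimes> (i \<oplus> \<one>)" if i: "i \<preceq> k" for i
  proof (cases "i = k")
    case False
    then obtain q where "m = q \<otimes> (i \<oplus> \<one>)" using m i by (auto simp: le_def)
    then have "?m = (q \<otimes> (k \<oplus> \<one>)) \<otimes> (i \<oplus> \<one>)" by (simp add: algebra_simps)
    then show ?thesis by blast
  qed blast
  then have "\<forall>i. i \<prec> k \<oplus> \<one> \<longrightarrow> (\<exists>q. q \<prec> ?m \<oplus> \<one> \<and> ?m = q \<otimes> (i \<oplus> \<one>))"
    using le unfolding less_suc_iff by metis
  moreover have "?m \<noteq> \<zero>" using m by (auto dest: mult_eq_zero)
  ultimately show "\<exists>m. m \<noteq> \<zero> \<and> (\<forall>i. i \<prec> k \<oplus> \<one> \<longrightarrow> (\<exists>q. q \<prec> m \<oplus> \<one> \<and> m = q \<otimes> (i \<oplus> \<one>)))" by blast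
qed

text \<open>The code is built from the product of the moduli that belong to the elements of
  \<open>P\<close>, accumulated by \<Sigma>1 induction on \<open>j\<close>. By coprimality a new
  factor affects divisibility by its own modulus only.\<close>

lemma code_exists:
  assumes P: "\<Delta>0 (\<lambda>v. P (v 0))"
  shows "\<exists>s. \<forall>i. fmem M i s \<longleftrightarrow> i \<prec> k \<and> P i"
proof -
  obtain m where "m \<noteq> \<zero> \<and> (\<forall>i. i \<prec> k \<longrightarrow> (\<exists>q. q \<prec> m \<oplus> \<one> \<and> m = q \<otimes> (i \<oplus> \<one>)))"
    using common_multiple[of k] ..
  then have m0: "m \<noteq> \<zero>" and m: "\<And>i. i \<prec> k \<Longrightarrow> \<exists>q. m = q \<otimes> (i \<oplus> \<one>)" by auto
  let ?a = "\<lambda>i. m \<otimes> (i \<oplus> \<one>) \<oplus> \<one>"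
  have cop: "dv (?a i) (n \<otimes> ?a j) \<longleftrightarrow> dv (?a i) n" if ij: "i \<prec> k" "j \<prec> k" "i \<noteq> j" for i j n
  proof
    assume a: "dv (?a i) (n \<otimes> ?a j)"
    from less_linear[of i j] ij(3) obtain d where d: "i = j \<oplus> (d \<oplus> \<one>) \<or> j = i \<oplus> (d \<oplus> \<one>)"
      unfolding less_iff_suc_add by blast
    \<comment> \<open>The difference \<open>d \<oplus> \<one>\<close> must be among the numbers of
      which \<open>m\<close> is a multiple; for this \<open>d \<prec> k\<close> is enough.\<close>
    have "d \<prec> l \<oplus> (d \<oplus> \<one>)" for l by (simp add: add_suc)
    with d have "d \<prec> i \<or> d \<prec> j" by metis
    then have "d \<prec> k" using ij less_trans by blast
    then obtain q where "m = q \<otimes> (d \<oplus> \<one>)" using m by blast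
    from coprime_moduli[OF this d a] show "dv (?a i) n" .
  qed (rule nn.dvd_mult2)
  \<comment> \<open>No modulus divides the empty product, with which the induction starts.\<close>
  have a1: "\<not> dv (?a i) \<one>" for i
  proof
    assume "dv (?a i) \<one>"
    then obtain q where q: "\<one> = ?a i \<otimes> q" unfolding nn.dvd_def by blast
    then have "q \<noteq> \<zero>" using zero_neq_one mult_zero by auto
    then obtain p where "q = p \<oplus> \<one>" using zero_or_suc by blast
    with q have "\<zero> \<oplus> \<one> = (m \<otimes> i \<oplus> m \<oplus> ?a i \<otimes> p) \<oplus> \<one>" by (simp add: algebra_simps)
    then have "m \<otimes> i \<oplus> m \<oplus> ?a i \<otimes> p = \<zero>" unfolding suc_inject by simp
    then show False using m0 by simp
  qed
  have "\<exists>n. \<forall>i. i \<prec> k \<longrightarrow> ((\<exists>q. q \<prec> n \<oplus> \<one> \<and> n = q \<otimes> ?a i) \<longleftrightarrow> i \<prec> j \<and> P i)" for j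
  proof (rule \<Sigma>1_induct[where Q="\<lambda>j n. \<forall>i. i \<prec> k \<longrightarrow> ((\<exists>q. q \<prec> n \<oplus> \<one> \<and> n = q \<otimes> ?a i) \<longleftrightarrow> i \<prec> j \<and> P i)"])
    note * = dv_bounded[symmetric]
    show "\<Delta>0 (\<lambda>v. \<forall>i. i \<prec> k \<longrightarrow> ((\<exists>q. q \<prec> v (Suc 0) \<oplus> \<one> \<and> v (Suc 0) = q \<otimes> ?a i) \<longleftrightarrow> i \<prec> v 0 \<and> P i))"
      by (intro fm_intros trm_intros fm_inst1[where R = P, OF P])
    show "\<exists>n. \<forall>i. i \<prec> k \<longrightarrow> ((\<exists>q. q \<prec> n \<oplus> \<one> \<and> n = q \<otimes> ?a i) \<longleftrightarrow> i \<prec> \<zero> \<and> P i)"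
      unfolding * using a1 by (intro exI[of _ \<one>]) simp
    fix j n assume "\<forall>i. i \<prec> k \<longrightarrow> ((\<exists>q. q \<prec> n \<oplus> \<one> \<and> n = q \<otimes> ?a i) \<longleftrightarrow> i \<prec> j \<and> P i)"
    then have n: "dv (?a i) n \<longleftrightarrow> i \<prec> j \<and> P i" if "i \<prec> k" for i using that unfolding * by blast
    have "\<exists>n. \<forall>i. i \<prec> k \<longrightarrow> (dv (?a i) n \<longleftrightarrow> i \<preceq> j \<and> P i)"
    proof (cases "j \<prec> k \<and> P j")
      case True
      have "dv (?a i) (n \<otimes> ?a j) \<longleftrightarrow> i \<preceq> j \<and> P i" if i: "i \<prec> k" for i
        using cop[OF i, of j n] n[OF i] True by (cases "i = j") (auto simp: le_def)
      then show ?thesis by blast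
    next
      case False
      then have "i \<prec> j \<and> P i \<longleftrightarrow> i \<preceq> j \<and> P i" if "i \<prec> k" for i using that by (auto simp: le_def)
      with n show ?thesis by (intro exI[of _ n]) simp
    qed
    then show "\<exists>n. \<forall>i. i \<prec> k \<longrightarrow> ((\<exists>q. q \<prec> n \<oplus> \<one> \<and> n = q \<otimes> ?a i) \<longleftrightarrow> i \<prec> j \<oplus> \<one> \<and> P i)"
      unfolding * unfolding less_suc_iff .
  qed
  then obtain n where n: "\<And>i. i \<prec> k \<Longrightarrow> (\<exists>q. q \<prec> n \<oplus> \<one> \<and> n = q \<otimes> ?a i) \<longleftrightarrow> i \<prec> k \<and> P i" by blast
  note * = dv_bounded[symmetric]
  show ?thesis using n unfolding * by (intro exI[of _ "pr (pr k m) n"]) (auto simp: fmem_pair)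
qed

section \<open>Computations\<close>

lemma num_simps: "num M 0 = \<zero>" "num M (Suc k) = num M k \<oplus> \<one>"
  by (simp_all add: num_def)

lemma num_eq [simp]: "num M i = num M j \<longleftrightarrow> i = j"
proof
  show "num M i = num M j \<Longrightarrow> i = j"
  proof (induction i arbitrary: j)
    case 0 then show ?case by (cases j) (auto simp: num_simps suc_neq_zero[symmetric])
  next
    case (Suc i) then show ?case by (cases j) (auto simp: num_simps)
  qed
qed simp

abbreviation tr :: "'a \<Rightarrow> 'a \<Rightarrow> 'a \<Rightarrow> 'a \<Rightarrow> bool" where
  "tr D a u w \<equiv> fmem M (pr a (pr u w)) D"

lemma pair_le_pair [simp]: "a \<preceq> pr c (pr a b)" "b \<preceq> pr c (pr a b)"
  using nn.order.trans[OF le_pair1[of a b] le_pair2] nn.order.trans[OF le_pair2[of b a] le_pair2] by auto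

lemma tr_less: assumes "tr D a u w" shows "a \<prec> D" "u \<prec> D" "w \<prec> D"
  using fmem_less[OF assms] le_pair1[of a "pr u w"] pair_le_pair[where c = a and a = u and b = w] by order+

lemma less_pair_suc [simp]: "n \<prec> pr p (n \<oplus> \<one>)"
  using le_pair2[of "n \<oplus> \<one>" p] by (simp only: suc_le_iff)

text \<open>A matrix that forces its witness below a term turns an unbounded quantifier into a
  bounded one, so the formula stays \<Delta>0.\<close>

lemma fm_bexI:
  assumes "trm t" "\<And>a v. P a v \<Longrightarrow> a \<prec> t v" "fm \<beta> \<V> (\<lambda>v. P (v 0) (\<lambda>i. v (Suc i)))"
  shows "fm \<beta> \<V> (\<lambda>v. \<exists>a. P a v)"
proof -
  have "(\<lambda>v. \<exists>a. P a v) = (\<lambda>v. \<exists>a. a \<prec> t v \<and> P a v)" using assms(2) by blast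
  then show ?thesis using fm_bex[OF assms(1,3)] by simp
qed

lemmas fm_basic = fm_intros trm_intros trm_pair fm_fmem

text \<open>Parts of \<open>e\<close> are at most \<open>e\<close>, parts of \<open>x\<close> at
  most \<open>x\<close>, and values found in the table lie below \<open>D\<close>, so every witness
  is bounded. The variables are \<open>D\<close>, \<open>e\<close>, \<open>x\<close>,
  \<open>y\<close> in this order; the indices in the bounds grow because each quantifier shifts them
  by one.\<close>

lemma fm_justified0:
  assumes X: "X \<in> \<V>"
  shows "fm \<beta> \<V> (\<lambda>v. justified M X (v 0) (v (Suc 0)) (v (Suc (Suc 0))) (v (Suc (Suc (Suc 0)))))"
  unfolding justified_def Let_def
proof (intro fm_or, goal_cases)
  case 4 show ?case
    apply (intro fm_and; (intro fm_basic)?)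
    apply (rule fm_bexI[where t = "\<lambda>v. v (Suc (Suc 0)) \<oplus> \<one>"])
    by (auto intro!: fm_basic)
next
  case 5 show ?case
    apply (intro fm_and; (intro fm_basic)?)
    apply (rule fm_bexI[where t = "\<lambda>v. v (Suc (Suc 0)) \<oplus> \<one>"])
    by (auto intro!: fm_basic)
next
  case 7 show ?case
    apply (rule fm_bexI[where t = "\<lambda>v. v (Suc 0) \<oplus> \<one>"], intro fm_basic, force)
    apply (rule fm_bexI[where t = "\<lambda>v. v (Suc (Suc 0)) \<oplus> \<one>"], intro fm_basic, force)
    apply (rule fm_bexI[where t = "\<lambda>v. v (Suc (Suc 0))"], intro fm_basic, force dest: tr_less)
    apply (rule fm_bexI[where t = "\<lambda>v. v (Suc (Suc (Suc 0)))"], intro fm_basic, force dest: tr_less)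
    by (intro fm_basic)
next
  case 8 show ?case
    apply (rule fm_bexI[where t = "\<lambda>v. v (Suc 0) \<oplus> \<one>"], intro fm_basic, force)
    apply (rule fm_bexI[where t = "\<lambda>v. v (Suc (Suc 0)) \<oplus> \<one>"], intro fm_basic, force)
    apply (rule fm_bexI[where t = "\<lambda>v. v (Suc (Suc 0))"], intro fm_basic, force dest: tr_less)
    by (intro fm_basic)
next
  case 9 show ?case
    apply (rule fm_bexI[where t = "\<lambda>v. v (Suc 0) \<oplus> \<one>"], intro fm_basic, force)
    apply (rule fm_bexI[where t = "\<lambda>v. v (Suc (Suc 0)) \<oplus> \<one>"], intro fm_basic, force)
    apply (rule fm_bexI[where t = "\<lambda>v. v (Suc (Suc (Suc (Suc 0)))) \<oplus> \<one>"], intro fm_basic, force)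
    by (intro fm_basic)
next
  case 10 show ?case
    apply (rule fm_bexI[where t = "\<lambda>v. v (Suc 0) \<oplus> \<one>"], intro fm_basic, force)
    apply (rule fm_bexI[where t = "\<lambda>v. v (Suc (Suc 0)) \<oplus> \<one>"], intro fm_basic, force)
    apply (rule fm_bexI[where t = "\<lambda>v. v (Suc (Suc (Suc (Suc 0)))) \<oplus> \<one>"], intro fm_basic, force)
    apply (rule fm_bexI[where t = "\<lambda>v. v (Suc (Suc (Suc (Suc (Suc 0)))))"], intro fm_basic, force)
    apply (rule fm_bexI[where t = "\<lambda>v. v (Suc (Suc (Suc (Suc 0))))"], intro fm_basic, force dest: tr_less)
    by (intro fm_basic)
next
  case 11 show ?case
    apply (rule fm_bexI[where t = "\<lambda>v. v (Suc 0) \<oplus> \<one>"], intro fm_basic, force)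
    apply (intro fm_basic)
    apply (rule fm_bexI[where t = "\<lambda>v. v (Suc (Suc 0))"], intro fm_basic, force dest: tr_less)
    by (intro fm_basic)
qed (use X in \<open>intro fm_basic; assumption\<close>)+

definition closed :: "'a set \<Rightarrow> 'a \<Rightarrow> bool" where
  "closed X D \<longleftrightarrow> (\<forall>a u w. tr D a u w \<longrightarrow> justified M X D a u w)"

lemma fm_closed:
  assumes X: "X \<in> \<V>" and "trm t"
  shows "fm \<beta> \<V> (\<lambda>v. closed X (t v))"
proof (rule fm_inst1[OF _ assms(2)])
  have "closed X D \<longleftrightarrow> (\<forall>a. a \<prec> D \<longrightarrow> (\<forall>u. u \<prec> D \<longrightarrow> (\<forall>w. w \<prec> D \<longrightarrow>
    tr D a u w \<longrightarrow> justified M X D a u w)))" for D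
    unfolding closed_def using tr_less by blast
  then show "fm \<beta> \<V> (\<lambda>v. closed X (v 0))"
    by (simp only:) (intro fm_basic fm_inst4[where R = "justified M X", OF fm_justified0[OF X]])
qed

lemma computes_iff: "computes M X e x y \<longleftrightarrow> (\<exists>D. closed X D \<and> tr D e x y)"
  unfolding computes_def closed_def by blast

text \<open>This is \<open>justified\<close> with the table replaced by a relation \<open>T\<close>
  that occurs only positively. A step can therefore be moved to a larger table and, in
  \<open>computes_step\<close>, to the computation relation itself.\<close>

definition step :: "'a set \<Rightarrow> ('a \<Rightarrow> 'a \<Rightarrow> 'a \<Rightarrow> bool) \<Rightarrow> 'a \<Rightarrow> 'a \<Rightarrow> 'a \<Rightarrow> bool" where
  "step X T e x y \<longleftrightarrow>
     e = pr (num M 0) y \<or>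
     (e = pr (num M 1) \<zero> \<and> y = x) \<or>
     (e = pr (num M 2) \<zero> \<and> y = x \<oplus> \<one>) \<or>
     (e = pr (num M 3) \<zero> \<and> (\<exists>u. x = pr y u)) \<or>
     (e = pr (num M 4) \<zero> \<and> (\<exists>u. x = pr u y)) \<or>
     (e = pr (num M 5) \<zero> \<and> (x \<in> X \<and> y = \<one> \<or> x \<notin> X \<and> y = \<zero>)) \<or>
     (\<exists>a b u w. e = pr (num M 6) (pr a b) \<and> T a x u \<and> T b x w \<and> y = pr u w) \<or>
     (\<exists>a b u. e = pr (num M 7) (pr a b) \<and> T b x u \<and> T a u y) \<or>
     (\<exists>a b p. e = pr (num M 8) (pr a b) \<and> x = pr p \<zero> \<and> T a p y) \<or>
     (\<exists>a b p n u. e = pr (num M 8) (pr a b) \<and> x = pr p (n \<oplus> \<one>) \<and>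
        T e (pr p n) u \<and> T b (pr p (pr n u)) y) \<or>
     (\<exists>a. e = pr (num M 9) a \<and> T a (pr x y) \<zero> \<and>
        (\<forall>k. k \<prec> y \<longrightarrow> (\<exists>u. u \<noteq> \<zero> \<and> T a (pr x k) u)))"

lemma justified_step: "justified M X D e x y \<longleftrightarrow> step X (tr D) e x y"
  by (simp only: justified_def step_def Let_def)

lemma step_mono:
  assumes "step X T e x y" and m: "\<And>a u w. T a u w \<Longrightarrow> T' a u w"
  shows "step X T' e x y"
  using assms(1) unfolding step_def
  by (elim disj_forward conj_forward ex_forward all_forward imp_forward m)

lemma code_union: "\<exists>s. \<forall>i. fmem M i s \<longleftrightarrow> fmem M i D \<or> fmem M i D'"
proof -
  obtain s where s: "\<forall>i. fmem M i s \<longleftrightarrow> i \<prec> D \<oplus> D' \<and> (fmem M i D \<or> fmem M i D')"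
    using code_exists[of "\<lambda>i. fmem M i D \<or> fmem M i D'" "D \<oplus> D'", OF fm_or[OF fm_fmem fm_fmem]]
      trm_var trm_const by blast
  have "i \<prec> D \<oplus> D'" if "fmem M i D \<or> fmem M i D'" for i
    using that fmem_less[of i] le_add1(1)[of D D'] le_add1(2)[of D' D] by (metis nn.less_le_trans)
  then show ?thesis using s by (intro exI[of _ s]) blast
qed

lemma code_insert: "\<exists>s. \<forall>i. fmem M i s \<longleftrightarrow> fmem M i D \<or> i = p"
proof -
  obtain s where s: "\<forall>i. fmem M i s \<longleftrightarrow> i \<prec> D \<oplus> (p \<oplus> \<one>) \<and> (fmem M i D \<or> i = p)"
    using code_exists[of "\<lambda>i. fmem M i D \<or> i = p" "D \<oplus> (p \<oplus> \<one>)", OF fm_or[OF fm_fmem fm_eq]]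
      trm_var trm_const by blast
  have "i \<prec> D \<oplus> (p \<oplus> \<one>)" if "fmem M i D \<or> i = p" for i
    using that fmem_less[of i D] by (auto simp: add_suc) (metis le_add1(1) nn.order.trans le_def)
  then show ?thesis using s by (intro exI[of _ s]) blast
qed

text \<open>Steps are monotone in the table, so a justification survives the union.\<close>

lemma closed_union:
  assumes "closed X D" "closed X D'"
  shows "\<exists>E. closed X E \<and> (\<forall>a u w. tr D a u w \<or> tr D' a u w \<longrightarrow> tr E a u w)"
proof -
  obtain E where E: "\<forall>i. fmem M i E \<longleftrightarrow> fmem M i D \<or> fmem M i D'" using code_union by blast
  have "step X (tr E) a u w" if "tr E a u w" for a u w
    
  proof -
    have "step X (tr D) a u w \<or> step X (tr D') a u w"
      using that E assms unfolding closed_def justified_step by auto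
    then show ?thesis
    proof
      assume "step X (tr D) a u w" then show ?thesis by (rule step_mono) (simp add: E)
    next
      assume "step X (tr D') a u w" then show ?thesis by (rule step_mono) (simp add: E)
    qed
  qed
  then show ?thesis using E unfolding closed_def justified_step by blast
qed

lemma computes_closed_step:
  assumes "closed X D" "step X (tr D) e x y"
  shows "computes M X e x y"
proof -
  obtain E where E: "\<forall>i. fmem M i E \<longleftrightarrow> fmem M i D \<or> i = pr e (pr x y)" using code_insert by blast
  have "step X (tr E) a u w" if "tr E a u w" for a u w
    
  proof -
    have "step X (tr D) a u w" using that E assms unfolding closed_def justified_step by auto
    then show ?thesis by (rule step_mono) (simp add: E)
  qed
  then show ?thesis using E unfolding computes_iff closed_def justified_step by blast
qed

lemma closed_empty: "\<exists>D. closed X D"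
proof -
  obtain s where "\<forall>i. fmem M i s \<longleftrightarrow> i \<prec> \<zero> \<and> True"
    using code_exists[of "\<lambda>i. True" \<zero>, OF fm_const] ..
  then have "closed X s" by (simp add: closed_def)
  then show ?thesis ..
qed

lemma computes_two:
  assumes "computes M X a u w" "computes M X a' u' w'"
  shows "\<exists>D. closed X D \<and> tr D a u w \<and> tr D a' u' w'"
  using assms closed_union unfolding computes_iff by metis

text \<open>Minimization needs the computations for all \<open>k \<prec> y\<close> in one table, and
  \<open>y\<close> may be nonstandard. The tables are merged one by one in a \<Sigma>1 induction
  whose witness is the merged table; the bound \<open>u \<prec> D\<close> keeps the matrix
  \<Delta>0.\<close>

lemma computes_bounded_collection:
  assumes X: "X \<in> S" and c: "\<And>k. k \<prec> y \<Longrightarrow> \<exists>u. u \<noteq> \<zero> \<and> computes M X a (pr x k) u"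
  shows "\<exists>D. closed X D \<and> (\<forall>k. k \<prec> y \<longrightarrow> (\<exists>u. u \<prec> D \<and> u \<noteq> \<zero> \<and> tr D a (pr x k) u))"
proof -
  have "\<exists>D. n \<preceq> y \<longrightarrow> closed X D \<and> (\<forall>k. k \<prec> n \<longrightarrow> (\<exists>u. u \<prec> D \<and> u \<noteq> \<zero> \<and> tr D a (pr x k) u))" for n
  proof (rule \<Sigma>1_induct[where Q = "\<lambda>n D. n \<preceq> y \<longrightarrow> closed X D \<and>
      (\<forall>k. k \<prec> n \<longrightarrow> (\<exists>u. u \<prec> D \<and> u \<noteq> \<zero> \<and> tr D a (pr x k) u))"])
    show "\<Delta>0 (\<lambda>v. v 0 \<preceq> y \<longrightarrow> closed X (v (Suc 0)) \<and> (\<forall>k. k \<prec> v 0 \<longrightarrow>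
        (\<exists>u. u \<prec> v (Suc 0) \<and> u \<noteq> \<zero> \<and> tr (v (Suc 0)) a (pr x k) u)))"
      by (intro fm_basic fm_closed X)
    show "\<exists>D. \<zero> \<preceq> y \<longrightarrow> closed X D \<and> (\<forall>k. k \<prec> \<zero> \<longrightarrow> (\<exists>u. u \<prec> D \<and> u \<noteq> \<zero> \<and> tr D a (pr x k) u))"
      using closed_empty by simp
    fix n D assume D: "n \<preceq> y \<longrightarrow> closed X D \<and> (\<forall>k. k \<prec> n \<longrightarrow> (\<exists>u. u \<prec> D \<and> u \<noteq> \<zero> \<and> tr D a (pr x k) u))"
    show "\<exists>D. n \<oplus> \<one> \<preceq> y \<longrightarrow> closed X D \<and>
        (\<forall>k. k \<prec> n \<oplus> \<one> \<longrightarrow> (\<exists>u. u \<prec> D \<and> u \<noteq> \<zero> \<and> tr D a (pr x k) u))"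
    proof (cases "n \<prec> y")
      case True
      then obtain u where u: "u \<noteq> \<zero>" "computes M X a (pr x n) u" using c by blast
      then obtain D' where D': "closed X D'" "tr D' a (pr x n) u" unfolding computes_iff by blast
      have D1: "closed X D" "\<And>k. k \<prec> n \<Longrightarrow> \<exists>u. u \<noteq> \<zero> \<and> tr D a (pr x k) u" using D True by (auto simp: le_def)
      obtain E where E: "closed X E" "\<And>a u w. tr D a u w \<or> tr D' a u w \<Longrightarrow> tr E a u w"
        using closed_union[OF D1(1) D'(1)] by blast
      have "\<exists>u. u \<prec> E \<and> u \<noteq> \<zero> \<and> tr E a (pr x k) u" if "k \<preceq> n" for k
        using that u D1(2)[of k] D'(2) E(2) tr_less(3) unfolding le_def by metis
      with E show ?thesis by (intro exI[of _ E]) simp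
    qed (simp add: suc_le_iff)
  qed
  from this[of y] show ?thesis by simp
qed

text \<open>Computability is a fixed point of the clauses. From left to right the table is
  forgotten; from right to left the tables of the premises are united and the new triple is
  added.\<close>

lemma computes_step:
  assumes X: "X \<in> S"
  shows "computes M X e x y \<longleftrightarrow> step X (computes M X) e x y"
proof
  assume "computes M X e x y"
  then obtain D where D: "closed X D" "tr D e x y" unfolding computes_iff by blast
  then have "step X (tr D) e x y" unfolding closed_def justified_step by blast
  moreover have "tr D a u w \<Longrightarrow> computes M X a u w" for a u w using D(1) unfolding computes_iff by blast
  ultimately show "step X (computes M X) e x y" by (rule step_mono)
next
  assume "step X (computes M X) e x y"
  then consider (C0) "e = pr (num M 0) y \<or> (e = pr (num M 1) \<zero> \<and> y = x) \<or> (e = pr (num M 2) \<zero> \<and> y = x \<oplus> \<one>) \<or>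
     (e = pr (num M 3) \<zero> \<and> (\<exists>u. x = pr y u)) \<or> (e = pr (num M 4) \<zero> \<and> (\<exists>u. x = pr u y)) \<or>
     (e = pr (num M 5) \<zero> \<and> (x \<in> X \<and> y = \<one> \<or> x \<notin> X \<and> y = \<zero>))"
    | (C6) a b u w where "e = pr (num M 6) (pr a b)" "computes M X a x u" "computes M X b x w" "y = pr u w"
    | (C7) a b u where "e = pr (num M 7) (pr a b)" "computes M X b x u" "computes M X a u y"
    | (C8) a b p where "e = pr (num M 8) (pr a b)" "x = pr p \<zero>" "computes M X a p y"
    | (C8s) a b p n u where "e = pr (num M 8) (pr a b)" "x = pr p (n \<oplus> \<one>)"
        "computes M X e (pr p n) u" "computes M X b (pr p (pr n u)) y"
    | (C9) a where "e = pr (num M 9) a" "computes M X a (pr x y) \<zero>"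
        "\<forall>k. k \<prec> y \<longrightarrow> (\<exists>u. u \<noteq> \<zero> \<and> computes M X a (pr x k) u)"
    unfolding step_def
    by (elim disjE exE conjE)
      ((rule that(2); assumption) | (rule that(3); assumption) | (rule that(4); assumption)
       | (rule that(5); assumption) | (rule that(6); assumption) | (rule that(1); simp))+
  then have "\<exists>D. closed X D \<and> step X (tr D) e x y"
  proof cases
    case C0
    then have "step X T e x y" for T unfolding step_def by argo
    with closed_empty show ?thesis by blast
  next
    case (C6 a b u w)
    from computes_two[OF C6(2,3)] obtain D where D: "closed X D" "tr D a x u" "tr D b x w" by blast
    then have "step X (tr D) e x y" unfolding step_def using C6(1,4) by auto
    with D(1) show ?thesis by blast
  next
    case (C7 a b u)
    from computes_two[OF C7(2,3)] obtain D where D: "closed X D" "tr D b x u" "tr D a u y" by blast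
    then have "step X (tr D) e x y" unfolding step_def using C7(1) by auto
    with D(1) show ?thesis by blast
  next
    case (C8 a b p)
    then obtain D where D: "closed X D" "tr D a p y" unfolding computes_iff by blast
    then have "step X (tr D) e x y" unfolding step_def using C8(1,2) by auto
    with D(1) show ?thesis by blast
  next
    case (C8s a b p n u)
    from computes_two[OF C8s(3,4)] obtain D where D: "closed X D" "tr D e (pr p n) u" "tr D b (pr p (pr n u)) y" by blast
    then have "step X (tr D) e x y" unfolding step_def using C8s(1,2) by auto
    with D(1) show ?thesis by blast
  next
    case (C9 a)
    from computes_bounded_collection[OF X, of y a x] C9(3)
    obtain D where D: "closed X D" "\<forall>k. k \<prec> y \<longrightarrow> (\<exists>u. u \<prec> D \<and> u \<noteq> \<zero> \<and> tr D a (pr x k) u)"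
      by auto
    obtain D' where D': "closed X D'" "tr D' a (pr x y) \<zero>" using C9(2) unfolding computes_iff by blast
    obtain E where E: "closed X E" "\<And>a u w. tr D a u w \<or> tr D' a u w \<Longrightarrow> tr E a u w"
      using closed_union[OF D(1) D'(1)] by blast
    have "tr E a (pr x y) \<zero>" "\<forall>k. k \<prec> y \<longrightarrow> (\<exists>u. u \<noteq> \<zero> \<and> tr E a (pr x k) u)"
      using D(2) D'(2) E(2) by blast+
    then have "step X (tr E) e x y" unfolding step_def using C9(1) by auto
    with E(1) show ?thesis by blast
  qed
  then show "computes M X e x y" using computes_closed_step by blast
qed

lemma \<Delta>0_least:
  assumes Q: "\<Delta>0 (\<lambda>v. Q (v 0))" and m: "Q m"
  shows "\<exists>n. Q n \<and> (\<forall>k. k \<prec> n \<longrightarrow> \<not> Q k)"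
proof (rule ccontr)
  assume no: "\<not> ?thesis"
  have "\<forall>k. k \<prec> n \<longrightarrow> \<not> Q k" for n
  proof (rule \<Delta>0_induct[where Q = "\<lambda>n. \<forall>k. k \<prec> n \<longrightarrow> \<not> Q k"])
    show "\<Delta>0 (\<lambda>v. \<forall>k. k \<prec> v 0 \<longrightarrow> \<not> Q k)"
      by (intro fm_ball fm_neg fm_inst1[where R = Q, OF Q] trm_intros)
    fix n assume "\<forall>k. k \<prec> n \<longrightarrow> \<not> Q k"
    with no show "\<forall>k. k \<prec> n \<oplus> \<one> \<longrightarrow> \<not> Q k" by (auto simp: le_def)
  qed simp
  from this[of "m \<oplus> \<one>"] m show False by simp
qed

text \<open>Inputs are the codes \<open>c z\<close>; the index has to work for all \<open>z\<close>, but what it does on numbers that are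
  not codes is left open.\<close>

definition cf :: "'a set \<Rightarrow> ('c \<Rightarrow> 'a) \<Rightarrow> ('c \<Rightarrow> 'a) \<Rightarrow> bool" where
  "cf X c f \<longleftrightarrow> (\<exists>e. \<forall>z y. computes M X e (c z) y \<longleftrightarrow> y = f z)"

definition chi :: "bool \<Rightarrow> 'a" where "chi P = (if P then \<one> else \<zero>)"

lemma chi_simps [simp]: "chi True = \<one>" "chi False = \<zero>"
  by (simp_all add: chi_def)

lemma sub_simps [simp]: "sub a \<zero> = a" "sub a a = \<zero>" "sub (n \<oplus> \<one>) \<one> = n"
  using sub_eq[of a \<zero> a] sub_eq[of \<zero> a a] sub_eq[of n \<one> "n \<oplus> \<one>"] by (simp_all add: add_zero zero_add)

lemma sub_eq_zero: "sub a b = \<zero> \<longleftrightarrow> a \<preceq> b"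
proof
  assume "sub a b = \<zero>"
  then show "a \<preceq> b" using sub_add[of b a] less_linear[of a b] by (auto simp: le_def zero_add)
next
  assume "a \<preceq> b"
  then show "sub a b = \<zero>"
    using sub_zero[of b a] less_irrefl less_trans by (cases "a = b") (auto simp: le_def)
qed

lemma sub_graph: "y = sub a b \<longleftrightarrow> y \<oplus> b = a \<or> (a \<prec> b \<and> y = \<zero>)"
proof (cases "b \<preceq> a")
  case True
  then have "\<not> a \<prec> b" by simp
  then show ?thesis using sub_add[OF True] sub_eq by auto
next
  case False
  then have "a \<prec> b" by simp
  moreover have "y \<oplus> b \<noteq> a" using False by auto
  ultimately show ?thesis using sub_zero[OF False] by simp
qed

text \<open>The input of a formula whose variables are below \<open>N\<close>. The newest de Bruijn
  variable stands in front, so a quantifier adds or strips the first entry of the tuple.\<close>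

primrec code :: "nat \<Rightarrow> (nat \<Rightarrow> 'a) \<Rightarrow> 'a" where
  "code 0 v = \<zero>"
| "code (Suc N) v = pr (v 0) (code N (\<lambda>i. v (Suc i)))"

end

section \<open>Computable functions with oracle \<open>X\<close>\<close>

locale rca0_set = rca0 M for M :: "'a l2_structure" (structure) +
  fixes X assumes X: "X \<in> set_part M"
begin

abbreviation cmp :: "'a \<Rightarrow> 'a \<Rightarrow> 'a \<Rightarrow> bool" where "cmp \<equiv> computes M X"

lemmas cstep = computes_step[OF X]

lemma cmp_simps:
  "cmp (pr (num M 0) k) x y \<longleftrightarrow> y = k"
  "cmp (pr (num M 1) \<zero>) x y \<longleftrightarrow> y = x"
  "cmp (pr (num M 2) \<zero>) x y \<longleftrightarrow> y = x \<oplus> \<one>"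
  "cmp (pr (num M 3) \<zero>) (pr p q) y \<longleftrightarrow> y = p"
  "cmp (pr (num M 4) \<zero>) (pr p q) y \<longleftrightarrow> y = q"
  "cmp (pr (num M 5) \<zero>) x y \<longleftrightarrow> y = chi (x \<in> X)"
  "cmp (pr (num M 6) (pr a b)) x y \<longleftrightarrow> (\<exists>u w. cmp a x u \<and> cmp b x w \<and> y = pr u w)"
  "cmp (pr (num M 7) (pr a b)) x y \<longleftrightarrow> (\<exists>u. cmp b x u \<and> cmp a u y)"
  "cmp (pr (num M 8) (pr a b)) (pr p \<zero>) y \<longleftrightarrow> cmp a p y"
  "cmp (pr (num M 8) (pr a b)) (pr p (n \<oplus> \<one>)) y \<longleftrightarrow>
     (\<exists>u. cmp (pr (num M 8) (pr a b)) (pr p n) u \<and> cmp b (pr p (pr n u)) y)"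
  "cmp (pr (num M 9) a) x y \<longleftrightarrow> cmp a (pr x y) \<zero> \<and> (\<forall>k. k \<prec> y \<longrightarrow> (\<exists>u. u \<noteq> \<zero> \<and> cmp a (pr x k) u))"
  by (subst cstep, (auto simp: step_def suc_neq_zero[symmetric] suc_inject chi_def)[1])+

lemma cf_self: "cf X c c" unfolding cf_def using cmp_simps(2) by blast

lemma cf_const: "cf X c (\<lambda>z. k)" unfolding cf_def using cmp_simps(1) by blast

lemma cf_comp: "cf X f g \<Longrightarrow> cf X c f \<Longrightarrow> cf X c g"
proof -
  assume "cf X f g" "cf X c f"
  then obtain a b where "\<forall>z y. cmp a (f z) y \<longleftrightarrow> y = g z" "\<forall>z y. cmp b (c z) y \<longleftrightarrow> y = f z"
    unfolding cf_def by blast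
  then have "\<forall>z y. cmp (pr (num M 7) (pr a b)) (c z) y \<longleftrightarrow> y = g z" by (simp add: cmp_simps)
  then show ?thesis unfolding cf_def by blast
qed

lemma cf_reparam: "cf X c f \<Longrightarrow> cf X (\<lambda>w. c (h w)) (\<lambda>w. f (h w))"
  unfolding cf_def by blast

lemma cf_pair: "cf X c f \<Longrightarrow> cf X c g \<Longrightarrow> cf X c (\<lambda>z. pr (f z) (g z))"
proof -
  assume "cf X c f" "cf X c g"
  then obtain a b where "\<forall>z y. cmp a (c z) y \<longleftrightarrow> y = f z" "\<forall>z y. cmp b (c z) y \<longleftrightarrow> y = g z"
    unfolding cf_def by blast
  then have "\<forall>z y. cmp (pr (num M 6) (pr a b)) (c z) y \<longleftrightarrow> y = pr (f z) (g z)" by (simp add: cmp_simps)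
  then show ?thesis unfolding cf_def by blast
qed

lemma cf_suc: assumes "cf X c f" shows "cf X c (\<lambda>z. f z \<oplus> \<one>)"
proof (rule cf_comp[OF _ assms])
  have "\<forall>z y. cmp (pr (num M 2) \<zero>) (f z) y \<longleftrightarrow> y = f z \<oplus> \<one>" by (simp add: cmp_simps)
  then show "cf X f (\<lambda>z. f z \<oplus> \<one>)" unfolding cf_def by blast
qed

lemma cf_mem: assumes "cf X c f" shows "cf X c (\<lambda>z. chi (f z \<in> X))"
proof (rule cf_comp[OF _ assms])
  have "\<forall>z y. cmp (pr (num M 5) \<zero>) (f z) y \<longleftrightarrow> y = chi (f z \<in> X)" by (simp add: cmp_simps)
  then show "cf X f (\<lambda>z. chi (f z \<in> X))" unfolding cf_def by blast
qed

lemma cf_from1: assumes "cf X f k" shows "cf X (\<lambda>z. pr (f z) (g z)) k"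
proof (rule cf_comp[OF assms])
  have "\<forall>z y. cmp (pr (num M 3) \<zero>) (pr (f z) (g z)) y \<longleftrightarrow> y = f z" by (simp add: cmp_simps)
  then show "cf X (\<lambda>z. pr (f z) (g z)) f" unfolding cf_def by blast
qed

lemma cf_from2: assumes "cf X g k" shows "cf X (\<lambda>z. pr (f z) (g z)) k"
proof (rule cf_comp[OF assms])
  have "\<forall>z y. cmp (pr (num M 4) \<zero>) (pr (f z) (g z)) y \<longleftrightarrow> y = g z" by (simp add: cmp_simps)
  then show "cf X (\<lambda>z. pr (f z) (g z)) g" unfolding cf_def by blast
qed

text \<open>The recursion argument may be nonstandard, so neither existence nor uniqueness of the
  value follows by external iteration. Both are proved by induction in the model, for which the
  graph of \<open>F\<close> has to be \<Delta>0.\<close>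

lemma cf_rec:
  assumes base: "cf X c (\<lambda>z. F z \<zero>)"
    and step: "cf X (\<lambda>w. pr (c (fst w)) (pr (snd w) (F (fst w) (snd w)))) (\<lambda>w. F (fst w) (snd w \<oplus> \<one>))"
    and graph: "\<And>z. \<Delta>0 (\<lambda>v. v (Suc 0) = F z (v 0))"
    and t: "cf X c t"
  shows "cf X c (\<lambda>z. F z (t z))"
proof -
  obtain a where a: "\<And>z y. cmp a (c z) y \<longleftrightarrow> y = F z \<zero>" using base unfolding cf_def by blast
  obtain b where b: "\<And>z n y. cmp b (pr (c z) (pr n (F z n))) y \<longleftrightarrow> y = F z (n \<oplus> \<one>)"
    using step unfolding cf_def by auto
  let ?e = "pr (num M 8) (pr a b)"
  have ex: "cmp ?e (pr (c z) n) (F z n)" for z n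
  proof -
    let ?Q = "\<lambda>n D. closed X D \<and> (\<exists>y. y \<prec> D \<and> y = F z n \<and> tr D ?e (pr (c z) n) y)"
    have Q: "(\<exists>D. ?Q n D) \<longleftrightarrow> cmp ?e (pr (c z) n) (F z n)" for n
      unfolding computes_iff using tr_less(3) by blast
    have "\<exists>D. ?Q n D"
    proof (rule \<Sigma>1_induct[where Q = ?Q])
      show "\<Delta>0 (\<lambda>v. closed X (v (Suc 0)) \<and>
          (\<exists>y. y \<prec> v (Suc 0) \<and> y = F z (v 0) \<and> tr (v (Suc 0)) ?e (pr (c z) (v 0)) y))"
        by (intro fm_and fm_bex fm_closed X fm_inst2[where R = "\<lambda>n y. y = F z n", OF graph]
            trm_pair fm_fmem trm_intros)
      show "\<exists>D. ?Q \<zero> D" unfolding Q by (simp add: cmp_simps a)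
      show "\<exists>D. ?Q (n \<oplus> \<one>) D" if "?Q n D" for n D
      proof -
        from that have "cmp ?e (pr (c z) n) (F z n)" unfolding Q[symmetric] by blast
        then show ?thesis unfolding Q cmp_simps using b by blast
      qed
    qed
    then show ?thesis unfolding Q .
  qed
  have un: "y = F z n" if "cmp ?e (pr (c z) n) y" for z n y
  proof -
    obtain D where D: "closed X D" "tr D ?e (pr (c z) n) y" using \<open>cmp ?e (pr (c z) n) y\<close> unfolding computes_iff by blast
    have st: "step X (tr D) e x y" if "tr D e x y" for e x y
      using D(1) that unfolding closed_def justified_step by blast
    have c: "cmp e x y" if "tr D e x y" for e x y using D(1) that unfolding computes_iff by blast
    \<comment> \<open>Inside one fixed table uniqueness is a bounded statement, as all values in the
      table are below \<open>D\<close>.\<close>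
    have "\<forall>y. y \<prec> D \<longrightarrow> tr D ?e (pr (c z) n) y \<longrightarrow> y = F z n"
    proof (rule \<Delta>0_induct[where Q = "\<lambda>n. \<forall>y. y \<prec> D \<longrightarrow> tr D ?e (pr (c z) n) y \<longrightarrow> y = F z n"])
      show "\<Delta>0 (\<lambda>v. \<forall>y. y \<prec> D \<longrightarrow> tr D ?e (pr (c z) (v 0)) y \<longrightarrow> y = F z (v 0))"
        by (intro fm_ball fm_imp fm_inst2[where R = "\<lambda>n y. y = F z n", OF graph] trm_pair fm_fmem trm_intros)
      show "\<forall>y. y \<prec> D \<longrightarrow> tr D ?e (pr (c z) \<zero>) y \<longrightarrow> y = F z \<zero>"
        using c[of ?e "pr (c z) \<zero>"] unfolding cmp_simps(9) a by blast
      fix n assume IH: "\<forall>y. y \<prec> D \<longrightarrow> tr D ?e (pr (c z) n) y \<longrightarrow> y = F z n"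
      { fix y assume "tr D ?e (pr (c z) (n \<oplus> \<one>)) y"
        from st[OF this] obtain u where u: "tr D ?e (pr (c z) n) u" "tr D b (pr (c z) (pr n u)) y"
          unfolding step_def by (auto simp: suc_neq_zero[symmetric] suc_inject)
        then have "u = F z n" using IH tr_less(3) by blast
        then have "y = F z (n \<oplus> \<one>)" using c[OF u(2)] b by simp }
      then show "\<forall>y. y \<prec> D \<longrightarrow> tr D ?e (pr (c z) (n \<oplus> \<one>)) y \<longrightarrow> y = F z (n \<oplus> \<one>)" by blast
    qed
    then show ?thesis using D(2) tr_less(3) by blast
  qed
  have "cf X (\<lambda>z. pr (c z) (t z)) (\<lambda>z. F z (t z))"
    unfolding cf_def using ex un by blast
  then show ?thesis by (rule cf_comp) (intro cf_pair cf_self t)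
qed

lemma cf_add: assumes f: "cf X c f" and g: "cf X c g" shows "cf X c (\<lambda>z. f z \<oplus> g z)"
proof (rule cf_rec[where F = "\<lambda>z n. f z \<oplus> n", OF _ _ _ g])
  show "cf X c (\<lambda>z. f z \<oplus> \<zero>)" using f by (simp add: add_zero)
  show "cf X (\<lambda>w. pr (c (fst w)) (pr (snd w) (f (fst w) \<oplus> snd w))) (\<lambda>w. f (fst w) \<oplus> (snd w \<oplus> \<one>))"
    unfolding add_suc by (intro cf_suc cf_from2 cf_self)
qed (intro fm_basic)

lemma cf_mult: assumes f: "cf X c f" and g: "cf X c g" shows "cf X c (\<lambda>z. f z \<otimes> g z)"
proof (rule cf_rec[where F = "\<lambda>z n. f z \<otimes> n", OF _ _ _ g])
  show "cf X c (\<lambda>z. f z \<otimes> \<zero>)" using cf_const by (simp add: mult_zero)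
  show "cf X (\<lambda>w. pr (c (fst w)) (pr (snd w) (f (fst w) \<otimes> snd w))) (\<lambda>w. f (fst w) \<otimes> (snd w \<oplus> \<one>))"
    unfolding mult_suc
    by (rule cf_add) (rule cf_from2, rule cf_from2, rule cf_self, rule cf_from1, rule cf_reparam[OF f])
qed (intro fm_basic)

lemma cf_pred: assumes f: "cf X c f" shows "cf X c (\<lambda>z. sub (f z) \<one>)"
proof (rule cf_rec[where F = "\<lambda>z n. sub n \<one>", OF _ _ _ f])
  show "cf X c (\<lambda>z. sub \<zero> \<one>)" by (rule cf_const)
  show "cf X (\<lambda>w. pr (c (fst w)) (pr (snd w) (sub (snd w) \<one>))) (\<lambda>w. sub (snd w \<oplus> \<one>) \<one>)"
    by simp (rule cf_from2, rule cf_from1, rule cf_self)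
  show "\<Delta>0 (\<lambda>v. v (Suc 0) = sub (v 0) \<one>)" unfolding sub_graph by (intro fm_basic)
qed

lemma cf_sub: assumes f: "cf X c f" and g: "cf X c g" shows "cf X c (\<lambda>z. sub (f z) (g z))"
proof (rule cf_rec[where F = "\<lambda>z n. sub (f z) n", OF _ _ _ g])
  show "cf X c (\<lambda>z. sub (f z) \<zero>)" using f by simp
  show "cf X (\<lambda>w. pr (c (fst w)) (pr (snd w) (sub (f (fst w)) (snd w)))) (\<lambda>w. sub (f (fst w)) (snd w \<oplus> \<one>))"
    unfolding sub_sub[symmetric] by (intro cf_pred cf_from2 cf_self)
  show "\<Delta>0 (\<lambda>v. v (Suc 0) = sub (f z) (v 0))" for z unfolding sub_graph by (intro fm_basic)
qed

lemma cf_zero: assumes "cf X c f" shows "cf X c (\<lambda>z. chi (f z = \<zero>))"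
proof -
  have "chi (n = \<zero>) = sub \<one> n" for n
  proof (cases "n = \<zero>")
    case False
    then have "\<one> \<preceq> n" using suc_le_iff[of \<zero> n] by (simp add: zero_less_iff zero_add)
    then show ?thesis using False sub_eq_zero[of \<one> n] by simp
  qed simp
  then show ?thesis using cf_sub[OF cf_const assms, of \<one>] by simp
qed

lemma cf_neg: assumes "cf X c (\<lambda>z. chi (P z))" shows "cf X c (\<lambda>z. chi (\<not> P z))"
proof -
  have "(chi b = \<zero>) = (\<not> b)" for b using zero_neq_one by (cases b) auto
  then show ?thesis using cf_zero[OF assms] by simp
qed

lemma cf_and:
  assumes "cf X c (\<lambda>z. chi (P z))" "cf X c (\<lambda>z. chi (Q z))"
  shows "cf X c (\<lambda>z. chi (P z \<and> Q z))"
proof -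
  have "chi (a \<and> b) = chi a \<otimes> chi b" for a b by (cases a; cases b) auto
  then show ?thesis using cf_mult[OF assms] by simp
qed

lemma cf_less: assumes "cf X c f" "cf X c g" shows "cf X c (\<lambda>z. chi (f z \<prec> g z))"
  using cf_neg[OF cf_zero[OF cf_sub[OF assms(2,1)]]] by (simp add: sub_eq_zero nn.not_le)

lemma cf_eq: assumes "cf X c f" "cf X c g" shows "cf X c (\<lambda>z. chi (f z = g z))"
proof -
  have "(a = b) = (\<not> a \<prec> b \<and> \<not> b \<prec> a)" for a b using less_linear[of a b] less_irrefl by auto
  then show ?thesis using cf_and[OF cf_neg[OF cf_less[OF assms]] cf_neg[OF cf_less[OF assms(2,1)]]] by presburger
qed

text \<open>Primitive recursion on the bound: the truth value up to \<open>n\<close> and that of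
  \<open>Q n\<close> give the one up to \<open>n \<oplus> \<one>\<close>. Disjunction is written
  with negation and conjunction, which are arithmetic on truth values.\<close>

lemma cf_bex:
  assumes t: "cf X c t" and Q: "cf X (\<lambda>w. pr (snd w) (c (fst w))) (\<lambda>w. chi (Q (snd w) (fst w)))"
    and graph: "\<And>z. \<Delta>0 (\<lambda>v. Q (v 0) z)"
  shows "cf X c (\<lambda>z. chi (\<exists>a. a \<prec> t z \<and> Q a z))"
proof (rule cf_rec[where F = "\<lambda>z n. chi (\<exists>a. a \<prec> n \<and> Q a z)", OF _ _ _ t])
  show "cf X c (\<lambda>z. chi (\<exists>a. a \<prec> \<zero> \<and> Q a z))" using cf_const by simp
  let ?c = "\<lambda>w. pr (c (fst w)) (pr (snd w) (chi (\<exists>a. a \<prec> snd w \<and> Q a (fst w))))"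
  have "cf X ?c (\<lambda>w. chi (Q (snd w) (fst w)))"
    by (rule cf_comp[OF Q cf_pair]) (rule cf_from2, rule cf_from1, rule cf_self, rule cf_from1, rule cf_self)
  moreover have "cf X ?c (\<lambda>w. chi (\<exists>a. a \<prec> snd w \<and> Q a (fst w)))"
    by (rule cf_from2, rule cf_from2, rule cf_self)
  ultimately have "cf X ?c (\<lambda>w. chi (\<not> (\<not> (\<exists>a. a \<prec> snd w \<and> Q a (fst w)) \<and> \<not> Q (snd w) (fst w))))"
    by (intro cf_neg cf_and)
  moreover have "(\<exists>a. a \<prec> n \<oplus> \<one> \<and> Q a z) = (\<not> (\<not> (\<exists>a. a \<prec> n \<and> Q a z) \<and> \<not> Q n z))" for n z
    by (auto simp: le_def)
  ultimately show "cf X ?c (\<lambda>w. chi (\<exists>a. a \<prec> snd w \<oplus> \<one> \<and> Q a (fst w)))" by presburger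
  show "\<Delta>0 (\<lambda>v. v (Suc 0) = chi (\<exists>a. a \<prec> v 0 \<and> Q a z))" for z
  proof -
    have "(y = chi P) = ((P \<and> y = \<one>) \<or> (\<not> P \<and> y = \<zero>))" for y P by (simp add: chi_def)
    then show ?thesis
      by (simp only:) (intro fm_or fm_and fm_neg fm_bex fm_inst1[where R = "\<lambda>a. Q a z", OF graph] fm_eq trm_intros)
  qed
qed

lemma cf_var: "i < N \<Longrightarrow> cf X (code N) (\<lambda>v. v i)"
proof (induction i arbitrary: N)
  case 0
  then obtain N' where "N = Suc N'" by (cases N) auto
  then have "code N = (\<lambda>v. pr (v 0) (code N' (\<lambda>i. v (Suc i))))" by auto
  then show ?case using cf_from1[OF cf_self] by simp
next
  case (Suc i)
  then obtain N' where N: "N = Suc N'" "i < N'" by (cases N) auto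
  then have "code N = (\<lambda>v. pr (v 0) (code N' (\<lambda>i. v (Suc i))))" by auto
  then show ?case using cf_from2[OF cf_reparam[OF Suc.IH[OF N(2)], of "\<lambda>v i. v (Suc i)"]] by simp
qed

lemma cf_trm: "trm t \<Longrightarrow> \<exists>N0. \<forall>N\<ge>N0. cf X (code N) t"
proof (induction rule: trm.induct)
  case (trm_var i) show ?case using cf_var[of i] by (intro exI[of _ "Suc i"]) simp
next
  case (trm_const k) show ?case using cf_const by blast
next
  case (trm_add s t)
  then obtain N1 N2 where "\<forall>N\<ge>N1. cf X (code N) s" "\<forall>N\<ge>N2. cf X (code N) t" by auto
  then show ?case by (intro exI[of _ "max N1 N2"]) (simp add: cf_add)
next
  case (trm_mult s t)
  then obtain N1 N2 where "\<forall>N\<ge>N1. cf X (code N) s" "\<forall>N\<ge>N2. cf X (code N) t" by auto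
  then show ?case by (intro exI[of _ "max N1 N2"]) (simp add: cf_mult)
qed

text \<open>Tuples may be longer than the formula requires; stating the claim for all large
  \<open>N\<close> lets subformulas share one length.\<close>

lemma cf_fm:
  assumes "fm \<beta> {X} P" "\<not> \<beta>"
  shows "\<exists>N0. \<forall>N\<ge>N0. cf X (code N) (\<lambda>v. chi (P v))"
  using assms
proof (induction rule: fm.induct)
  case (fm_eq s t)
  then obtain N1 N2 where "\<forall>N\<ge>N1. cf X (code N) s" "\<forall>N\<ge>N2. cf X (code N) t" using cf_trm by meson
  then show ?case by (intro exI[of _ "max N1 N2"]) (simp add: cf_eq)
next
  case (fm_less s t)
  then obtain N1 N2 where "\<forall>N\<ge>N1. cf X (code N) s" "\<forall>N\<ge>N2. cf X (code N) t" using cf_trm by meson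
  then show ?case by (intro exI[of _ "max N1 N2"]) (simp add: cf_less)
next
  case (fm_mem t Z)
  then obtain N1 where "\<forall>N\<ge>N1. cf X (code N) t" using cf_trm by meson
  then show ?case using fm_mem(2) by (intro exI[of _ N1]) (simp add: cf_mem)
next
  case (fm_neg P)
  then obtain N1 where "\<forall>N\<ge>N1. cf X (code N) (\<lambda>v. chi (P v))" by auto
  then show ?case by (intro exI[of _ N1]) (simp add: cf_neg)
next
  case (fm_and P Q)
  then obtain N1 N2 where "\<forall>N\<ge>N1. cf X (code N) (\<lambda>v. chi (P v))" "\<forall>N\<ge>N2. cf X (code N) (\<lambda>v. chi (Q v))" by auto
  then show ?case by (intro exI[of _ "max N1 N2"]) (simp add: cf_and)
next
  case (fm_bex0 t Q)
  obtain N1 where N1: "\<forall>N\<ge>N1. cf X (code N) t" using cf_trm[OF fm_bex0(1)] ..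
  obtain N2 where N2: "\<forall>N\<ge>N2. cf X (code N) (\<lambda>v. chi (Q v))" using fm_bex0.IH[OF fm_bex0.prems] ..
  have "cf X (code N) (\<lambda>v. chi (\<exists>a. a \<prec> t v \<and> Q (case_nat a v)))" if N: "N \<ge> max N1 N2" for N
  proof (rule cf_bex[where Q = "\<lambda>a v. Q (case_nat a v)"])
    show "cf X (code N) t" using N1 N by simp
    have "cf X (code (Suc N)) (\<lambda>v. chi (Q v))" using N2 N by simp
    from cf_reparam[OF this, of "\<lambda>w. case_nat (snd w) (fst w)"]
    show "cf X (\<lambda>w. pr (snd w) (code N (fst w))) (\<lambda>w. chi (Q (case_nat (snd w) (fst w))))" by simp
    show "\<Delta>0 (\<lambda>v. Q (case_nat (v 0) z))" for z
    proof -
      have "\<Delta>0 Q" by (rule fm_mono[OF fm_bex0(2)]) (use X fm_bex0.prems in auto)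
      moreover have "trm (\<lambda>v. case_nat (v 0) z i)" for i by (cases i) (simp_all add: trm_intros)
      ultimately show ?thesis by (rule fm_subst[where \<sigma> = "\<lambda>v. case_nat (v 0) z"])
    qed
  qed
  then show ?case by (intro exI[of _ "max N1 N2"]) simp
qed simp

text \<open>The search operator is applied to the characteristic function of the complement. It
  converges because a \<Delta>0 predicate with a witness has a least one, and all earlier tests
  yield nonzero values.\<close>

lemma semicomputable:
  assumes Q: "cf X (\<lambda>w. pr (c (fst w)) (snd w)) (\<lambda>w. chi (Q (fst w) (snd w)))"
    and \<Delta>: "\<And>z. \<Delta>0 (\<lambda>v. Q z (v 0))"
  shows "\<exists>e. \<forall>z. (\<exists>m. Q z m) \<longleftrightarrow> (\<exists>y. cmp e (c z) y)"
proof -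
  obtain a where a: "\<And>z m y. cmp a (pr (c z) m) y \<longleftrightarrow> y = chi (\<not> Q z m)"
    using cf_neg[OF Q] unfolding cf_def by auto
  have "(\<exists>m. Q z m) \<longleftrightarrow> (\<exists>y. cmp (pr (num M 9) a) (c z) y)" for z
  proof
    assume "\<exists>m. Q z m"
    then obtain n where "Q z n" "\<forall>k. k \<prec> n \<longrightarrow> \<not> Q z k" using \<Delta>0_least[where Q = "Q z", OF \<Delta>] by blast
    then have "cmp (pr (num M 9) a) (c z) n" using zero_neq_one by (auto simp: cmp_simps a)
    then show "\<exists>y. cmp (pr (num M 9) a) (c z) y" ..
  next
    assume "\<exists>y. cmp (pr (num M 9) a) (c z) y"
    then obtain y where "cmp a (pr (c z) y) \<zero>" by (auto simp: cmp_simps)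
    then have "Q z y" using zero_neq_one by (cases "Q z y") (auto simp: a)
    then show "\<exists>m. Q z m" ..
  qed
  then show ?thesis by blast
qed

end

section \<open>The jump as a complete \<Sigma>1 class\<close>

context rca0 begin

text \<open>The index of the computation that ignores its input and runs \<open>e\<close> on \<open>x\<close>, so that it lies in the
  jump iff \<open>{e}(x)\<close> converges.\<close>

definition section_index :: "'a \<Rightarrow> 'a \<Rightarrow> 'a" where
  "section_index e x = pr (num M 7) (pr e (pr (num M 0) x))"

lemma trm_section_index: "trm s \<Longrightarrow> trm t \<Longrightarrow> trm (\<lambda>v. section_index (s v) (t v))"
  unfolding section_index_def by (intro trm_pair trm_const)

end

context rca0_set begin

lemma section_index_jump: "section_index e x \<in> jump M X \<longleftrightarrow> (\<exists>y. cmp e x y)"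
proof -
  have "cmp (section_index e x) z y \<longleftrightarrow> cmp e x y" for z y
    unfolding section_index_def by (simp add: cmp_simps)
  then show ?thesis unfolding jump_def by blast
qed

lemma jump_complete:
  assumes "fm False {X} (\<lambda>v. Q (v 0) (v (Suc 0)))"
  shows "\<exists>e. \<forall>x. (\<exists>m. Q x m) \<longleftrightarrow> section_index e x \<in> jump M X"
  unfolding section_index_jump
proof (rule semicomputable[where c = "\<lambda>x. x" and Q = Q])
  obtain N where "cf X (code (Suc (Suc N))) (\<lambda>v. chi (Q (v 0) (v (Suc 0))))"
    using cf_fm[OF assms] by (metis le_add1 le_add2 not_less_eq_eq nat_le_iff_add add_Suc_right simp_thms)
  \<comment> \<open>The index expects a tuple of length \<open>Suc (Suc N)\<close>; the entries
    after the two that matter are filled with zeros.\<close>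
  from cf_reparam[OF this, of "\<lambda>w. case_nat (fst w) (case_nat (snd w) (\<lambda>_. \<zero>))"]
  have "cf X (\<lambda>w. pr (fst w) (pr (snd w) (code N (\<lambda>_. \<zero>)))) (\<lambda>w. chi (Q (fst w) (snd w)))" by simp
  then show "cf X (\<lambda>w. pr (fst w) (snd w)) (\<lambda>w. chi (Q (fst w) (snd w)))"
    by (rule cf_comp) (rule cf_pair, rule cf_from1, rule cf_self, rule cf_pair, rule cf_from2, rule cf_self, rule cf_const)
  have "\<Delta>0 (\<lambda>v. Q (v 0) (v (Suc 0)))" by (rule fm_mono[OF assms]) (use X in auto)
  then show "\<Delta>0 (\<lambda>v. Q z (v 0))" for z by (rule fm_inst2) (intro trm_intros)+
qed

text \<open>A search over an idle variable turns the truth of a decidable predicate into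
  convergence. In this way formulas with any number of variables become sections of the
  jump.\<close>

lemma jump_complete_code:
  assumes P: "fm False {X} P"
  shows "\<exists>N0. \<forall>N\<ge>N0. \<exists>e. \<forall>v. P v \<longleftrightarrow> section_index e (code N v) \<in> jump M X"
proof -
  obtain N0 where N0: "\<forall>N\<ge>N0. cf X (code N) (\<lambda>v. chi (P v))" using cf_fm[OF P] by auto
  have "\<exists>e. \<forall>v. (\<exists>m::'a. P v) \<longleftrightarrow> (\<exists>y. cmp e (code N v) y)" if "N \<ge> N0" for N
  proof (rule semicomputable[where Q = "\<lambda>v m. P v"])
    have "cf X (code N) (\<lambda>v. chi (P v))" using N0 that by blast
    from cf_from1[OF cf_reparam[OF this, of fst]]
    show "cf X (\<lambda>w. pr (code N (fst w)) (snd w)) (\<lambda>w. chi (P (fst w)))" .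
  qed (rule fm_const)
  then show ?thesis unfolding section_index_jump by auto
qed

end

context rca0 begin

section \<open>Arithmetically closed families of sets\<close>

lemmas fm_arith = TrueI fm_ex fm_all fm_basic trm_section_index

text \<open>Serves to trade several set parameters for a single oracle in which they are
  definable.\<close>

lemma fm_reduce:
  "fm \<beta> \<V> P \<Longrightarrow> (\<And>Z. Z \<in> \<V> \<Longrightarrow> fm \<beta> \<W> (\<lambda>v. v 0 \<in> Z)) \<Longrightarrow> fm \<beta> \<W> P"
proof (induction rule: fm.induct)
  case (fm_eq s t) show ?case by (rule fm.fm_eq[OF fm_eq(1,2)])
next
  case (fm_less s t) show ?case by (rule fm.fm_less[OF fm_less(1,2)])
next
  case (fm_mem t Z)
  show ?case by (rule fm_inst1[where R = "\<lambda>x. x \<in> Z", OF fm_mem.prems[OF fm_mem(2)] fm_mem(1)])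
next
  case (fm_neg P) show ?case by (rule fm.fm_neg[OF fm_neg.IH[OF fm_neg.prems]])
next
  case (fm_and P Q)
  show ?case by (rule fm.fm_and[OF fm_and.IH(1)[OF fm_and.prems] fm_and.IH(2)[OF fm_and.prems]])
next
  case (fm_bex0 t Q) show ?case by (rule fm.fm_bex0[OF fm_bex0(1) fm_bex0.IH[OF fm_bex0.prems]])
next
  case (fm_ex0 Q) show ?case by (rule fm.fm_ex0[OF fm_ex0(1) fm_ex0.IH[OF fm_ex0.prems]])
qed

definition arithmetically_closed :: "'a set set \<Rightarrow> bool" where
  "arithmetically_closed \<A> \<longleftrightarrow> \<A> \<subseteq> S \<and> (\<forall>P. fm True \<A> (\<lambda>v. P (v 0)) \<longrightarrow> {x. P x} \<in> \<A>)"

text \<open>The number of variables changes in an induction on formulas. Recording the truth set on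
  tuples of every large length \<open>N\<close> allows subformulas to be combined through members of
  \<open>\<A>\<close>.\<close>

definition represented :: "'a set set \<Rightarrow> ((nat \<Rightarrow> 'a) \<Rightarrow> bool) \<Rightarrow> bool" where
  "represented \<A> P \<longleftrightarrow> (\<exists>N0. \<forall>N\<ge>N0. \<exists>Z\<in>\<A>. \<forall>v. P v \<longleftrightarrow> code N v \<in> Z)"

text \<open>Closure under all formulas reduces to closure under one quantifier: a set of tuples is
  projected along its first entry, so each quantifier costs one application of
  \<open>\<Sigma>1\<close>. Intersections are the reason for two set parameters.\<close>

lemma arithmetically_closedI:
  assumes S: "\<A> \<subseteq> S" and ne: "\<A> \<noteq> {}"
    and \<Sigma>1: "\<And>Y Z Q. Y \<in> \<A> \<Longrightarrow> Z \<in> \<A> \<Longrightarrow> fm False {Y, Z} (\<lambda>v. Q (v 0) (v (Suc 0))) \<Longrightarrow> {x. \<exists>m. Q x m} \<in> \<A>"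
    and rep: "\<And>Z P. Z \<in> \<A> \<Longrightarrow> fm False {Z} P \<Longrightarrow> represented \<A> P"
  shows "arithmetically_closed \<A>"
proof -
  have \<Delta>0: "{x. Q x} \<in> \<A>" if "Y \<in> \<A>" "Z \<in> \<A>" "fm False {Y, Z} (\<lambda>v. Q (v 0))" for Y Z Q
    using \<Sigma>1[OF that(1,2), of "\<lambda>x m. Q x"] that(3) by simp
  obtain Z0 where Z0: "Z0 \<in> \<A>" using ne by blast
  have conj: "represented \<A> (\<lambda>v. P v \<and> Q v)" if "represented \<A> P" "represented \<A> Q" for P Q
  proof -
    obtain N1 where N1: "\<forall>N\<ge>N1. \<exists>Z\<in>\<A>. \<forall>v. P v \<longleftrightarrow> code N v \<in> Z" using \<open>represented \<A> P\<close> unfolding represented_def ..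
    obtain N2 where N2: "\<forall>N\<ge>N2. \<exists>Z\<in>\<A>. \<forall>v. Q v \<longleftrightarrow> code N v \<in> Z" using \<open>represented \<A> Q\<close> unfolding represented_def ..
    have "\<exists>Z\<in>\<A>. \<forall>v. P v \<and> Q v \<longleftrightarrow> code N v \<in> Z" if N: "N \<ge> max N1 N2" for N
    proof -
      have "N \<ge> N1" "N \<ge> N2" using N by simp_all
      obtain Y where Y: "Y \<in> \<A>" "\<forall>v. P v \<longleftrightarrow> code N v \<in> Y"
        using N1[THEN spec, THEN mp, OF \<open>N \<ge> N1\<close>] ..
      obtain Z where Z: "Z \<in> \<A>" "\<forall>v. Q v \<longleftrightarrow> code N v \<in> Z"
        using N2[THEN spec, THEN mp, OF \<open>N \<ge> N2\<close>] ..
      have "{x. x \<in> Y \<and> x \<in> Z} \<in> \<A>" by (rule \<Delta>0[OF Y(1) Z(1)]) (intro fm_and fm_mem trm_var, simp_all)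
      then show ?thesis using Y(2) Z(2) by (intro bexI[of _ "{x. x \<in> Y \<and> x \<in> Z}"]) auto
    qed
    then show ?thesis unfolding represented_def by blast
  qed
  have ex: "represented \<A> (\<lambda>v. \<exists>a. Q (case_nat a v))" if Q: "represented \<A> Q" for Q
  proof -
    obtain N1 where N1: "\<forall>N\<ge>N1. \<exists>Z\<in>\<A>. \<forall>v. Q v \<longleftrightarrow> code N v \<in> Z" using Q unfolding represented_def ..
    have "\<exists>Z\<in>\<A>. \<forall>v. (\<exists>a. Q (case_nat a v)) \<longleftrightarrow> code N v \<in> Z" if N: "N \<ge> N1" for N
    proof -
      have "Suc N \<ge> N1" using N by simp
      then obtain Z where Z: "Z \<in> \<A>" "\<forall>v. Q v \<longleftrightarrow> code (Suc N) v \<in> Z" using N1 by blast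
      have "{x. \<exists>a. pr a x \<in> Z} \<in> \<A>" by (rule \<Sigma>1[OF Z(1) Z(1)]) (intro fm_basic, simp)
      then show ?thesis using Z(2) by (intro bexI[of _ "{x. \<exists>a. pr a x \<in> Z}"]) auto
    qed
    then show ?thesis unfolding represented_def by blast
  qed
  have "represented \<A> P" if "fm True \<A> P" for P
    using that
  proof (induction rule: fm.induct)
    case (fm_eq s t) show ?case by (rule rep[OF Z0 fm.fm_eq[OF fm_eq]])
  next
    case (fm_less s t) show ?case by (rule rep[OF Z0 fm.fm_less[OF fm_less]])
  next
    case (fm_mem t Z) show ?case by (rule rep[OF fm_mem(2) fm.fm_mem[OF fm_mem(1)]]) simp
  next
    case (fm_neg P)
    obtain N1 where N1: "\<forall>N\<ge>N1. \<exists>Z\<in>\<A>. \<forall>v. P v \<longleftrightarrow> code N v \<in> Z" using fm_neg.IH unfolding represented_def ..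
    have "\<exists>Z\<in>\<A>. \<forall>v. \<not> P v \<longleftrightarrow> code N v \<in> Z" if N: "N \<ge> N1" for N
    proof -
      obtain Z where Z: "Z \<in> \<A>" "\<forall>v. P v \<longleftrightarrow> code N v \<in> Z" using N1 N by blast
      have "{x. x \<notin> Z} \<in> \<A>" by (rule \<Delta>0[OF Z(1) Z(1)]) (intro fm.fm_neg fm.fm_mem trm_var, simp)
      then show ?thesis using Z(2) by (intro bexI[of _ "{x. x \<notin> Z}"]) auto
    qed
    then show ?case unfolding represented_def by blast
  next
    case (fm_and P Q) then show ?case by (intro conj)
  next
    \<comment> \<open>A bounded quantifier is handled as an unbounded one with an atomic
      guard.\<close>
    case (fm_bex0 t Q)
    have "trm (\<lambda>v. t (\<lambda>i. v (Suc i)))" by (rule trm_subst[OF fm_bex0(1) trm_var])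
    then have "represented \<A> (\<lambda>v. v 0 \<prec> t (\<lambda>i. v (Suc i)))"
      by (intro rep[OF Z0] fm.fm_less trm_var)
    from ex[OF conj[OF this fm_bex0.IH]] show ?case by simp
  next
    case (fm_ex0 Q) show ?case by (rule ex[OF fm_ex0.IH])
  qed
  note main = this
  have "{x. P x} \<in> \<A>" if P: "fm True \<A> (\<lambda>v. P (v 0))" for P
  proof -
    obtain N0 where "\<forall>N\<ge>N0. \<exists>Z\<in>\<A>. \<forall>v. P (v 0) \<longleftrightarrow> code N v \<in> Z" using main[OF P] unfolding represented_def ..
    then have "\<exists>Z\<in>\<A>. \<forall>v. P (v 0) \<longleftrightarrow> code (Suc N0) v \<in> Z" using le_SucI[OF order.refl] by blast
    then obtain Z where Z: "Z \<in> \<A>" "\<forall>v. P (v 0) \<longleftrightarrow> code (Suc N0) v \<in> Z" by blast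
    have "P x \<longleftrightarrow> pr x (code N0 (\<lambda>_. \<zero>)) \<in> Z" for x
      using Z(2)[THEN spec, of "case_nat x (\<lambda>_. \<zero>)"] by simp
    moreover have "{x. pr x (code N0 (\<lambda>_. \<zero>)) \<in> Z} \<in> \<A>" by (rule \<Delta>0[OF Z(1) Z(1)]) (intro fm_basic, simp)
    ultimately show ?thesis by simp
  qed
  with S show ?thesis unfolding arithmetically_closed_def by blast
qed

lemma closedD: "arithmetically_closed \<A> \<Longrightarrow> fm True \<A> (\<lambda>v. P (v 0)) \<Longrightarrow> {x. P x} \<in> \<A>"
  unfolding arithmetically_closed_def by blast

end

section \<open>Arithmetical comprehension from jumps\<close>

locale omega_jumps = rca0 +
  assumes omega: "\<forall>X\<in>set_part M. \<exists>Y\<in>set_part M. is_omega_jump M X Y"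
begin

text \<open>The instance \<open>n = \<one>\<close> of an omega-jump provides a set whose column
  \<open>\<one>\<close> is the jump.\<close>

lemma jump_in_S:
  assumes X: "X \<in> S" shows "jump M X \<in> S"
proof -
  obtain Y where "is_omega_jump M X Y" using omega X by blast
  then obtain W where W: "W \<in> S" "projection M W \<zero> = X"
    "\<forall>i. i \<prec> \<one> \<longrightarrow> projection M W (i \<oplus> \<one>) = jump M (projection M W i)"
    unfolding is_omega_jump_def is_iterated_jump_def by blast
  have "projection M W (\<zero> \<oplus> \<one>) = jump M X" using W(3)[THEN spec, of \<zero>] W(2) by simp
  then have "jump M X = {x. pr (\<zero> \<oplus> \<one>) x \<in> W}" by (simp add: projection_def)
  then show ?thesis by (simp only:) (rule \<Delta>0_comprehension, intro fm_basic W(1))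
qed

text \<open>This is arithmetical comprehension in the model. A \<Sigma>1 class with two parameters
  is a section of the jump of their join.\<close>

lemma S_closed: "arithmetically_closed S"
proof (rule arithmetically_closedI)
  fix Y Z Q assume YZ: "Y \<in> S" "Z \<in> S" and Q: "fm False {Y, Z} (\<lambda>v. Q (v 0) (v (Suc 0)))"
  \<comment> \<open>The join, with tags \<open>\<zero>\<close> and \<open>\<one>\<close>; the bound
    on \<open>x\<close> makes its definition \<Delta>0.\<close>
  define X where "X = {p. \<exists>x. x \<prec> p \<oplus> \<one> \<and> (p = pr \<zero> x \<and> x \<in> Y \<or> p = pr \<one> x \<and> x \<in> Z)}"
  have X: "X \<in> S" unfolding X_def by (rule \<Delta>0_comprehension) (intro fm_basic YZ)
  have "Y = {x. pr \<zero> x \<in> X}" "Z = {x. pr \<one> x \<in> X}"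
    unfolding X_def using zero_neq_one by auto
  then have Y: "\<And>x. x \<in> Y \<longleftrightarrow> pr \<zero> x \<in> X" and Z: "\<And>x. x \<in> Z \<longleftrightarrow> pr \<one> x \<in> X" by auto
  have "fm False {X} (\<lambda>v. v 0 \<in> Y)" unfolding Y by (intro fm_basic) simp
  moreover have "fm False {X} (\<lambda>v. v 0 \<in> Z)" unfolding Z by (intro fm_basic) simp
  ultimately have Q': "fm False {X} (\<lambda>v. Q (v 0) (v (Suc 0)))" by (intro fm_reduce[OF Q]) auto
  interpret rca0_set M X using X by unfold_locales
  obtain e where "\<forall>x. (\<exists>m. Q x m) \<longleftrightarrow> section_index e x \<in> jump M X"
    using jump_complete[OF Q'] ..
  then have "{x. \<exists>m. Q x m} = {x. section_index e x \<in> jump M X}" by simp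
  then show "{x. \<exists>m. Q x m} \<in> S"
    by (simp only:) (rule \<Delta>0_comprehension, intro fm_basic trm_section_index jump_in_S X)
next
  fix Z P assume Z: "Z \<in> S" and P: "fm False {Z} P"
  interpret rca0_set M Z using Z by unfold_locales
  obtain N0 where N0: "\<forall>N\<ge>N0. \<exists>e. \<forall>v. P v \<longleftrightarrow> section_index e (code N v) \<in> jump M Z"
    using jump_complete_code[OF P] ..
  have "\<exists>Y\<in>S. \<forall>v. P v \<longleftrightarrow> code N v \<in> Y" if N: "N \<ge> N0" for N
  proof -
    obtain e where "\<forall>v. P v \<longleftrightarrow> section_index e (code N v) \<in> jump M Z" using N0[THEN spec, THEN mp, OF N] ..
    moreover have "{x. section_index e x \<in> jump M Z} \<in> S"
      by (rule \<Delta>0_comprehension) (intro fm_basic trm_section_index jump_in_S Z)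
    ultimately show ?thesis by (intro bexI[of _ "{x. section_index e x \<in> jump M Z}"]) simp_all
  qed
  then show "represented S P" unfolding represented_def by blast
qed (use S_nonempty in auto)

lemmas comprehension = closedD[OF S_closed]

lemma arith_induct:
  assumes "fm True S (\<lambda>v. Q (v 0))" "Q \<zero>" "\<And>n. Q n \<Longrightarrow> Q (n \<oplus> \<one>)"
  shows "Q n"
proof -
  have Z: "{n. Q n} \<in> S" by (rule comprehension[OF assms(1)])
  have "n \<in> {n. Q n}"
    by (rule \<Delta>0_induct[where Q = "\<lambda>n. n \<in> {n. Q n}"]) (intro fm_mem trm_var Z, use assms(2,3) in auto)
  then show ?thesis by simp
qed

lemma arith_least:
  assumes "fm True S (\<lambda>v. Q (v 0))" "Q m"
  shows "\<exists>n. Q n \<and> (\<forall>k. k \<prec> n \<longrightarrow> \<not> Q k)"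
proof -
  have Z: "{n. Q n} \<in> S" by (rule comprehension[OF assms(1)])
  have "\<Delta>0 (\<lambda>v. v 0 \<in> {n. Q n})" by (intro fm_mem trm_var Z)
  from \<Delta>0_least[where Q = "\<lambda>n. n \<in> {n. Q n}", OF this, of m] assms(2) show ?thesis by simp
qed

lemma arith_less_induct:
  assumes "fm True S (\<lambda>v. Q (v 0))" "\<And>n. (\<And>k. k \<prec> n \<Longrightarrow> Q k) \<Longrightarrow> Q n"
  shows "Q n"
  using arith_least[where Q = "\<lambda>n. \<not> Q n", OF fm_neg[OF assms(1)], of n] assms(2) by blast

lemma code_exists_arith:
  assumes "fm True S (\<lambda>v. P (v 0))"
  shows "\<exists>s. \<forall>i. fmem M i s \<longleftrightarrow> i \<prec> k \<and> P i"
proof -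
  have Z: "{n. P n} \<in> S" by (rule comprehension[OF assms])
  have "\<Delta>0 (\<lambda>v. v 0 \<in> {n. P n})" by (intro fm_mem trm_var Z)
  from code_exists[where P = "\<lambda>n. n \<in> {n. P n}", OF this, of k] show ?thesis by simp
qed

lemma collection:
  assumes R: "fm True S (\<lambda>v. R (v 0) (v (Suc 0)))" and ex: "\<And>x. x \<prec> k \<Longrightarrow> \<exists>y. R x y"
  shows "\<exists>b. \<forall>x. x \<prec> k \<longrightarrow> (\<exists>y. y \<prec> b \<and> R x y)"
proof -
  have "n \<preceq> k \<longrightarrow> (\<exists>b. \<forall>x. x \<prec> n \<longrightarrow> (\<exists>y. y \<prec> b \<and> R x y))" for n
  proof (rule arith_induct[where Q = "\<lambda>n. n \<preceq> k \<longrightarrow> (\<exists>b. \<forall>x. x \<prec> n \<longrightarrow> (\<exists>y. y \<prec> b \<and> R x y))"])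
    show "fm True S (\<lambda>v. v 0 \<preceq> k \<longrightarrow> (\<exists>b. \<forall>x. x \<prec> v 0 \<longrightarrow> (\<exists>y. y \<prec> b \<and> R x y)))"
      by (intro fm_inst2[where R = R, OF R] fm_arith)
    fix n assume IH: "n \<preceq> k \<longrightarrow> (\<exists>b. \<forall>x. x \<prec> n \<longrightarrow> (\<exists>y. y \<prec> b \<and> R x y))"
    show "n \<oplus> \<one> \<preceq> k \<longrightarrow> (\<exists>b. \<forall>x. x \<prec> n \<oplus> \<one> \<longrightarrow> (\<exists>y. y \<prec> b \<and> R x y))"
    proof
      assume "n \<oplus> \<one> \<preceq> k"
      then have n: "n \<prec> k" by (simp add: suc_le_iff)
      then obtain y where y: "R n y" using ex by blast
      obtain b where b: "\<forall>x. x \<prec> n \<longrightarrow> (\<exists>y. y \<prec> b \<and> R x y)" using IH n by (auto simp: le_def)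
      have "\<exists>z. z \<prec> b \<oplus> (y \<oplus> \<one>) \<and> R x z" if x: "x \<preceq> n" for x
      proof (cases "x = n")
        case True then show ?thesis using y by (intro exI[of _ y]) (simp add: add_suc)
      next
        case False
        then obtain z where "z \<prec> b" "R x z" using b x by (auto simp: le_def)
        moreover have "b \<preceq> b \<oplus> (y \<oplus> \<one>)" by (rule le_add1)
        ultimately show ?thesis by (intro exI[of _ z]) (auto intro: nn.less_le_trans)
      qed
      then show "\<exists>b. \<forall>x. x \<prec> n \<oplus> \<one> \<longrightarrow> (\<exists>y. y \<prec> b \<and> R x y)"
        unfolding less_suc_iff by blast
    qed
  qed simp
  from this[of k] show ?thesis by simp
qed

section \<open>The levels of an omega-jump\<close>

lemma projection_in_S: "W \<in> S \<Longrightarrow> projection M W n \<in> S"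
  unfolding projection_def by (rule comprehension) (intro fm_arith)

text \<open>Each \<open>n\<close> comes with its own witness \<open>W\<close>, tied to
  \<open>Y\<close> in column \<open>n\<close>. Two witnesses agree on their common columns, by
  induction in the model, so the columns of \<open>Y\<close> itself form the sequence of
  jumps.\<close>

lemma omega_jump_suc:
  assumes "is_omega_jump M X Y"
  shows "projection M Y (n \<oplus> \<one>) = jump M (projection M Y n)"
proof -
  obtain W where W: "W \<in> S" "projection M W \<zero> = X" "projection M W n = projection M Y n"
    "\<And>i. i \<prec> n \<Longrightarrow> projection M W (i \<oplus> \<one>) = jump M (projection M W i)"
    using assms unfolding is_omega_jump_def is_iterated_jump_def by metis
  obtain W' where W': "W' \<in> S" "projection M W' \<zero> = X" "projection M W' (n \<oplus> \<one>) = projection M Y (n \<oplus> \<one>)"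
    "\<And>i. i \<prec> n \<oplus> \<one> \<Longrightarrow> projection M W' (i \<oplus> \<one>) = jump M (projection M W' i)"
    using assms unfolding is_omega_jump_def is_iterated_jump_def by metis
  \<comment> \<open>Equality of columns is spelled out elementwise, which makes it arithmetical in
    \<open>W\<close> and \<open>W'\<close> and open to induction.\<close>
  have iff: "projection M W i = projection M W' i \<longleftrightarrow> (\<forall>x. pr i x \<in> W \<longleftrightarrow> pr i x \<in> W')" for i
    unfolding projection_def by auto
  have "i \<preceq> n \<longrightarrow> (\<forall>x. pr i x \<in> W \<longleftrightarrow> pr i x \<in> W')" for i
  proof (rule arith_induct[where Q = "\<lambda>i. i \<preceq> n \<longrightarrow> (\<forall>x. pr i x \<in> W \<longleftrightarrow> pr i x \<in> W')"])
    show "fm True S (\<lambda>v. v 0 \<preceq> n \<longrightarrow> (\<forall>x. pr (v 0) x \<in> W \<longleftrightarrow> pr (v 0) x \<in> W'))"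
      by (intro fm_arith W(1) W'(1))
    show "\<zero> \<preceq> n \<longrightarrow> (\<forall>x. pr \<zero> x \<in> W \<longleftrightarrow> pr \<zero> x \<in> W')"
      unfolding iff[symmetric] by (simp add: W(2) W'(2))
    fix i assume "i \<preceq> n \<longrightarrow> (\<forall>x. pr i x \<in> W \<longleftrightarrow> pr i x \<in> W')"
    then show "i \<oplus> \<one> \<preceq> n \<longrightarrow> (\<forall>x. pr (i \<oplus> \<one>) x \<in> W \<longleftrightarrow> pr (i \<oplus> \<one>) x \<in> W')"
      unfolding iff[symmetric] suc_le_iff using W(4)[of i] W'(4)[of i] by (auto simp: le_def)
  qed
  then have "projection M W n = projection M W' n" unfolding iff by simp
  then show ?thesis using W(3) W'(3) W'(4)[of n] by simp
qed

lemma omega_jump_zero: "is_omega_jump M X Y \<Longrightarrow> projection M Y \<zero> = X"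
  unfolding is_omega_jump_def is_iterated_jump_def by metis

text \<open>If \<open>Y\<close> is an omega-jump, this is the domain of the \<open>e\<close>-th
  function computable from column \<open>j\<close>. It is read off from column
  \<open>j \<oplus> \<one>\<close>, the jump of column \<open>j\<close>.\<close>

definition level :: "'a set \<Rightarrow> 'a \<Rightarrow> 'a \<Rightarrow> 'a set" where
  "level Y j e = {x. pr (j \<oplus> \<one>) (section_index e x) \<in> Y}"

lemma level_complete:
  assumes Y: "Y \<in> S" and o: "is_omega_jump M X Y"
    and Q: "fm False {projection M Y j} (\<lambda>v. Q (v 0) (v (Suc 0)))"
  shows "\<exists>e. {x. \<exists>m. Q x m} = level Y j e"
proof -
  interpret rca0_set M "projection M Y j" using projection_in_S[OF Y] by unfold_locales
  obtain e where e: "\<forall>x. (\<exists>m. Q x m) \<longleftrightarrow> section_index e x \<in> jump M (projection M Y j)" using jump_complete[OF Q] ..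
  have "{x. \<exists>m. Q x m} = level Y j e"
    using e unfolding omega_jump_suc[OF o, symmetric] unfolding level_def projection_def by simp
  then show ?thesis ..
qed

lemma level_suc:
  assumes Y: "Y \<in> S" and o: "is_omega_jump M X Y"
  shows "\<exists>e'. level Y j e = level Y (j \<oplus> \<one>) e'"
proof -
  have "fm False {projection M Y (j \<oplus> \<one>)} (\<lambda>v. section_index e (v 0) \<in> projection M Y (j \<oplus> \<one>))"
    by (intro fm_mem trm_section_index trm_intros) simp
  from level_complete[OF Y o, where Q = "\<lambda>x m. section_index e x \<in> projection M Y (j \<oplus> \<one>)", OF this]
  show ?thesis by (simp add: level_def projection_def)
qed

text \<open>The distance \<open>d\<close> may be nonstandard, so the indices are carried upwards by
  induction in the model.\<close>

lemma level_mono: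
  assumes Y: "Y \<in> S" and o: "is_omega_jump M X Y"
  shows "\<exists>e'. level Y i e = level Y (i \<oplus> d) e'"
proof -
  have eq: "level Y i e = level Y j e' \<longleftrightarrow> (\<forall>x. pr (i \<oplus> \<one>) (section_index e x) \<in> Y \<longleftrightarrow>
      pr (j \<oplus> \<one>) (section_index e' x) \<in> Y)" for j e'
    unfolding level_def by auto
  show ?thesis
  proof (rule arith_induct[where Q = "\<lambda>d. \<exists>e'. level Y i e = level Y (i \<oplus> d) e'"])
    show "fm True S (\<lambda>v. \<exists>e'. level Y i e = level Y (i \<oplus> v 0) e')"
      unfolding eq by (intro fm_arith Y)
    show "\<exists>e'. level Y i e = level Y (i \<oplus> \<zero>) e'" by (auto simp: add_zero)
    fix d assume "\<exists>e'. level Y i e = level Y (i \<oplus> d) e'"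
    then show "\<exists>e'. level Y i e = level Y (i \<oplus> (d \<oplus> \<one>)) e'"
      unfolding add_suc using level_suc[OF Y o, of "i \<oplus> d"] by metis
  qed
qed

text \<open>Two members are moved to the common level \<open>i \<oplus> j\<close>, where both are
  decidable from column \<open>(i \<oplus> j) \<oplus> \<one>\<close>. A quantifier over them leads
  one level up, and there is no last level.\<close>

lemma levels_closed:
  assumes Y: "Y \<in> S" and o: "is_omega_jump M X Y"
  shows "arithmetically_closed {Z. \<exists>j e. Z = level Y j e}" (is "arithmetically_closed ?\<A>")
proof (rule arithmetically_closedI)
  show "?\<A> \<subseteq> S"
    unfolding level_def using comprehension by (auto intro!: \<Delta>0_comprehension fm_basic trm_section_index Y)
  show "?\<A> \<noteq> {}" by auto
  fix U Z Q assume U: "U \<in> ?\<A>" and Z: "Z \<in> ?\<A>" and Q: "fm False {U, Z} (\<lambda>v. Q (v 0) (v (Suc 0)))"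
  obtain i a where ia: "U = level Y i a" using U by blast
  obtain j b where jb: "Z = level Y j b" using Z by blast
  obtain a' where a': "U = level Y (i \<oplus> j) a'" using level_mono[OF Y o, of i a j] ia by blast
  obtain b' where b': "Z = level Y (i \<oplus> j) b'"
    using level_mono[OF Y o, of j b i] jb by (auto simp: add_commute)
  let ?k = "(i \<oplus> j) \<oplus> \<one>"
  have mem: "fm False {projection M Y ?k} (\<lambda>v. v 0 \<in> level Y (i \<oplus> j) c)" for c
  proof -
    have "x \<in> level Y (i \<oplus> j) c \<longleftrightarrow> section_index c x \<in> projection M Y ?k" for x
      by (simp add: level_def projection_def)
    then show ?thesis by (simp only:) (intro fm_mem trm_section_index trm_intros, simp)
  qed
  have "fm False {projection M Y ?k} (\<lambda>v. Q (v 0) (v (Suc 0)))"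
    by (rule fm_reduce[OF Q]) (use mem a' b' in auto)
  from level_complete[OF Y o this] show "{x. \<exists>m. Q x m} \<in> ?\<A>" by auto
next
  fix Z P assume Z: "Z \<in> ?\<A>" and P: "fm False {Z} P"
  obtain j b where jb: "Z = level Y j b" using Z by blast
  let ?k = "j \<oplus> \<one>"
  have "x \<in> Z \<longleftrightarrow> section_index b x \<in> projection M Y ?k" for x
    by (simp add: level_def projection_def jb)
  then have "fm False {projection M Y ?k} (\<lambda>v. v 0 \<in> Z)"
    by (simp only:) (intro fm_mem trm_section_index trm_intros, simp)
  then have P': "fm False {projection M Y ?k} P" by (intro fm_reduce[OF P]) auto
  interpret rca0_set M "projection M Y ?k" using projection_in_S[OF Y] by unfold_locales
  obtain N0 where N0: "\<forall>N\<ge>N0. \<exists>e. \<forall>v. P v \<longleftrightarrow> section_index e (code N v) \<in> jump M (projection M Y ?k)"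
    using jump_complete_code[OF P'] ..
  have "\<exists>Z\<in>?\<A>. \<forall>v. P v \<longleftrightarrow> code N v \<in> Z" if N: "N \<ge> N0" for N
  proof -
    obtain e where "\<forall>v. P v \<longleftrightarrow> section_index e (code N v) \<in> jump M (projection M Y ?k)" using N0[THEN spec, THEN mp, OF N] ..
    then have "\<forall>v. P v \<longleftrightarrow> code N v \<in> level Y ?k e"
      unfolding omega_jump_suc[OF o, symmetric] unfolding level_def projection_def by simp
    then show ?thesis by blast
  qed
  then show "represented ?\<A> P" unfolding represented_def by blast
qed

text \<open>The first component of an index \<open>pr w (pr j e)\<close> is a padding, so that every set of the family has
  arbitrarily large indices.\<close>

lemma coded_closed_family:
  assumes X: "X \<in> S"
  obtains U where "U \<in> S" "arithmetically_closed (range (projection M U))" "X \<in> range (projection M U)"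
    "\<And>e b. \<exists>e'. b \<preceq> e' \<and> projection M U e' = projection M U e"
proof -
  obtain Y where Y: "Y \<in> S" and o: "is_omega_jump M X Y" using omega X by blast
  let ?\<A> = "{Z. \<exists>j e. Z = level Y j e}"
  define U where "U = {p. \<exists>w j e x. p = pr (pr w (pr j e)) x \<and> pr (j \<oplus> \<one>) (section_index e x) \<in> Y}"
  have U: "U \<in> S" unfolding U_def by (rule comprehension) (intro fm_arith Y)
  have row: "projection M U (pr w (pr j e)) = level Y j e" for w j e
    unfolding projection_def U_def level_def by auto
  have row': "projection M U e = {}" if "\<nexists>w j i. e = pr w (pr j i)" for e
    unfolding projection_def U_def using that by auto
  \<comment> \<open>Numbers that are not of the form \<open>pr w (pr j e)\<close> have an empty
    column, which must be a member of the family too.\<close>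
  have "{x. x \<noteq> x} \<in> ?\<A>" by (rule closedD[OF levels_closed[OF Y o]]) (intro fm_arith)
  then obtain j0 e0 where empty: "level Y j0 e0 = {}" by auto
  have row_ex: "\<exists>j i. projection M U e = level Y j i" for e
  proof (cases "\<exists>w j i. e = pr w (pr j i)")
    case True then show ?thesis using row by blast
  next
    case False then show ?thesis using row' empty by blast
  qed
  have range: "range (projection M U) = ?\<A>"
  proof (intro equalityI subsetI)
    fix Z assume "Z \<in> ?\<A>"
    then obtain j e where "Z = level Y j e" by blast
    then have "Z = projection M U (pr \<zero> (pr j e))" by (simp add: row)
    then show "Z \<in> range (projection M U)" by blast
  qed (use row_ex in blast)
  have "fm False {projection M Y \<zero>} (\<lambda>v. v 0 \<in> projection M Y \<zero>)" by (intro fm_mem trm_var) simp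
  from level_complete[OF Y o, where Q = "\<lambda>x m. x \<in> projection M Y \<zero>", OF this]
  have "X \<in> ?\<A>" by (auto simp: omega_jump_zero[OF o])
  moreover have "\<exists>e'. b \<preceq> e' \<and> projection M U e' = projection M U e" for b e
  proof -
    obtain j i where "projection M U e = level Y j i" using row_ex by blast
    then have "projection M U (pr b (pr j i)) = projection M U e" by (simp add: row)
    then show ?thesis using le_pair1 by blast
  qed
  ultimately show thesis using that[OF U] levels_closed[OF Y o] unfolding range by blast
qed

end

section \<open>Canonical codes of finite sets\<close>

context rca0 begin

lemma fm_finset_code: "trm s \<Longrightarrow> fm True \<V> (\<lambda>v. finset_code M (s v))"
  by (rule fm_inst1) (unfold finset_code_def, (intro fm_arith)+)

lemma finset_code_unique:
  assumes "finset_code M s" "finset_code M t" "\<And>i. fmem M i s \<longleftrightarrow> fmem M i t"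
  shows "s = t"
  using assms less_linear[of s t] unfolding finset_code_def by blast

text \<open>The counterpart of \<open>restr\<close> with a coded set in place of \<open>Z\<close>,
  usable while the set under construction exists only in finite approximations.\<close>

definition is_restr :: "'a \<Rightarrow> 'a \<Rightarrow> 'a \<Rightarrow> bool" where
  "is_restr s t n \<longleftrightarrow> finset_code M t \<and> (\<forall>i. fmem M i t \<longleftrightarrow> i \<prec> n \<and> fmem M i s)"

definition restr :: "'a set \<Rightarrow> 'a \<Rightarrow> 'a" where
  "restr Z n = (THE s. finset_code M s \<and> (\<forall>i. fmem M i s \<longleftrightarrow> i \<prec> n \<and> i \<in> Z))"

lemma fm_is_restr: "trm s \<Longrightarrow> trm t \<Longrightarrow> trm u \<Longrightarrow> fm True \<V> (\<lambda>v. is_restr (s v) (t v) (u v))"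
  by (rule fm_inst3) (unfold is_restr_def, (intro fm_finset_code fm_arith)+)

end

context omega_jumps begin

lemma finset_code_exists:
  assumes "fm True S (\<lambda>v. P (v 0))"
  shows "\<exists>s. finset_code M s \<and> (\<forall>i. fmem M i s \<longleftrightarrow> i \<prec> k \<and> P i)"
proof -
  obtain s where s: "\<forall>i. fmem M i s \<longleftrightarrow> i \<prec> k \<and> P i" using code_exists_arith[where P = P, OF assms] ..
  have "fm True S (\<lambda>v. \<forall>i. fmem M i (v 0) \<longleftrightarrow> fmem M i s)" by (intro fm_arith)
  from arith_least[where Q = "\<lambda>t. \<forall>i. fmem M i t \<longleftrightarrow> fmem M i s", OF this, of s]
  obtain t where t: "\<forall>i. fmem M i t \<longleftrightarrow> fmem M i s" "\<forall>k. k \<prec> t \<longrightarrow> \<not> (\<forall>i. fmem M i k \<longleftrightarrow> fmem M i s)" by auto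
  then have "finset_code M t" unfolding finset_code_def by simp
  with s t(1) show ?thesis by (intro exI[of _ t]) simp
qed

lemma restr:
  assumes "Z \<in> S"
  shows restr_code: "finset_code M (restr Z n)" and fmem_restr: "fmem M i (restr Z n) \<longleftrightarrow> i \<prec> n \<and> i \<in> Z"
proof -
  have Z: "fm True S (\<lambda>v. v 0 \<in> Z)" using assms by (intro fm_arith)
  obtain s where s: "finset_code M s \<and> (\<forall>i. fmem M i s \<longleftrightarrow> i \<prec> n \<and> i \<in> Z)"
    using finset_code_exists[where P = "\<lambda>i. i \<in> Z", OF Z] ..
  then have "finset_code M (restr Z n) \<and> (\<forall>i. fmem M i (restr Z n) \<longleftrightarrow> i \<prec> n \<and> i \<in> Z)"
    unfolding restr_def by (rule theI) (metis s finset_code_unique)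
  then show "finset_code M (restr Z n)" "fmem M i (restr Z n) \<longleftrightarrow> i \<prec> n \<and> i \<in> Z" by simp_all
qed

lemma restr_eqI:
  assumes "Z \<in> S" "finset_code M t" "\<And>i. fmem M i t \<longleftrightarrow> i \<prec> n \<and> i \<in> Z"
  shows "t = restr Z n"
  by (rule finset_code_unique[OF assms(2) restr_code[OF assms(1)]]) (simp add: assms(3) fmem_restr[OF assms(1)])

lemma is_restr_cong:
  assumes "\<And>i. i \<prec> n \<Longrightarrow> fmem M i s \<longleftrightarrow> fmem M i s'"
  shows "is_restr s t n \<longleftrightarrow> is_restr s' t n"
  unfolding is_restr_def using assms by metis

section \<open>Recursion, cohesive sets and choice\<close>

lemma fm_S: "arithmetically_closed \<A> \<Longrightarrow> fm True \<A> P \<Longrightarrow> fm True S P"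
  using fm_mono[of True \<A> P S True] unfolding arithmetically_closed_def by simp

text \<open>Course-of-values recursion. The approximations are coded finite sets, hence numbers, so
  the set assembled from the correct ones is arithmetical over \<open>\<A>\<close>. Correct
  approximations agree, and they exist at every length, by induction in the model.\<close>

lemma set_recursion:
  assumes \<A>: "arithmetically_closed \<A>" and \<Psi>: "fm True \<A> (\<lambda>v. \<Psi> (v 0) (v (Suc 0)))"
  shows "\<exists>G\<in>\<A>. \<forall>n. n \<in> G \<longleftrightarrow> \<Psi> (restr G n) n"
proof -
  note \<Psi>' = fm_inst2[where R = \<Psi>, OF \<Psi>]
  define good where "good s n \<longleftrightarrow> (\<forall>j. j \<prec> n \<longrightarrow> (fmem M j s \<longleftrightarrow> (\<exists>t. is_restr s t j \<and> \<Psi> t j)))" for s n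
  have good: "fm True \<A> (\<lambda>v. good (v 0) (v (Suc 0)))"
    unfolding good_def by (intro \<Psi>' fm_is_restr fm_arith)
  note good' = fm_inst2[where R = good, OF good] and goodS = fm_inst2[where R = good, OF fm_S[OF \<A> good]]
  have good_less: "good s m" if "good s n" "m \<preceq> n" for s m n
    using that unfolding good_def by (auto intro: nn.less_le_trans)
  have uniq: "j \<prec> n \<longrightarrow> (fmem M j s \<longleftrightarrow> fmem M j s')" if g: "good s n" "good s' n" for s s' n j
  proof (rule arith_less_induct[where Q = "\<lambda>j. j \<prec> n \<longrightarrow> (fmem M j s \<longleftrightarrow> fmem M j s')"])
    show "fm True S (\<lambda>v. v 0 \<prec> n \<longrightarrow> (fmem M (v 0) s \<longleftrightarrow> fmem M (v 0) s'))" by (intro fm_arith)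
    fix j assume IH: "\<And>k. k \<prec> j \<Longrightarrow> k \<prec> n \<longrightarrow> (fmem M k s \<longleftrightarrow> fmem M k s')"
    show "j \<prec> n \<longrightarrow> (fmem M j s \<longleftrightarrow> fmem M j s')"
    proof
      assume j: "j \<prec> n"
      then have "is_restr s t j \<longleftrightarrow> is_restr s' t j" for t
        using IH less_trans by (intro is_restr_cong) blast
      then show "fmem M j s \<longleftrightarrow> fmem M j s'" using g j unfolding good_def by simp
    qed
  qed
  have ex: "\<exists>s. good s n" for n
  proof (rule arith_induct[where Q = "\<lambda>n. \<exists>s. good s n"])
    show "fm True S (\<lambda>v. \<exists>s. good s (v 0))" by (intro goodS fm_arith)
    show "\<exists>s. good s \<zero>" by (simp add: good_def)
    fix n assume "\<exists>s. good s n"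
    then obtain s where s: "good s n" ..
    have "fm True S (\<lambda>v. (v 0 \<prec> n \<and> fmem M (v 0) s) \<or> (v 0 = n \<and> (\<exists>t. is_restr s t n \<and> \<Psi> t n)))"
      by (intro fm_S[OF \<A>] \<Psi>' fm_is_restr fm_arith)
    from code_exists_arith[where P = "\<lambda>i. (i \<prec> n \<and> fmem M i s) \<or> (i = n \<and> (\<exists>t. is_restr s t n \<and> \<Psi> t n))",
        OF this, of "n \<oplus> \<one>"]
    obtain s' where s': "\<And>i. fmem M i s' \<longleftrightarrow> i \<preceq> n \<and> ((i \<prec> n \<and> fmem M i s) \<or> (i = n \<and> (\<exists>t. is_restr s t n \<and> \<Psi> t n)))"
      by auto
    have agree: "fmem M i s' \<longleftrightarrow> fmem M i s" if "i \<prec> n" for i using that s' less_irrefl by (auto simp: le_def)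
    have r: "is_restr s' t j \<longleftrightarrow> is_restr s t j" if "j \<preceq> n" for t j
      using that by (intro is_restr_cong agree) (auto intro: nn.less_le_trans)
    have "fmem M j s' \<longleftrightarrow> (\<exists>t. is_restr s' t j \<and> \<Psi> t j)" if j: "j \<preceq> n" for j
    proof (cases "j = n")
      case True then show ?thesis using s' r[of n] by (simp add: le_def less_irrefl)
    next
      case False
      then have "j \<prec> n" using j by (simp add: le_def)
      then show ?thesis using agree r[OF j] s unfolding good_def by simp
    qed
    then have "good s' (n \<oplus> \<one>)" unfolding good_def by simp
    then show "\<exists>s. good s (n \<oplus> \<one>)" ..
  qed
  define G where "G = {n. \<exists>s. good s (n \<oplus> \<one>) \<and> fmem M n s}"
  have G: "G \<in> \<A>" unfolding G_def by (rule closedD[OF \<A>]) (intro good' fm_arith)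
  then have GS: "G \<in> S" using \<A> unfolding arithmetically_closed_def by blast
  have "n \<in> G \<longleftrightarrow> \<Psi> (restr G n) n" for n
  proof -
    obtain s where s: "good s (n \<oplus> \<one>)" using ex by blast
    have mem: "j \<in> G \<longleftrightarrow> fmem M j s" if "j \<preceq> n" for j
    proof -
      have sj: "good s (j \<oplus> \<one>)" by (rule good_less[OF s]) (use that in simp)
      have eq: "fmem M j s' \<longleftrightarrow> fmem M j s" if "good s' (j \<oplus> \<one>)" for s'
        using uniq[OF that sj, of j] by simp
      show ?thesis
      proof
        assume "j \<in> G"
        then obtain s' where "good s' (j \<oplus> \<one>) \<and> fmem M j s'" unfolding G_def mem_Collect_eq ..
        then show "fmem M j s" by (elim conjE) (rule eq[THEN iffD1])
      next
        assume "fmem M j s"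
        with sj show "j \<in> G" unfolding G_def mem_Collect_eq by (intro exI[of _ s] conjI)
      qed
    qed
    have "is_restr s t n \<longleftrightarrow> t = restr G n" for t
    proof
      assume r: "is_restr s t n"
      show "t = restr G n"
      proof (rule restr_eqI[OF GS])
        show "finset_code M t" using r unfolding is_restr_def ..
        show "fmem M i t \<longleftrightarrow> i \<prec> n \<and> i \<in> G" for i
          using r mem[of i] unfolding is_restr_def le_def by metis
      qed
    next
      assume t: "t = restr G n"
      have "fmem M i t \<longleftrightarrow> i \<prec> n \<and> fmem M i s" for i
        unfolding t fmem_restr[OF GS] using mem[of i] unfolding le_def by metis
      then show "is_restr s t n" unfolding is_restr_def using restr_code[OF GS] t by simp
    qed
    moreover have "fmem M n s \<longleftrightarrow> (\<exists>t. is_restr s t n \<and> \<Psi> t n)" using s unfolding good_def by simp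
    ultimately show ?thesis using mem[of n] by simp
  qed
  with G show ?thesis by blast
qed

text \<open>All \<open>Q t\<close> are treated at once. \<open>G\<close> records for each
  \<open>t\<close> a side that leaves unboundedly many elements of \<open>R\<close> compatible with
  the earlier decisions; \<open>R'\<close> is a diagonal through the decreasing classes
  \<open>B t\<close> of compatible elements.\<close>

lemma cohesive:
  assumes \<A>: "arithmetically_closed \<A>" and R: "R \<in> \<A>" "unbounded M R"
    and Q: "fm True \<A> (\<lambda>v. Q (v 0) (v (Suc 0)))"
  shows "\<exists>R'\<in>\<A>. unbounded M R' \<and> R' \<subseteq> R \<and>
    (\<forall>t. (\<exists>b. \<forall>x\<in>R'. b \<prec> x \<longrightarrow> Q t x) \<or> (\<exists>b. \<forall>x\<in>R'. b \<prec> x \<longrightarrow> \<not> Q t x))"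
proof -
  note Q' = fm_inst2[where R = Q, OF Q]
  \<comment> \<open>\<open>s\<close> stands for the decisions on all \<open>i \<prec> t\<close>; the
    positive side is preferred whenever it is unbounded.\<close>
  let ?\<Psi> = "\<lambda>s t. \<forall>b. \<exists>x. b \<prec> x \<and> x \<in> R \<and> (\<forall>i. i \<prec> t \<longrightarrow> (Q i x \<longleftrightarrow> fmem M i s)) \<and> Q t x"
  have "fm True \<A> (\<lambda>v. ?\<Psi> (v 0) (v (Suc 0)))" by (intro Q' fm_arith R(1))
  from set_recursion[where \<Psi> = ?\<Psi>, OF \<A> this]
  obtain G where G: "G \<in> \<A>" "\<And>n. n \<in> G \<longleftrightarrow> ?\<Psi> (restr G n) n" by auto
  have AS: "\<A> \<subseteq> S" using \<A> unfolding arithmetically_closed_def by blast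
  then have GS: "G \<in> S" and RS: "R \<in> S" using G(1) R(1) by auto
  define B where "B t x \<longleftrightarrow> x \<in> R \<and> (\<forall>i. i \<prec> t \<longrightarrow> (Q i x \<longleftrightarrow> i \<in> G))" for t x
  have fB: "fm True \<A> (\<lambda>v. B (v 0) (v (Suc 0)))" unfolding B_def by (intro Q' fm_arith R(1) G(1))
  note B' = fm_inst2[where R = B, OF fB] and BS = fm_inst2[where R = B, OF fm_S[OF \<A> fB]]
  have G2: "t \<in> G \<longleftrightarrow> (\<forall>b. \<exists>x. b \<prec> x \<and> B t x \<and> Q t x)" for t
    by (subst G(2)) (auto simp: B_def fmem_restr[OF GS])
  have Bsuc: "B (t \<oplus> \<one>) x \<longleftrightarrow> B t x \<and> (Q t x \<longleftrightarrow> t \<in> G)" for t x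
    unfolding B_def by (auto simp: le_def)
  have Bmono: "B t x" if "B t' x" "t \<preceq> t'" for t t' x using that unfolding B_def by (auto intro: nn.less_le_trans)
  have Bunb: "\<forall>b. \<exists>x. b \<prec> x \<and> B t x" for t
  proof (rule arith_induct[where Q = "\<lambda>t. \<forall>b. \<exists>x. b \<prec> x \<and> B t x"])
    show "fm True S (\<lambda>v. \<forall>b. \<exists>x. b \<prec> x \<and> B (v 0) x)" by (intro BS fm_arith)
    show "\<forall>b. \<exists>x. b \<prec> x \<and> B \<zero> x" using R(2) unfolding unbounded_def B_def by auto
    fix t assume IH: "\<forall>b. \<exists>x. b \<prec> x \<and> B t x"
    show "\<forall>b. \<exists>x. b \<prec> x \<and> B (t \<oplus> \<one>) x"
    proof (cases "t \<in> G")
      case True then show ?thesis unfolding Bsuc using G2 by auto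
    next
      case False
      then obtain b0 where b0: "\<And>x. b0 \<prec> x \<Longrightarrow> B t x \<Longrightarrow> \<not> Q t x" using G2 by blast
      show ?thesis
      proof
        fix b
        obtain x where x: "b0 \<oplus> b \<prec> x" "B t x" using IH by blast
        have "b0 \<prec> x" "b \<prec> x" using x(1) le_add1(1)[of b0 b] le_add1(2)[of b b0] by order+
        then show "\<exists>x. b \<prec> x \<and> B (t \<oplus> \<one>) x" using x(2) b0 False unfolding Bsuc by blast
      qed
    qed
  qed
  \<comment> \<open>The least compatible element not below \<open>t\<close> is selected for each
    \<open>t\<close>. The lower bound makes the selection unbounded; leastness makes late elements
    compatible with many decisions.\<close>
  define R' where "R' = {x. \<exists>t. B t x \<and> t \<preceq> x \<and> (\<forall>y. y \<prec> x \<longrightarrow> \<not> (B t y \<and> t \<preceq> y))}"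
  have R'A: "R' \<in> \<A>" unfolding R'_def by (rule closedD[OF \<A>]) (intro B' fm_arith)
  have least: "\<exists>x. B t x \<and> t \<preceq> x \<and> (\<forall>y. y \<prec> x \<longrightarrow> \<not> (B t y \<and> t \<preceq> y))" for t
  proof -
    have "fm True S (\<lambda>v. B t (v 0) \<and> t \<preceq> v 0)" by (intro BS fm_arith)
    moreover obtain x where "t \<prec> x \<and> B t x" using Bunb[of t] by blast
    ultimately show ?thesis using arith_least[where Q = "\<lambda>x. B t x \<and> t \<preceq> x", of x] by (auto simp: le_def)
  qed
  have "unbounded M R'"
    unfolding unbounded_def
  proof
    fix n
    obtain x where x: "B (n \<oplus> \<one>) x \<and> n \<oplus> \<one> \<preceq> x \<and> (\<forall>y. y \<prec> x \<longrightarrow> \<not> (B (n \<oplus> \<one>) y \<and> n \<oplus> \<one> \<preceq> y))"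
      using least[of "n \<oplus> \<one>"] ..
    then have "x \<in> R'" unfolding R'_def by blast
    moreover have "n \<prec> x" using x suc_le_iff by blast
    ultimately show "\<exists>m\<in>R'. n \<prec> m" by blast
  qed
  moreover have "R' \<subseteq> R" unfolding R'_def B_def by blast
  moreover have "(\<exists>b. \<forall>x\<in>R'. b \<prec> x \<longrightarrow> Q i x) \<or> (\<exists>b. \<forall>x\<in>R'. b \<prec> x \<longrightarrow> \<not> Q i x)" for i
  proof -
    let ?t = "i \<oplus> \<one>"
    obtain x0 where x0: "B ?t x0" "?t \<preceq> x0" using least[of ?t] by blast
    have "Q i x \<longleftrightarrow> i \<in> G" if x: "x \<in> R'" "x0 \<prec> x" for x
    proof -
      obtain t where t: "B t x" "\<And>y. y \<prec> x \<Longrightarrow> \<not> (B t y \<and> t \<preceq> y)" using x(1) unfolding R'_def by blast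
      \<comment> \<open>Had \<open>x\<close> been selected for an earlier \<open>t\<close>, the
        smaller \<open>x0\<close> would have been an admissible choice for it.\<close>
      have "?t \<preceq> t"
      proof (rule ccontr)
        assume "\<not> ?t \<preceq> t"
        then have "t \<preceq> ?t" by simp
        then show False using t(2)[OF x(2)] Bmono[OF x0(1)] x0(2) nn.order.trans by blast
      qed
      from Bmono[OF t(1) this] show ?thesis unfolding Bsuc by simp
    qed
    then show ?thesis by blast
  qed
  ultimately show ?thesis using R'A by blast
qed

text \<open>The least witness is chosen each time, and the graph is obtained by
  \<open>set_recursion\<close> over the codes of its pairs. The pair for \<open>n\<close> must have
  a smaller code than the one for \<open>n \<oplus> \<one>\<close>; this is why the witnesses have
  to be nondecreasing and why the coded family carries a padding.\<close>

lemma dependent_choice: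
  assumes \<Phi>: "fm True S (\<lambda>v. \<Phi> (v 0) (v (Suc 0)) (v (Suc (Suc 0))))"
    and I: "fm True S (\<lambda>v. I (v 0) (v (Suc 0)))" and e0: "I \<zero> e0"
    and step: "\<And>n e. I n e \<Longrightarrow> \<exists>e'. e \<preceq> e' \<and> \<Phi> n e e' \<and> I (n \<oplus> \<one>) e'"
  shows "\<exists>f. f \<zero> = e0 \<and> (\<forall>n. I n (f n) \<and> \<Phi> n (f n) (f (n \<oplus> \<one>))) \<and> fm True S (\<lambda>v. v (Suc 0) = f (v 0))"
proof -
  note \<Phi>' = fm_inst3[where R = \<Phi>, OF \<Phi>] and I' = fm_inst2[where R = I, OF I]
  define N where "N n e e' \<longleftrightarrow> e \<preceq> e' \<and> \<Phi> n e e' \<and> I (n \<oplus> \<one>) e' \<and>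
    (\<forall>k. k \<prec> e' \<longrightarrow> \<not> (e \<preceq> k \<and> \<Phi> n e k \<and> I (n \<oplus> \<one>) k))" for n e e'
  have N: "fm True S (\<lambda>v. N (v 0) (v (Suc 0)) (v (Suc (Suc 0))))" unfolding N_def by (intro \<Phi>' I' fm_arith)
  note N' = fm_inst3[where R = N, OF N]
  have N_ex: "\<exists>!e'. N n e e'" if e: "I n e" for n e
  proof -
    obtain d where d: "e \<preceq> d \<and> \<Phi> n e d \<and> I (n \<oplus> \<one>) d" using step[OF e] ..
    have "fm True S (\<lambda>v. e \<preceq> v 0 \<and> \<Phi> n e (v 0) \<and> I (n \<oplus> \<one>) (v 0))" by (intro \<Phi>' I' fm_arith)
    from arith_least[where Q = "\<lambda>k. e \<preceq> k \<and> \<Phi> n e k \<and> I (n \<oplus> \<one>) k", OF this d]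
    obtain e' where e': "N n e e'" unfolding N_def by auto
    moreover have "e'' = e'" if "N n e e''" for e''
      using that e' less_linear[of e' e''] unfolding N_def by metis
    ultimately show ?thesis by blast
  qed
  let ?\<Psi> = "\<lambda>s p. \<exists>n e. p = pr n e \<and> ((n = \<zero> \<and> e = e0) \<or>
    (\<exists>n' e'. n = n' \<oplus> \<one> \<and> fmem M (pr n' e') s \<and> N n' e' e))"
  have "fm True S (\<lambda>v. ?\<Psi> (v 0) (v (Suc 0)))" by (intro N' fm_arith)
  from set_recursion[where \<Psi> = ?\<Psi>, OF S_closed this]
  obtain G where G: "G \<in> S" "\<And>n. n \<in> G \<longleftrightarrow> ?\<Psi> (restr G n) n" by auto
  have G0: "pr \<zero> e \<in> G \<longleftrightarrow> e = e0" for e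
    by (subst G(2)) (auto simp: suc_neq_zero[symmetric])
  have Gsuc: "pr (n \<oplus> \<one>) e \<in> G \<longleftrightarrow> (\<exists>e'. pr n e' \<in> G \<and> N n e' e)" for n e
  proof -
    have "pr n e' \<prec> pr (n \<oplus> \<one>) e" if "N n e' e" for e'
    proof (rule pair_less)
      have "n \<oplus> e' \<preceq> n \<oplus> e" using that unfolding N_def by simp
      moreover have "n \<oplus> e \<prec> (n \<oplus> \<one>) \<oplus> e" by (simp add: suc_add)
      ultimately show "n \<oplus> e' \<prec> (n \<oplus> \<one>) \<oplus> e" by order
    qed
    then show ?thesis
      by (subst G(2)) (auto simp: suc_inject fmem_restr[OF G(1)])
  qed
  \<comment> \<open>The invariant and the functionality of the graph are proved together, as a
    witness for the next step exists only under the invariant.\<close>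
  have main: "\<exists>e. I n e \<and> (\<forall>e'. pr n e' \<in> G \<longleftrightarrow> e' = e)" for n
  proof (rule arith_induct[where Q = "\<lambda>n. \<exists>e. I n e \<and> (\<forall>e'. pr n e' \<in> G \<longleftrightarrow> e' = e)"])
    show "fm True S (\<lambda>v. \<exists>e. I (v 0) e \<and> (\<forall>e'. pr (v 0) e' \<in> G \<longleftrightarrow> e' = e))"
      by (intro I' fm_arith G(1))
    show "\<exists>e. I \<zero> e \<and> (\<forall>e'. pr \<zero> e' \<in> G \<longleftrightarrow> e' = e)" using e0 G0 by blast
    fix n assume "\<exists>e. I n e \<and> (\<forall>e'. pr n e' \<in> G \<longleftrightarrow> e' = e)"
    then obtain e where e: "I n e" "\<And>e'. pr n e' \<in> G \<longleftrightarrow> e' = e" by auto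
    obtain d where d: "N n e d" "\<And>d'. N n e d' \<Longrightarrow> d' = d" using N_ex[OF e(1)] by blast
    have "I (n \<oplus> \<one>) d" using d(1) by (simp add: N_def)
    moreover have "pr (n \<oplus> \<one>) d' \<in> G \<longleftrightarrow> d' = d" for d' using Gsuc[of n d'] e(2) d by metis
    ultimately show "\<exists>e. I (n \<oplus> \<one>) e \<and> (\<forall>e'. pr (n \<oplus> \<one>) e' \<in> G \<longleftrightarrow> e' = e)" by (intro exI[of _ d]) simp
  qed
  then obtain f where f: "\<And>n. I n (f n)" "\<And>n e. pr n e \<in> G \<longleftrightarrow> e = f n" by metis
  have "f \<zero> = e0" using f(2) G0 by metis
  moreover have "\<Phi> n (f n) (f (n \<oplus> \<one>))" for n
  proof -
    have "pr (n \<oplus> \<one>) (f (n \<oplus> \<one>)) \<in> G" using f(2) by simp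
    then obtain e' where "pr n e' \<in> G" "N n e' (f (n \<oplus> \<one>))" unfolding Gsuc by blast
    then have "N n (f n) (f (n \<oplus> \<one>))" using f(2) by simp
    then show ?thesis by (simp add: N_def)
  qed
  moreover have "fm True S (\<lambda>v. v (Suc 0) = f (v 0))"
    unfolding f(2)[symmetric] by (intro fm_arith G(1))
  ultimately show ?thesis using f(1) by blast
qed

end

context rca0 begin

section \<open>Limit colourings\<close>

definition is_insert :: "'a \<Rightarrow> 'a \<Rightarrow> 'a \<Rightarrow> bool" where
  "is_insert s x t \<longleftrightarrow> finset_code M t \<and> (\<forall>i. fmem M i t \<longleftrightarrow> fmem M i s \<or> i = x)"

lemma fm_is_insert: "trm s \<Longrightarrow> trm t \<Longrightarrow> trm u \<Longrightarrow> fm True \<V> (\<lambda>v. is_insert (s v) (t v) (u v))"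
  by (rule fm_inst3) (unfold is_insert_def, (intro fm_finset_code fm_arith)+)

lemma is_insert_unique: "is_insert s x t \<Longrightarrow> is_insert s x u \<Longrightarrow> t = u"
  unfolding is_insert_def using finset_code_unique by simp

lemma fm_has_card: "trm s \<Longrightarrow> trm t \<Longrightarrow> fm True \<V> (\<lambda>v. has_card M (s v) (t v))"
  by (rule fm_inst2) (unfold has_card_def Ex1_def, (intro fm_arith)+)

lemma fm_is_min: "trm s \<Longrightarrow> trm t \<Longrightarrow> fm True \<V> (\<lambda>v. is_min M (s v) (t v))"
  by (rule fm_inst2) (unfold is_min_def, (intro fm_arith)+)

text \<open>Internal cardinality is tied to an external bijection with a coded graph, so that the
  counting can be done with \<open>bij_betw\<close>.\<close>

lemma has_cardI:
  assumes F: "bij_betw F {i. i \<prec> k} {x. fmem M x s}"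
    and f: "\<And>p. fmem M p f \<longleftrightarrow> (\<exists>i. i \<prec> k \<and> p = pr i (F i))"
  shows "has_card M s k"
proof -
  have f2: "fmem M (pr i x) f \<longleftrightarrow> i \<prec> k \<and> x = F i" for i x unfolding f pair_eq by metis
  show ?thesis
  unfolding has_card_def
proof (rule exI[of _ f], intro conjI allI impI)
  fix p assume "fmem M p f"
  then have "\<exists>i. i \<prec> k \<and> p = pr i (F i)" by (rule f[THEN iffD1])
  then obtain i where i: "i \<prec> k" "p = pr i (F i)" by (elim exE conjE) (rule that)
  have "F i \<in> {x. fmem M x s}" by (rule bij_betw_apply[OF F]) (simp add: i(1))
  with i show "\<exists>i x. p = pr i x \<and> i \<prec> k \<and> fmem M x s" by (intro exI[of _ i] exI[of _ "F i"]) simp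
next
  fix i assume "i \<prec> k" then show "\<exists>!x. fmem M (pr i x) f" unfolding f2 by simp
next
  fix x assume "fmem M x s"
  then have "x \<in> F ` {i. i \<prec> k}" using bij_betw_imp_surj_on[OF F] by simp
  then obtain i where i: "i \<prec> k" "x = F i" by (elim imageE) (rule that, simp_all)
  show "\<exists>!i. fmem M (pr i x) f" unfolding f2
  proof (rule ex1I[of _ i])
    fix j assume "j \<prec> k \<and> x = F j"
    then have j: "j \<in> {i. i \<prec> k}" "F j = F i" using i(2) by simp_all
    show "j = i" by (rule inj_onD[OF bij_betw_imp_inj_on[OF F] j(2,1)]) (simp add: i(1))
  qed (simp add: i)
qed
qed

lemma has_cardE:
  assumes "has_card M s k"
  shows "\<exists>F f. bij_betw F {i. i \<prec> k} {x. fmem M x s} \<and> (\<forall>p. fmem M p f \<longleftrightarrow> (\<exists>i. i \<prec> k \<and> p = pr i (F i)))"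
proof -
  obtain f where f: "\<forall>p. fmem M p f \<longrightarrow> (\<exists>i x. p = pr i x \<and> i \<prec> k \<and> fmem M x s)"
    "\<forall>i. i \<prec> k \<longrightarrow> (\<exists>!x. fmem M (pr i x) f)" "\<forall>x. fmem M x s \<longrightarrow> (\<exists>!i. fmem M (pr i x) f)"
    using assms unfolding has_card_def by (elim exE conjE) (rule that)
  define F where "F i = (THE x. fmem M (pr i x) f)" for i
  have F: "fmem M (pr i x) f \<longleftrightarrow> i \<prec> k \<and> x = F i" for i x
  proof
    assume a: "fmem M (pr i x) f"
    then have i: "i \<prec> k" using f(1) by auto
    then have "F i = x" unfolding F_def using f(2) a by (intro the1_equality) simp_all
    with i show "i \<prec> k \<and> x = F i" by simp
  next
    assume "i \<prec> k \<and> x = F i"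
    then show "fmem M (pr i x) f" unfolding F_def using theI'[OF f(2)[THEN spec, THEN mp]] by simp
  qed
  have mem: "fmem M (F i) s" if "i \<prec> k" for i
  proof -
    have "fmem M (pr i (F i)) f" using F that by simp
    then show ?thesis using f(1) by fastforce
  qed
  have "inj_on F {i. i \<prec> k}"
  proof (rule inj_onI)
    fix i j assume ij: "i \<in> {i. i \<prec> k}" "j \<in> {i. i \<prec> k}" "F i = F j"
    then have "fmem M (pr i (F i)) f" "fmem M (pr j (F i)) f" using F by simp_all
    then show "i = j" using f(3) mem ij(1) by blast
  qed
  moreover have "F ` {i. i \<prec> k} = {x. fmem M x s}"
  proof (intro equalityI subsetI)
    fix x assume "x \<in> {x. fmem M x s}"
    then obtain i where "fmem M (pr i x) f" using f(3) by blast
    then show "x \<in> F ` {i. i \<prec> k}" using F by auto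
  qed (use mem in auto)
  ultimately have "bij_betw F {i. i \<prec> k} {x. fmem M x s}" unfolding bij_betw_def by simp
  moreover have "fmem M p f \<longleftrightarrow> (\<exists>i. i \<prec> k \<and> p = pr i (F i))" for p
    using F f(1) by metis
  ultimately show ?thesis by blast
qed

lemma has_card_zero: "has_card M s \<zero> \<Longrightarrow> \<not> fmem M x s"
  by (drule has_cardE) (auto simp: bij_betw_def)

lemma has_card_empty: "has_card M s k \<Longrightarrow> (\<And>x. \<not> fmem M x s) \<Longrightarrow> k = \<zero>"
proof (rule ccontr)
  assume a: "has_card M s k" "\<And>x. \<not> fmem M x s" "k \<noteq> \<zero>"
  then have "\<zero> \<prec> k" by (simp add: zero_less_iff)
  moreover obtain F where "bij_betw F {i. i \<prec> k} {x. fmem M x s}" using has_cardE[OF a(1)] by (elim exE conjE) (rule that)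
  ultimately have "fmem M (F \<zero>) s" unfolding bij_betw_def by auto
  then show False using a(2) by blast
qed

end

context omega_jumps begin

text \<open>If \<open>x\<close> is not the last value of the enumeration \<open>F\<close> of
  \<open>t\<close>, the last value \<open>F k\<close> takes its place; the index \<open>k\<close> is
  then dropped.\<close>

lemma has_card_remove:
  assumes x: "\<not> fmem M x s" and t: "\<And>i. fmem M i t \<longleftrightarrow> fmem M i s \<or> i = x"
    and c: "has_card M t (k \<oplus> \<one>)"
  shows "has_card M s k"
proof -
  obtain F f where F: "bij_betw F {i. i \<prec> k \<oplus> \<one>} {x. fmem M x t}"
    and f: "\<forall>p. fmem M p f \<longleftrightarrow> (\<exists>i. i \<prec> k \<oplus> \<one> \<and> p = pr i (F i))"
    using has_cardE[OF c] by (elim exE conjE) (rule that)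
  have inj: "i = j" if "F i = F j" "i \<preceq> k" "j \<preceq> k" for i j
    by (rule inj_onD[OF bij_betw_imp_inj_on[OF F] that(1)]) (simp_all add: that(2,3))
  have ne: "F i \<noteq> F k" if "i \<prec> k" for i
    using inj[of i k] that less_irrefl by (auto simp: le_def)
  have FE: "fmem M (F i) s \<or> F i = x" if "i \<preceq> k" for i
    using bij_betwE[OF F] that t by simp
  have surj: "\<exists>i. i \<preceq> k \<and> F i = y" if "fmem M y s \<or> y = x" for y
  proof -
    have "y \<in> F ` {i. i \<prec> k \<oplus> \<one>}" using F that t unfolding bij_betw_def by simp
    then show ?thesis unfolding image_iff less_suc_iff by auto
  qed
  define G where "G i = (if F i = x then F k else F i)" for i
  have "bij_betw G {i. i \<prec> k} {x. fmem M x s}"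
    unfolding bij_betw_def
  proof
    show "inj_on G {i. i \<prec> k}"
    proof (rule inj_onI)
      fix i j assume "i \<in> {i. i \<prec> k}" "j \<in> {i. i \<prec> k}" and G: "G i = G j"
      then have i: "i \<prec> k" and j: "j \<prec> k" by simp_all
      have "F i = F j"
        using G ne[OF i] ne[OF j] unfolding G_def by (cases "F i = x"; cases "F j = x") simp_all
      then show "i = j" by (rule inj) (simp_all add: le_def i j)
    qed
    show "G ` {i. i \<prec> k} = {x. fmem M x s}"
    proof (intro equalityI subsetI)
      fix y assume "y \<in> G ` {i. i \<prec> k}"
      then obtain i where i: "i \<prec> k" "y = G i" by blast
      have "G i \<noteq> x" using ne[OF i(1)] unfolding G_def by (cases "F i = x") simp_all
      moreover have "G i = F i \<or> G i = F k" unfolding G_def by simp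
      moreover have "i \<preceq> k" using i(1) by (simp add: le_def)
      ultimately have "fmem M (G i) s" using FE[of i] FE[of k] by auto
      then show "y \<in> {x. fmem M x s}" using i(2) by simp
    next
      fix y assume "y \<in> {x. fmem M x s}"
      then have y: "fmem M y s" "y \<noteq> x" using x by auto
      obtain i where i: "i \<preceq> k" "F i = y" using surj y(1) by blast
      show "y \<in> G ` {i. i \<prec> k}"
      proof (cases "i = k")
        case True
        obtain j where j: "j \<preceq> k" "F j = x" using surj by blast
        then have "j \<prec> k" using True i(2) y(2) by (auto simp: le_def)
        moreover have "G j = y" unfolding G_def using j(2) True i(2) by simp
        ultimately show ?thesis by blast
      next
        case False
        then have "i \<prec> k" using i(1) by (simp add: le_def)
        moreover have "G i = y" unfolding G_def using i(2) y(2) by simp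
        ultimately show ?thesis by blast
      qed
    qed
  qed
  moreover
  have "fm True S (\<lambda>v. \<exists>i y. v 0 = pr i y \<and> i \<prec> k \<and> ((y \<noteq> x \<and> fmem M (pr i y) f) \<or>
      (fmem M (pr i x) f \<and> fmem M (pr k y) f)))" by (intro fm_arith)
  \<comment> \<open>\<open>f\<close> bounds the new graph: the moved pair \<open>pr i (F k)\<close>
    is at most \<open>pr k (F k)\<close>, an element of \<open>f\<close>.\<close>
  from code_exists_arith[where P = "\<lambda>p. \<exists>i y. p = pr i y \<and> i \<prec> k \<and> ((y \<noteq> x \<and> fmem M (pr i y) f) \<or>
      (fmem M (pr i x) f \<and> fmem M (pr k y) f))", OF this, of f]
  obtain g where g: "\<And>p. fmem M p g \<longleftrightarrow> p \<prec> f \<and> (\<exists>i y. p = pr i y \<and> i \<prec> k \<and> ((y \<noteq> x \<and> fmem M (pr i y) f) \<or>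
      (fmem M (pr i x) f \<and> fmem M (pr k y) f)))" by auto
  have f': "fmem M (pr i y) f \<longleftrightarrow> i \<preceq> k \<and> y = F i" for i y by (auto simp: f)
  have "fmem M p g \<longleftrightarrow> (\<exists>i. i \<prec> k \<and> p = pr i (G i))" for p
  proof
    assume "fmem M p g"
    then obtain i y where p: "p = pr i y" "i \<prec> k" "(y \<noteq> x \<and> fmem M (pr i y) f) \<or> (fmem M (pr i x) f \<and> fmem M (pr k y) f)"
      unfolding g by auto
    then have "y = G i" unfolding f' G_def by auto
    with p show "\<exists>i. i \<prec> k \<and> p = pr i (G i)" by blast
  next
    assume "\<exists>i. i \<prec> k \<and> p = pr i (G i)"
    then obtain i where i: "i \<prec> k" "p = pr i (G i)" by blast
    have k: "fmem M (pr k (F k)) f" "fmem M (pr i (F i)) f" using i(1) by (simp_all add: f' le_def)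
    have "pr i (F k) \<preceq> pr k (F k)" using i(1) by (intro pair_mono) (simp_all add: le_def)
    then have "p \<prec> f" using fmem_less[OF k(1)] fmem_less[OF k(2)] i(2) unfolding G_def
      by (auto intro: nn.le_less_trans)
    moreover have "(G i \<noteq> x \<and> fmem M (pr i (G i)) f) \<or> (fmem M (pr i x) f \<and> fmem M (pr k (G i)) f)"
      using k unfolding G_def by auto
    ultimately show "fmem M p g" unfolding g using i by blast
  qed
  ultimately show ?thesis by (rule has_cardI)
qed

text \<open>A set containing \<open>k\<close> arises by one insertion from a set below
  \<open>k\<close>, and collection bounds the results of all these insertions. Quantification over
  the subsets of an initial segment thereby becomes bounded.\<close>

lemma subset_code_bound: "\<exists>b. \<forall>t. finset_code M t \<and> (\<forall>x. fmem M x t \<longrightarrow> x \<prec> k) \<longrightarrow> t \<prec> b"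
proof (rule arith_induct[where Q = "\<lambda>k. \<exists>b. \<forall>t. finset_code M t \<and> (\<forall>x. fmem M x t \<longrightarrow> x \<prec> k) \<longrightarrow> t \<prec> b"])
  show "fm True S (\<lambda>v. \<exists>b. \<forall>t. finset_code M t \<and> (\<forall>x. fmem M x t \<longrightarrow> x \<prec> v 0) \<longrightarrow> t \<prec> b)"
    by (intro fm_finset_code fm_arith)
  have "s = t" if "finset_code M t \<and> (\<forall>x. fmem M x t \<longrightarrow> x \<prec> \<zero>)" "finset_code M s \<and> (\<forall>x. fmem M x s \<longrightarrow> x \<prec> \<zero>)" for s t
    using that by (intro finset_code_unique) auto
  then show "\<exists>b. \<forall>t. finset_code M t \<and> (\<forall>x. fmem M x t \<longrightarrow> x \<prec> \<zero>) \<longrightarrow> t \<prec> b"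
    using less_add_suc by metis
  fix k assume "\<exists>b. \<forall>t. finset_code M t \<and> (\<forall>x. fmem M x t \<longrightarrow> x \<prec> k) \<longrightarrow> t \<prec> b"
  then obtain b where b: "\<And>t. finset_code M t \<Longrightarrow> (\<forall>x. fmem M x t \<longrightarrow> x \<prec> k) \<Longrightarrow> t \<prec> b" by auto
  have "fm True S (\<lambda>v. \<forall>t. is_insert (v 0) k t \<longrightarrow> t \<prec> v (Suc 0))" by (intro fm_is_insert fm_arith)
  moreover have "\<exists>y. \<forall>t. is_insert u k t \<longrightarrow> t \<prec> y" for u
  proof (cases "\<exists>t. is_insert u k t")
    case True
    then obtain t where t: "is_insert u k t" ..
    have "t \<prec> t \<oplus> \<one>" by simp
    then show ?thesis using t is_insert_unique by blast
  qed blast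
  ultimately obtain d where d: "\<forall>u. u \<prec> b \<longrightarrow> (\<exists>y. y \<prec> d \<and> (\<forall>t. is_insert u k t \<longrightarrow> t \<prec> y))"
    using collection[where R = "\<lambda>u y. \<forall>t. is_insert u k t \<longrightarrow> t \<prec> y" and k = b] by blast
  have "t \<prec> b \<oplus> d" if t: "finset_code M t" "\<forall>x. fmem M x t \<longrightarrow> x \<prec> k \<oplus> \<one>" for t
  proof (cases "fmem M k t")
    case False
    then have "\<forall>x. fmem M x t \<longrightarrow> x \<prec> k" using t(2) by (auto simp: le_def)
    then show ?thesis using b[OF t(1)] le_add1(1)[of b d] by (auto intro: nn.less_le_trans)
  next
    case True
    have "fm True S (\<lambda>v. fmem M (v 0) t)" by (intro fm_arith)
    from finset_code_exists[where P = "\<lambda>i. fmem M i t", OF this, of k]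
    obtain u where u: "finset_code M u" "\<And>i. fmem M i u \<longleftrightarrow> i \<prec> k \<and> fmem M i t" by auto
    have "is_insert u k t" unfolding is_insert_def using t True by (auto simp: u(2) le_def)
    moreover have "u \<prec> b" using b u by simp
    ultimately obtain y where "y \<prec> d" "t \<prec> y" using d by blast
    then show ?thesis using le_add1(2)[of d b] by order
  qed
  then show "\<exists>b. \<forall>t. finset_code M t \<and> (\<forall>x. fmem M x t \<longrightarrow> x \<prec> k \<oplus> \<one>) \<longrightarrow> t \<prec> b" by blast
qed

text \<open>\<open>c n t\<close> is the colour of \<open>t\<close> when \<open>n\<close> elements are missing: the limit of the colours of
  \<open>t \<union> {x}\<close> as \<open>x\<close> runs through \<open>R (n + 1)\<close>.\<close>

lemma limit_colourings:
  assumes A: "A \<in> S" "unbounded M A" and P: "P \<in> S"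
  shows "\<exists>R c. fm True S (\<lambda>v. R (v 0) (v (Suc 0))) \<and> fm True S (\<lambda>v. c (v 0) (v (Suc 0))) \<and>
    (\<forall>x. R \<zero> x \<longleftrightarrow> x \<in> A) \<and> (\<forall>t. c \<zero> t \<longleftrightarrow> t \<in> P) \<and> (\<forall>n x. R (n \<oplus> \<one>) x \<longrightarrow> R n x) \<and>
    (\<forall>n b. \<exists>x. b \<prec> x \<and> R n x) \<and>
    (\<forall>n t. \<exists>b. \<forall>x. R (n \<oplus> \<one>) x \<longrightarrow> b \<prec> x \<longrightarrow> (\<forall>u. is_insert t x u \<longrightarrow> (c n u \<longleftrightarrow> c (n \<oplus> \<one>) t)))"
proof -
  define join where "join Y Z = {p. \<exists>x. (p = pr \<zero> x \<and> x \<in> Y) \<or> (p = pr \<one> x \<and> x \<in> Z)}" for Y Z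
  have join: "pr \<zero> x \<in> join Y Z \<longleftrightarrow> x \<in> Y" "pr \<one> x \<in> join Y Z \<longleftrightarrow> x \<in> Z" for x Y Z
    unfolding join_def using zero_neq_one by auto
  have join_in: "join Y Z \<in> \<A>" if "arithmetically_closed \<A>" "Y \<in> \<A>" "Z \<in> \<A>" for Y Z \<A>
    unfolding join_def by (rule closedD[OF that(1)]) (intro fm_arith that(2,3))
  obtain U where U: "U \<in> S" and \<A>: "arithmetically_closed (range (projection M U))"
    and X: "join A P \<in> range (projection M U)"
    and pad: "\<And>e b. \<exists>e'. b \<preceq> e' \<and> projection M U e' = projection M U e"
    using coded_closed_family[OF join_in[OF S_closed A(1) P]] by metis
  let ?\<A> = "range (projection M U)"
  \<comment> \<open>Column \<open>e\<close> of \<open>U\<close> holds a whole stage, the set with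
    tag \<open>\<zero>\<close> and the colouring with tag \<open>\<one>\<close>; a stage is thus a
    single number.\<close>
  define R0 where "R0 e x \<longleftrightarrow> pr e (pr \<zero> x) \<in> U" for e x
  define c0 where "c0 e t \<longleftrightarrow> pr e (pr \<one> t) \<in> U" for e t
  have R0: "R0 e x \<longleftrightarrow> pr \<zero> x \<in> projection M U e" and c0: "c0 e t \<longleftrightarrow> pr \<one> t \<in> projection M U e" for e x t
    unfolding R0_def c0_def projection_def by simp_all
  let ?Q = "\<lambda>e t x. \<forall>u. is_insert t x u \<longrightarrow> c0 e u"
  let ?I = "\<lambda>(n :: 'a) e. \<forall>b. \<exists>x. b \<prec> x \<and> R0 e x"
  \<comment> \<open>The colour stored at \<open>e'\<close> is the limit of the colours at
    \<open>e\<close>, and this limit has to exist for every \<open>t\<close>.\<close>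
  let ?\<Phi> = "\<lambda>(n :: 'a) e e'. (\<forall>x. R0 e' x \<longrightarrow> R0 e x) \<and> (\<forall>t. (c0 e' t \<and> (\<exists>b. \<forall>x. R0 e' x \<longrightarrow> b \<prec> x \<longrightarrow> ?Q e t x)) \<or>
    (\<not> c0 e' t \<and> (\<exists>b. \<forall>x. R0 e' x \<longrightarrow> b \<prec> x \<longrightarrow> \<not> ?Q e t x)))"
  obtain e0 where e0: "projection M U e0 = join A P" using X by auto
  have fm\<Phi>: "fm True S (\<lambda>v. ?\<Phi> (v 0) (v (Suc 0)) (v (Suc (Suc 0))))"
    unfolding R0_def c0_def by (intro fm_is_insert fm_arith U)
  have fmI: "fm True S (\<lambda>v. ?I (v 0) (v (Suc 0)))" unfolding R0_def by (intro fm_arith U)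
  have step: "\<exists>e'. e \<preceq> e' \<and> ?\<Phi> n e e' \<and> ?I (n \<oplus> \<one>) e'" if I: "?I n e" for n e :: 'a
  proof -
    let ?Z = "projection M U e"
    have Z: "?Z \<in> ?\<A>" by blast
    define R where "R = {x. R0 e x}"
    have R: "R \<in> ?\<A>" "unbounded M R"
    proof -
      show "R \<in> ?\<A>" unfolding R_def R0 by (rule closedD[OF \<A>]) (intro fm_arith Z)
      show "unbounded M R" unfolding unbounded_def R_def using I by blast
    qed
    have Q: "fm True ?\<A> (\<lambda>v. ?Q e (v 0) (v (Suc 0)))" unfolding c0 by (intro fm_is_insert fm_arith Z)
    from cohesive[OF \<A> R, where Q = "?Q e", OF Q]
    obtain R' where R': "R' \<in> ?\<A>" "unbounded M R'" "R' \<subseteq> R"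
      and lim: "\<forall>t. (\<exists>b. \<forall>x\<in>R'. b \<prec> x \<longrightarrow> ?Q e t x) \<or> (\<exists>b. \<forall>x\<in>R'. b \<prec> x \<longrightarrow> \<not> ?Q e t x)"
      by (elim bexE conjE) (rule that)
    define c' where "c' = {t. \<exists>b. \<forall>x. x \<in> R' \<longrightarrow> b \<prec> x \<longrightarrow> ?Q e t x}"
    have c': "c' \<in> ?\<A>" unfolding c'_def
      by (rule closedD[OF \<A>]) (intro fm_inst2[where R = "?Q e", OF Q] fm_arith R'(1))
    \<comment> \<open>\<open>d\<close> is some index of the next stage; padding replaces it by one
      that is not below \<open>e\<close>, as \<open>dependent_choice\<close> requires.\<close>
    obtain d where "projection M U d = join R' c'" using join_in[OF \<A> R'(1) c'] by auto
    then obtain e' where e': "e \<preceq> e'" "projection M U e' = join R' c'" using pad[of e d] by auto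
    have R0e: "R0 e' x \<longleftrightarrow> x \<in> R'" and c0e: "c0 e' t \<longleftrightarrow> t \<in> c'" for x t
      unfolding R0 c0 e'(2) join by simp_all
    have A1: "\<forall>x. R0 e' x \<longrightarrow> R0 e x" unfolding R0e using R'(3) unfolding R_def by auto
    have A2: "(c0 e' t \<and> (\<exists>b. \<forall>x. R0 e' x \<longrightarrow> b \<prec> x \<longrightarrow> ?Q e t x)) \<or>
      (\<not> c0 e' t \<and> (\<exists>b. \<forall>x. R0 e' x \<longrightarrow> b \<prec> x \<longrightarrow> \<not> ?Q e t x))" for t
    proof (cases "t \<in> c'")
      case True
      then have "\<exists>b. \<forall>x. x \<in> R' \<longrightarrow> b \<prec> x \<longrightarrow> ?Q e t x" unfolding c'_def by (rule CollectD)
      with True show ?thesis unfolding R0e c0e by (intro disjI1 conjI)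
    next
      case False
      then have "\<not> (\<exists>b. \<forall>x. x \<in> R' \<longrightarrow> b \<prec> x \<longrightarrow> ?Q e t x)" unfolding c'_def mem_Collect_eq .
      then have "\<exists>b. \<forall>x. x \<in> R' \<longrightarrow> b \<prec> x \<longrightarrow> \<not> ?Q e t x" using lim[THEN spec, of t] unfolding Ball_def by argo
      with False show ?thesis unfolding R0e c0e by (intro disjI2 conjI)
    qed
    have A3: "?I (n \<oplus> \<one>) e'" using R'(2) unfolding R0e unbounded_def by blast
    show ?thesis
      by (rule exI[of _ e'], intro conjI) (rule e'(1), rule A1, rule allI, rule A2, rule A3)
  qed
  have "?I \<zero> e0" using A(2) unfolding R0 e0 join unbounded_def by blast
  then have "\<exists>f. f \<zero> = e0 \<and> (\<forall>n. ?I n (f n) \<and> ?\<Phi> n (f n) (f (n \<oplus> \<one>))) \<and> fm True S (\<lambda>v. v (Suc 0) = f (v 0))"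
    by (rule dependent_choice[where \<Phi> = ?\<Phi> and I = ?I, OF fm\<Phi> fmI]) (rule step)
  then obtain f where f0: "f \<zero> = e0" and f: "\<forall>n. ?I n (f n) \<and> ?\<Phi> n (f n) (f (n \<oplus> \<one>))"
    and fmf: "fm True S (\<lambda>v. v (Suc 0) = f (v 0))"
    by (elim exE conjE) (rule that)
  note fmf' = fm_inst2[where R = "\<lambda>x y. y = f x", OF fmf]
  \<comment> \<open>\<open>f\<close> is not a term of the language; its value enters through its
    definable graph.\<close>
  have "R0 (f n) x \<longleftrightarrow> (\<exists>e. e = f n \<and> pr e (pr \<zero> x) \<in> U)" for n x by (simp add: R0_def)
  then have fmR: "fm True S (\<lambda>v. R0 (f (v 0)) (v (Suc 0)))"
    by (simp only:) (intro TrueI fm_ex fm_and fmf' fm_mem trm_pair trm_intros U)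
  have "c0 (f n) x \<longleftrightarrow> (\<exists>e. e = f n \<and> pr e (pr \<one> x) \<in> U)" for n x by (simp add: c0_def)
  then have fmc: "fm True S (\<lambda>v. c0 (f (v 0)) (v (Suc 0)))"
    by (simp only:) (intro TrueI fm_ex fm_and fmf' fm_mem trm_pair trm_intros U)
  have lim: "\<exists>b. \<forall>x. R0 (f (n \<oplus> \<one>)) x \<longrightarrow> b \<prec> x \<longrightarrow>
      (\<forall>u. is_insert t x u \<longrightarrow> (c0 (f n) u \<longleftrightarrow> c0 (f (n \<oplus> \<one>)) t))" for n t
  proof -
    have "?\<Phi> n (f n) (f (n \<oplus> \<one>))" using f by blast
    then consider (1) b where "c0 (f (n \<oplus> \<one>)) t" "\<forall>x. R0 (f (n \<oplus> \<one>)) x \<longrightarrow> b \<prec> x \<longrightarrow> ?Q (f n) t x"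
      | (2) b where "\<not> c0 (f (n \<oplus> \<one>)) t" "\<forall>x. R0 (f (n \<oplus> \<one>)) x \<longrightarrow> b \<prec> x \<longrightarrow> \<not> ?Q (f n) t x" by blast
    then show ?thesis
    proof cases
      case 1 then show ?thesis by blast
    next
      case 2
      \<comment> \<open>Failure of the universal \<open>?Q\<close> yields an insertion with the
        other colour; uniqueness of the code identifies it with \<open>u\<close>.\<close>
      have "\<not> c0 (f n) u" if "R0 (f (n \<oplus> \<one>)) x" "b \<prec> x" "is_insert t x u" for x u
        using 2(2) that is_insert_unique[OF that(3)] by blast
      with 2(1) show ?thesis by blast
    qed
  qed
  have R_0: "R0 (f \<zero>) x \<longleftrightarrow> x \<in> A" and c_0: "c0 (f \<zero>) t \<longleftrightarrow> t \<in> P" for x t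
    unfolding f0 R0 c0 e0 join by simp_all
  show ?thesis
    by (rule exI[of _ "\<lambda>n. R0 (f n)"], rule exI[of _ "\<lambda>n. c0 (f n)"])
      (use fmR fmc lim f R_0 c_0 in simp)
qed

section \<open>The set \<open>H\<close> and the colours of its exactly large subsets\<close>

definition deficient :: "'a \<Rightarrow> 'a \<Rightarrow> bool" where
  "deficient t d \<longleftrightarrow> finset_code M t \<and> (\<exists>a j. is_min M a t \<and> has_card M t j \<and> j \<oplus> d = a \<oplus> \<one>)"

lemma fm_deficient: "trm s \<Longrightarrow> trm t \<Longrightarrow> fm True \<V> (\<lambda>v. deficient (s v) (t v))"
  by (rule fm_inst2) (unfold deficient_def, (intro fm_finset_code fm_is_min fm_has_card fm_arith)+)

text \<open>The minimum belongs to \<open>t\<close>, so \<open>t\<close> has at least one element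
  and at most as many are missing as the minimum says. A bound on the elements therefore bounds the
  stages that concern \<open>t\<close>.\<close>

lemma deficient_le:
  assumes "deficient t (d \<oplus> \<one>)" "\<And>x. fmem M x t \<Longrightarrow> x \<preceq> b"
  shows "d \<oplus> \<one> \<preceq> b"
proof -
  obtain a j where a: "is_min M a t" "has_card M t j" "j \<oplus> (d \<oplus> \<one>) = a \<oplus> \<one>"
    using assms(1) unfolding deficient_def by blast
  have at: "fmem M a t" using a(1) unfolding is_min_def by blast
  then have "j \<noteq> \<zero>" using has_card_zero[of t a] a(2) by auto
  then obtain i where "j = i \<oplus> \<one>" using zero_or_suc by blast
  then have "(i \<oplus> (d \<oplus> \<one>)) \<oplus> \<one> = a \<oplus> \<one>" using a(3) by (simp add: suc_add)
  then have "i \<oplus> (d \<oplus> \<one>) = a" unfolding suc_inject .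
  then have "d \<oplus> \<one> \<preceq> a" using le_add1(2)[of "d \<oplus> \<one>" i] by simp
  then show ?thesis using assms(2)[OF at] nn.order.trans by blast
qed

lemma prehomogeneous_set:
  assumes A: "A \<in> S"
    and R: "fm True S (\<lambda>v. R (v 0) (v (Suc 0)))" and c: "fm True S (\<lambda>v. c (v 0) (v (Suc 0)))"
    and R0: "\<And>x. R \<zero> x \<longleftrightarrow> x \<in> A" and Rsuc: "\<And>n x. R (n \<oplus> \<one>) x \<Longrightarrow> R n x"
    and Runb: "\<And>n b. \<exists>x. b \<prec> x \<and> R n x"
    and lim: "\<And>n t. \<exists>b. \<forall>x. R (n \<oplus> \<one>) x \<longrightarrow> b \<prec> x \<longrightarrow> (\<forall>u. is_insert t x u \<longrightarrow> (c n u \<longleftrightarrow> c (n \<oplus> \<one>) t))"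
  shows "\<exists>H\<in>S. unbounded M H \<and> H \<subseteq> A \<and> (\<forall>x\<in>H. \<forall>t d u. deficient t (d \<oplus> \<one>) \<longrightarrow>
    (\<forall>y. fmem M y t \<longrightarrow> y \<in> H \<and> y \<prec> x) \<longrightarrow> is_insert t x u \<longrightarrow> (c d u \<longleftrightarrow> c (d \<oplus> \<one>) t))"
proof -
  note R' = fm_inst2[where R = R, OF R] and c' = fm_inst2[where R = c, OF c]
  have Rmono: "R (m \<oplus> d) x \<longrightarrow> R m x" for m d x
  proof (rule arith_induct[where Q = "\<lambda>d. R (m \<oplus> d) x \<longrightarrow> R m x"])
    show "fm True S (\<lambda>v. R (m \<oplus> v 0) x \<longrightarrow> R m x)" by (intro R' fm_arith)
    show "R (m \<oplus> \<zero>) x \<longrightarrow> R m x" by (simp add: add_zero)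
    show "R (m \<oplus> (d \<oplus> \<one>)) x \<longrightarrow> R m x" if "R (m \<oplus> d) x \<longrightarrow> R m x" for d
      using that Rsuc[of "m \<oplus> d" x] by (simp add: add_suc)
  qed
  define \<Psi> where "\<Psi> s i \<longleftrightarrow> i \<in> A \<and> (\<forall>t d. deficient t (d \<oplus> \<one>) \<longrightarrow> (\<forall>y. fmem M y t \<longrightarrow> fmem M y s) \<longrightarrow>
    (\<forall>u. is_insert t i u \<longrightarrow> (c d u \<longleftrightarrow> c (d \<oplus> \<one>) t)))" for s i
  have "fm True S (\<lambda>v. \<Psi> (v 0) (v (Suc 0)))"
    unfolding \<Psi>_def by (intro c' fm_deficient fm_is_insert fm_arith A)
  from set_recursion[where \<Psi> = \<Psi>, OF S_closed this]
  obtain H where H: "H \<in> S" and rec: "\<And>i. i \<in> H \<longleftrightarrow> \<Psi> (restr H i) i" by auto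
  have "unbounded M H"
  proof (rule ccontr)
    assume "\<not> unbounded M H"
    then obtain b where b: "\<And>x. b \<prec> x \<Longrightarrow> x \<notin> H" unfolding unbounded_def by blast
    define s where "s = restr H (b \<oplus> \<one>)"
    have s: "fmem M y s \<longleftrightarrow> y \<preceq> b \<and> y \<in> H" for y unfolding s_def fmem_restr[OF H] by simp
    obtain B where B: "\<And>t. finset_code M t \<Longrightarrow> \<forall>x. fmem M x t \<longrightarrow> x \<prec> b \<oplus> \<one> \<Longrightarrow> t \<prec> B"
      using subset_code_bound[of "b \<oplus> \<one>"] by auto
    let ?L = "\<lambda>d t y. \<forall>x. R (d \<oplus> \<one>) x \<longrightarrow> y \<prec> x \<longrightarrow> (\<forall>u. is_insert t x u \<longrightarrow> (c d u \<longleftrightarrow> c (d \<oplus> \<one>) t))"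
    have L_mono: "?L d t y'" if L: "?L d t y" and le: "y \<preceq> y'" for d t y y'
    proof (intro allI impI)
      fix x u assume x: "R (d \<oplus> \<one>) x" "y' \<prec> x" "is_insert t x u"
      have "y \<prec> x" using le x(2) by order
      with L x(1,3) show "c d u \<longleftrightarrow> c (d \<oplus> \<one>) t" by blast
    qed
    \<comment> \<open>Collection is used twice: for a bound valid at all stages
      \<open>d \<prec> b\<close>, and then for one valid for all subsets
      \<open>t \<prec> B\<close>.\<close>
    let ?K = "\<lambda>t y. \<forall>d. d \<prec> b \<longrightarrow> ?L d t y"
    have K: "\<exists>y. ?K t y" for t
    proof -
      have "fm True S (\<lambda>v. ?L (v 0) t (v (Suc 0)))" by (intro R' c' fm_is_insert fm_arith)
      from collection[where R = "\<lambda>d y. ?L d t y", OF this lim]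
      obtain y where y: "\<forall>d. d \<prec> b \<longrightarrow> (\<exists>z. z \<prec> y \<and> ?L d t z)" ..
      have "?L d t y" if d: "d \<prec> b" for d
      proof -
        obtain z where z: "z \<prec> y" "?L d t z" using y[THEN spec, THEN mp, OF d] by (elim exE conjE) (rule that)
        show ?thesis by (rule L_mono[OF z(2)]) (simp add: z(1) le_def)
      qed
      then have "?K t y" by blast
      then show ?thesis by (rule exI)
    qed
    have "fm True S (\<lambda>v. ?K (v 0) (v (Suc 0)))" by (intro R' c' fm_is_insert fm_arith)
    from collection[where R = ?K, OF this K]
    obtain y where y: "\<forall>t. t \<prec> B \<longrightarrow> (\<exists>z. z \<prec> y \<and> ?K t z)" ..
    \<comment> \<open>\<open>R b\<close> is contained in every \<open>R (d \<oplus> \<one>)\<close>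
      that matters, since \<open>d \<oplus> \<one> \<preceq> b\<close> by
      \<open>deficient_le\<close>.\<close>
    obtain i where i: "b \<oplus> y \<prec> i" "R b i" using Runb[of "b \<oplus> y" b] by blast
    have bi: "b \<prec> i" "y \<prec> i" using i(1) le_add1(1)[of b y] le_add1(2)[of y b] by order+
    \<comment> \<open>\<open>H\<close> has no elements above \<open>b\<close>, so the recursion at
      \<open>i\<close> sees the fixed set \<open>s\<close>.\<close>
    have "s = restr H i"
    proof (rule restr_eqI[OF H])
      show "finset_code M s" unfolding s_def by (rule restr_code[OF H])
      fix z
      have "z \<preceq> b \<Longrightarrow> z \<prec> i" using bi(1) by order
      moreover have "z \<in> H \<Longrightarrow> z \<preceq> b" using b[of z] nn.not_le by blast
      ultimately show "fmem M z s \<longleftrightarrow> z \<prec> i \<and> z \<in> H" unfolding s by blast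
    qed
    moreover have "\<Psi> s i"
      unfolding \<Psi>_def
    proof (intro conjI allI impI)
      have "R \<zero> i" using Rmono[of \<zero> b i] i(2) by (simp add: zero_add)
      then show "i \<in> A" unfolding R0 .
      fix t d u assume d: "deficient t (d \<oplus> \<one>)" and t: "\<forall>y. fmem M y t \<longrightarrow> fmem M y s" and u: "is_insert t i u"
      have tb: "\<And>x. fmem M x t \<Longrightarrow> x \<preceq> b" using t s by blast
      have db: "d \<oplus> \<one> \<preceq> b" by (rule deficient_le[OF d tb])
      then obtain e where "b = (d \<oplus> \<one>) \<oplus> e" using le_iff_add by blast
      then have Ri: "R (d \<oplus> \<one>) i" using Rmono[of "d \<oplus> \<one>" e i] i(2) by simp
      have "finset_code M t" using d unfolding deficient_def by blast
      then have "t \<prec> B" by (rule B) (simp add: tb)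
      from y[THEN spec, THEN mp, OF this] obtain z where z: "z \<prec> y" "?K t z" by (elim exE conjE) (rule that)
      have "d \<prec> b" using db suc_le_iff by blast
      from z(2)[THEN spec, THEN mp, OF this] have "?L d t z" .
      moreover have "z \<prec> i" using z(1) bi(2) by order
      ultimately show "c d u \<longleftrightarrow> c (d \<oplus> \<one>) t" using Ri u by blast
    qed
    ultimately have "i \<in> H" using rec[of i] by simp
    with b[OF bi(1)] show False by blast
  qed
  moreover have "H \<subseteq> A" using rec unfolding \<Psi>_def by blast
  moreover have "c d u \<longleftrightarrow> c (d \<oplus> \<one>) t"
    if "x \<in> H" "deficient t (d \<oplus> \<one>)" "\<forall>y. fmem M y t \<longrightarrow> y \<in> H \<and> y \<prec> x" "is_insert t x u" for x t d u
  proof -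
    have "\<Psi> (restr H x) x" using rec[of x] that(1) by simp
    moreover have "\<forall>y. fmem M y t \<longrightarrow> fmem M y (restr H x)" using that(3) unfolding fmem_restr[OF H] by blast
    ultimately show ?thesis using that(2,4) unfolding \<Psi>_def by blast
  qed
  ultimately show ?thesis using H by (intro bexI[of _ H] conjI ballI allI impI)
qed

text \<open>Induction on a cutoff \<open>x\<close>: the elements of \<open>s\<close> are added in
  increasing order, and each addition lowers the number \<open>d\<close> of missing elements by one
  without changing the colour. The first nonempty part consists of \<open>a\<close> alone, with
  \<open>a\<close> elements missing; the last is \<open>s\<close>, with none missing.\<close>

lemma colour_of_exactly_large:
  assumes c: "fm True S (\<lambda>v. c (v 0) (v (Suc 0)))" and H: "H \<in> S"
    and hom: "\<And>x t d u. x \<in> H \<Longrightarrow> deficient t (d \<oplus> \<one>) \<Longrightarrow> (\<forall>y. fmem M y t \<longrightarrow> y \<in> H \<and> y \<prec> x) \<Longrightarrow>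
      is_insert t x u \<Longrightarrow> (c d u \<longleftrightarrow> c (d \<oplus> \<one>) t)"
    and s: "finset_code M s" "is_min M a s" "has_card M s (a \<oplus> \<one>)" "\<And>x. fmem M x s \<Longrightarrow> x \<in> H"
    and z: "finset_code M z" "\<And>i. fmem M i z \<longleftrightarrow> i = a"
  shows "c \<zero> s \<longleftrightarrow> c a z"
proof -
  note c' = fm_inst2[where R = c, OF c]
  define E where "E = {x. fmem M x s}"
  have E: "E \<in> S" unfolding E_def by (rule comprehension) (intro fm_arith)
  have aE: "a \<in> E" and amin: "\<And>x. x \<in> E \<Longrightarrow> a \<preceq> x"
    using s(2) unfolding is_min_def E_def le_def by auto
  have EH: "x \<in> E \<Longrightarrow> x \<in> H" for x unfolding E_def by (simp add: s(4))
  let ?r = "\<lambda>t x. finset_code M t \<and> (\<forall>i. fmem M i t \<longleftrightarrow> i \<prec> x \<and> i \<in> E)"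
  let ?Q = "\<lambda>x. a \<prec> x \<longrightarrow> (\<forall>t d j. ?r t x \<longrightarrow> has_card M t j \<longrightarrow> j \<oplus> d = a \<oplus> \<one> \<longrightarrow> (c d t \<longleftrightarrow> c a z))"
  have "?Q x" for x
  proof (rule arith_induct[where Q = ?Q])
    show "fm True S (\<lambda>v. ?Q (v 0))" by (intro c' fm_finset_code fm_has_card fm_arith E)
    show "?Q \<zero>" by simp
    fix x assume IH: "?Q x"
    show "?Q (x \<oplus> \<one>)"
    proof (intro impI allI)
      fix t d j assume ax: "a \<prec> x \<oplus> \<one>" and t: "?r t (x \<oplus> \<one>)" and j: "has_card M t j" "j \<oplus> d = a \<oplus> \<one>"
      have ct: "finset_code M t" and mt: "\<And>i. fmem M i t \<longleftrightarrow> i \<preceq> x \<and> i \<in> E" using t by auto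
      have "fmem M a t" unfolding mt using ax aE by simp
      then have "j \<noteq> \<zero>" using has_card_zero[of t a] j(1) by auto
      then obtain k where k: "j = k \<oplus> \<one>" using zero_or_suc by blast
      have "fm True S (\<lambda>v. v 0 \<in> E)" by (intro fm_arith E)
      from finset_code_exists[where P = "\<lambda>i. i \<in> E", OF this, of x] obtain r where r: "?r r x" ..
      show "c d t \<longleftrightarrow> c a z"
      proof (cases "x = a")
        \<comment> \<open>The cutoff is just above the minimum: \<open>t\<close> has one element, so
          \<open>d = a\<close>.\<close>
        case True
        have "i \<preceq> x \<and> i \<in> E \<longleftrightarrow> i = a" for i
          using amin[of i] aE True nn.order.antisym[of i a] by auto
        then have tz: "t = z" by (intro finset_code_unique[OF ct z(1)]) (simp add: mt z(2))
        have e: "\<not> fmem M i r" for i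
        proof
          assume "fmem M i r"
          then have "i \<prec> a" "a \<preceq> i" using r True amin by auto
          then show False by order
        qed
        have "has_card M r k"
          by (rule has_card_remove[of a r t]) (use e j k tz z(2) in auto)
        then have "k = \<zero>" using e has_card_empty by blast
        then have "\<one> \<oplus> d = \<one> \<oplus> a" using j(2) k by (simp add: add_ac zero_add)
        then have "d = a" by simp
        then show ?thesis using tz by simp
      next
        case False
        then have ax': "a \<prec> x" using ax by (simp add: le_def)
        have rmem: "fmem M i r \<longleftrightarrow> i \<prec> x \<and> i \<in> E" for i using r by simp
        show ?thesis
        proof (cases "x \<in> E")
          case True
          have ins: "fmem M i t \<longleftrightarrow> fmem M i r \<or> i = x" for i
            unfolding mt rmem le_def using True by blast
          have xr: "\<not> fmem M x r" unfolding rmem using less_irrefl by blast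
          have card: "has_card M r k" using has_card_remove[OF xr ins] j(1) k by simp
          have kd: "k \<oplus> (d \<oplus> \<one>) = a \<oplus> \<one>" using j(2) k by (simp add: add_ac)
          have "is_min M a r" unfolding is_min_def rmem using ax' aE amin unfolding le_def by blast
          then have "deficient r (d \<oplus> \<one>)" unfolding deficient_def using r card kd by blast
          moreover have "\<forall>y. fmem M y r \<longrightarrow> y \<in> H \<and> y \<prec> x" unfolding rmem using EH by blast
          moreover have "is_insert r x t" unfolding is_insert_def using ct ins by blast
          ultimately have "c d t \<longleftrightarrow> c (d \<oplus> \<one>) r" by (rule hom[OF EH[OF True]])
          also have "\<dots> \<longleftrightarrow> c a z" using IH ax' r card kd by blast
          finally show ?thesis .
        next
          case False
          have "i \<preceq> x \<and> i \<in> E \<longleftrightarrow> i \<prec> x \<and> i \<in> E" for i using False unfolding le_def by blast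
          then have "?r t x" using ct mt by simp
          then show ?thesis using IH ax' j by blast
        qed
      qed
    qed
  qed
  \<comment> \<open>The code \<open>s\<close> exceeds all its elements, so cutting at
    \<open>s\<close> loses nothing.\<close>
  note Q = this[of s]
  have "a \<prec> s" using fmem_less aE unfolding E_def by simp
  moreover have "?r s s" using s(1) fmem_less unfolding E_def by blast
  moreover have "(a \<oplus> \<one>) \<oplus> \<zero> = a \<oplus> \<one>" by (rule add_zero)
  ultimately show ?thesis using Q s(3) by blast
qed

lemma RT_exactly_large_of_omega_jumps: "RT_exactly_large M"
  unfolding RT_exactly_large_def
proof (intro ballI impI)
  fix A C assume A: "A \<in> S" and C: "C \<in> S" and AC: "unbounded M A \<and> colouring M C"
  define P where "P = {s. pr s \<one> \<in> C}"
  have P: "P \<in> S" unfolding P_def by (rule comprehension) (intro fm_arith C)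
  obtain R c where Rc: "fm True S (\<lambda>v. R (v 0) (v (Suc 0)))" "fm True S (\<lambda>v. c (v 0) (v (Suc 0)))"
    "\<forall>x. R \<zero> x \<longleftrightarrow> x \<in> A" "\<forall>t. c \<zero> t \<longleftrightarrow> t \<in> P" "\<forall>n x. R (n \<oplus> \<one>) x \<longrightarrow> R n x"
    "\<forall>n b. \<exists>x. b \<prec> x \<and> R n x"
    "\<forall>n t. \<exists>b. \<forall>x. R (n \<oplus> \<one>) x \<longrightarrow> b \<prec> x \<longrightarrow> (\<forall>u. is_insert t x u \<longrightarrow> (c n u \<longleftrightarrow> c (n \<oplus> \<one>) t))"
    using limit_colourings[OF A AC[THEN conjunct1] P] by (elim exE conjE) (rule that)
  have "\<exists>H\<in>S. unbounded M H \<and> H \<subseteq> A \<and> (\<forall>x\<in>H. \<forall>t d u. deficient t (d \<oplus> \<one>) \<longrightarrow>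
    (\<forall>y. fmem M y t \<longrightarrow> y \<in> H \<and> y \<prec> x) \<longrightarrow> is_insert t x u \<longrightarrow> (c d u \<longleftrightarrow> c (d \<oplus> \<one>) t))"
    by (rule prehomogeneous_set[where R = R and c = c, OF A Rc(1,2)]) (use Rc(3,5,6,7) in blast)+
  then obtain H where H: "H \<in> S" "unbounded M H" "H \<subseteq> A"
    and hom: "\<forall>x\<in>H. \<forall>t d u. deficient t (d \<oplus> \<one>) \<longrightarrow>
    (\<forall>y. fmem M y t \<longrightarrow> y \<in> H \<and> y \<prec> x) \<longrightarrow> is_insert t x u \<longrightarrow> (c d u \<longleftrightarrow> c (d \<oplus> \<one>) t)"
    by (elim bexE conjE) (rule that)
  note c' = fm_inst2[where R = c, OF Rc(2)]
  \<comment> \<open>The common colour of the exactly large subsets of \<open>H\<close> with minimum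
    \<open>a\<close>, expressed through the code \<open>z\<close> of the singleton of
    \<open>a\<close>.\<close>
  let ?red = "\<lambda>a. \<exists>z. (finset_code M z \<and> (\<forall>i. fmem M i z \<longleftrightarrow> i = a)) \<and> c a z"
  define L where "L b = {a. a \<in> H \<and> (?red a \<longleftrightarrow> b)}" for b
  have L: "L b \<in> S" for b
    unfolding L_def by (rule comprehension) (intro c' fm_finset_code fm_const fm_arith H(1))
  have "\<exists>b. unbounded M (L b)"
  proof (rule ccontr)
    assume "\<nexists>b. unbounded M (L b)"
    then have "\<not> unbounded M (L True)" "\<not> unbounded M (L False)" by simp_all
    then obtain m n where m: "\<And>x. m \<prec> x \<Longrightarrow> x \<notin> L True" and n: "\<And>x. n \<prec> x \<Longrightarrow> x \<notin> L False"
      unfolding unbounded_def by auto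
    obtain x where x: "x \<in> H" "m \<oplus> n \<prec> x" using H(2) unfolding unbounded_def by blast
    have "m \<prec> x" "n \<prec> x" using x(2) le_add1(1)[of m n] le_add1(2)[of n m] by order+
    then have "x \<notin> L True" "x \<notin> L False" using m n by simp_all
    with x(1) show False unfolding L_def by simp
  qed
  then obtain b where b: "unbounded M (L b)" ..
  have LH: "L b \<subseteq> H" unfolding L_def by blast
  have colour: "pr s \<one> \<in> C \<longleftrightarrow> b" if s: "exactly_large M s" "\<forall>x. fmem M x s \<longrightarrow> x \<in> L b" for s
  proof -
    obtain a where a: "is_min M a s" "has_card M s (a \<oplus> \<one>)" and fs: "finset_code M s"
      using s(1) unfolding exactly_large_def by blast
    have aL: "a \<in> L b" using a(1) s(2) unfolding is_min_def by blast
    have "fm True S (\<lambda>v. v 0 = a)" by (intro fm_arith)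
    from finset_code_exists[where P = "\<lambda>i. i = a", OF this, of "a \<oplus> \<one>"]
    obtain z where z: "finset_code M z" "\<forall>i. fmem M i z \<longleftrightarrow> i = a" by (auto simp: le_def)
    have "c \<zero> s \<longleftrightarrow> c a z"
    proof (rule colour_of_exactly_large[where c = c, OF Rc(2) H(1) _ fs a])
      show "c d u \<longleftrightarrow> c (d \<oplus> \<one>) t" if "x \<in> H" "deficient t (d \<oplus> \<one>)"
        "\<forall>y. fmem M y t \<longrightarrow> y \<in> H \<and> y \<prec> x" "is_insert t x u" for x t d u
        using hom that by blast
      show "x \<in> H" if "fmem M x s" for x using that s(2) LH by blast
      show "finset_code M z" by (rule z(1))
      show "fmem M i z \<longleftrightarrow> i = a" for i using z(2) by blast
    qed
    moreover have "c a z \<longleftrightarrow> ?red a"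
    proof
      assume "c a z" with z show "?red a" by blast
    next
      assume "?red a"
      then obtain w where w: "finset_code M w" "\<forall>i. fmem M i w \<longleftrightarrow> i = a" "c a w" by blast
      have "w = z" by (rule finset_code_unique[OF w(1) z(1)]) (simp add: w(2) z(2))
      with w(3) show "c a z" by simp
    qed
    moreover have "?red a \<longleftrightarrow> b" using aL unfolding L_def by blast
    ultimately show ?thesis using Rc(4) unfolding P_def by simp
  qed
  have "homogeneous M C (L b)"
    unfolding homogeneous_def
  \<comment> \<open>\<open>P\<close> records only whether the colour is \<open>\<one>\<close>; that
    the other colour is \<open>\<zero>\<close> comes from \<open>colouring\<close>.\<close>
  proof (intro exI[of _ "if b then \<one> else \<zero>"] allI impI)
    fix s assume s: "exactly_large M s \<and> (\<forall>x. fmem M x s \<longrightarrow> x \<in> L b)"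
    then have col: "pr s \<one> \<in> C \<longleftrightarrow> b" using colour by blast
    have "colouring M C" using AC ..
    then obtain k where k: "pr s k \<in> C" using s unfolding colouring_def by blast
    with \<open>colouring M C\<close> obtain s' k' where "pr s k = pr s' k'" "k' = \<zero> \<or> k' = \<one>"
      unfolding colouring_def by blast
    then have "k = \<zero> \<or> k = \<one>" by simp
    with k col show "pr s (if b then \<one> else \<zero>) \<in> C" by auto
  qed
  with L[of b] b LH H(3) show "\<exists>L\<in>S. unbounded M L \<and> L \<subseteq> A \<and> homogeneous M C L" by blast
qed

end

theorem theorem14:
  fixes M :: "'a l2_structure"
  assumes "RCA0_model M"
    and "\<forall>X \<in> set_part M. \<exists>Y \<in> set_part M. is_omega_jump M X Y"
  shows "RT_exactly_large M"
proof -
  interpret omega_jumps M using assms by unfold_locales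
  show ?thesis by (rule RT_exactly_large_of_omega_jumps)
qed

end
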